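(* Let $\Omega\subset\mathbb{R}^N$ be a bounded $\mathcal{C}^2$ domain, $\alpha>0$, $\alpha+1\le\beta\le\alpha+2$, let $F$ satisfy the structural assumptions described in the context, let $b$ be Hölder continuous, and let $\gamma:\mathbb{R}\to\mathbb{R}$ be a nondecreasing continuous function with $\gamma(0)=0$. Let $f,g$ be continuous and bounded with $g\le f$. Suppose $u$ is a viscosity sub-solution of $-F(\nabla u,D^2u)+b(x)|\nabla u|^\beta+\gamma(u)\le g$ in $\Omega$ and $v$ is a viscosity super-solution of $-F(\nabla v,D^2v)+b(x)|\nabla v|^\beta+\gamma(v)\ge f$ in $\Omega$. If either $g<f$ in $\Omega$ or $\gamma$ is increasing, and $u\le v$ on $\partial\Omega$, then $u\le v$ in $\Omega$.
   Context: $S$ is the space of real symmetric $N\times N$ matrices. $F:S\to\mathbb{R}$ satisfies: there are $0<a<A$ with $a\,\mathrm{tr}(N)\le F(M+N)-F(M)\le A\,\mathrm{tr}(N)$ for all $M,N\in S$, $N\ge0$; and $F(tM)=tF(M)$ for $t>0$. For $p\in\mathbb{R}^N$, $\Theta_\alpha(p)=\mathrm{Diag}(|p_i|^{\alpha/2})$ and $F(p,M):=F(\Theta_\alpha(p)M\Theta_\alpha(p))$. $|\cdot|$ is the Euclidean norm. *)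

theory Defs
  imports "HOL-Analysis.Analysis"
begin

definition symmetric_mat :: "real^'n^'n \<Rightarrow> bool" where
  "symmetric_mat M \<longleftrightarrow> transpose M = M"

definition psd_mat :: "real^'n^'n \<Rightarrow> bool" where
  "psd_mat M \<longleftrightarrow> (\<forall>x. 0 \<le> x \<bullet> (M *v x))"

(* Structural assumptions on F : S -> R (only values on symmetric matrices matter) *)
definition structural_F :: "(real^'n^'n \<Rightarrow> real) \<Rightarrow> real \<Rightarrow> real \<Rightarrow> bool" where
  "structural_F F a A \<longleftrightarrow> 0 < a \<and> a < A \<and>
     (\<forall>M N. symmetric_mat M \<longrightarrow> symmetric_mat N \<longrightarrow> psd_mat N \<longrightarrow>
        a * trace N \<le> F (M + N) - F M \<and> F (M + N) - F M \<le> A * trace N) \<and>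
     (\<forall>M t. symmetric_mat M \<longrightarrow> 0 < t \<longrightarrow> F (t *\<^sub>R M) = t * F M)"

definition Theta :: "real \<Rightarrow> real^'n \<Rightarrow> real^'n^'n" where
  "Theta \<alpha> p = (\<chi> i j. if i = j then \<bar>p $ i\<bar> powr (\<alpha> / 2) else 0)"

definition Fp :: "(real^'n^'n \<Rightarrow> real) \<Rightarrow> real \<Rightarrow> real^'n \<Rightarrow> real^'n^'n \<Rightarrow> real" where
  "Fp F \<alpha> p M = F (Theta \<alpha> p ** M ** Theta \<alpha> p)"

definition C2_on :: "(real^'n) set \<Rightarrow> (real^'n \<Rightarrow> real) \<Rightarrow> (real^'n \<Rightarrow> real^'n)
                      \<Rightarrow> (real^'n \<Rightarrow> real^'n^'n) \<Rightarrow> bool" where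
  "C2_on S \<phi> D\<phi> H\<phi> \<longleftrightarrow>
     (\<forall>x\<in>S. (\<phi> has_derivative (\<lambda>h. D\<phi> x \<bullet> h)) (at x)) \<and>
     (\<forall>x\<in>S. (D\<phi> has_derivative (\<lambda>h. H\<phi> x *v h)) (at x)) \<and>
     continuous_on S H\<phi>"

definition C2_domain :: "(real^'n) set \<Rightarrow> bool" where
  "C2_domain \<Omega> \<longleftrightarrow> open \<Omega> \<and> connected \<Omega> \<and> \<Omega> \<noteq> {} \<and>
     (\<forall>x0\<in>frontier \<Omega>. \<exists>r>0. \<exists>\<psi> D\<psi> H\<psi>. C2_on UNIV \<psi> D\<psi> H\<psi> \<and> D\<psi> x0 \<noteq> 0 \<and>
        \<Omega> \<inter> ball x0 r = {x \<in> ball x0 r. \<psi> x < 0})"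

definition usc_on :: "('a::metric_space) set \<Rightarrow> ('a \<Rightarrow> real) \<Rightarrow> bool" where
  "usc_on S u \<longleftrightarrow> (\<forall>x\<in>S. \<forall>e>0. \<exists>d>0. \<forall>y\<in>S. dist y x < d \<longrightarrow> u y < u x + e)"

definition lsc_on :: "('a::metric_space) set \<Rightarrow> ('a \<Rightarrow> real) \<Rightarrow> bool" where
  "lsc_on S u \<longleftrightarrow> (\<forall>x\<in>S. \<forall>e>0. \<exists>d>0. \<forall>y\<in>S. dist y x < d \<longrightarrow> u x - e < u y)"

definition holder_on :: "('a::metric_space) set \<Rightarrow> ('a \<Rightarrow> real) \<Rightarrow> bool" where
  "holder_on S b \<longleftrightarrow> (\<exists>C \<theta>. 0 < \<theta> \<and> \<theta> \<le> 1 \<and>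
      (\<forall>x\<in>S. \<forall>y\<in>S. \<bar>b x - b y\<bar> \<le> C * dist x y powr \<theta>))"

definition visc_sub ::
  "(real^'n^'n \<Rightarrow> real) \<Rightarrow> real \<Rightarrow> real \<Rightarrow> (real^'n \<Rightarrow> real) \<Rightarrow> (real \<Rightarrow> real)
    \<Rightarrow> (real^'n \<Rightarrow> real) \<Rightarrow> (real^'n) set \<Rightarrow> (real^'n \<Rightarrow> real) \<Rightarrow> bool" where
  "visc_sub F \<alpha> \<beta> b \<gamma> g \<Omega> u \<longleftrightarrow> usc_on \<Omega> u \<and>
     (\<forall>x0\<in>\<Omega>. \<forall>r>0. \<forall>\<phi> D\<phi> H\<phi>. ball x0 r \<subseteq> \<Omega> \<longrightarrow> C2_on (ball x0 r) \<phi> D\<phi> H\<phi> \<longrightarrow>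
        (\<forall>x\<in>ball x0 r. u x - \<phi> x \<le> u x0 - \<phi> x0) \<longrightarrow>
        - Fp F \<alpha> (D\<phi> x0) (H\<phi> x0) + b x0 * norm (D\<phi> x0) powr \<beta> + \<gamma> (u x0) \<le> g x0)"

definition visc_super ::
  "(real^'n^'n \<Rightarrow> real) \<Rightarrow> real \<Rightarrow> real \<Rightarrow> (real^'n \<Rightarrow> real) \<Rightarrow> (real \<Rightarrow> real)
    \<Rightarrow> (real^'n \<Rightarrow> real) \<Rightarrow> (real^'n) set \<Rightarrow> (real^'n \<Rightarrow> real) \<Rightarrow> bool" where
  "visc_super F \<alpha> \<beta> b \<gamma> f \<Omega> v \<longleftrightarrow> lsc_on \<Omega> v \<and>
     (\<forall>x0\<in>\<Omega>. \<forall>r>0. \<forall>\<phi> D\<phi> H\<phi>. ball x0 r \<subseteq> \<Omega> \<longrightarrow> C2_on (ball x0 r) \<phi> D\<phi> H\<phi> \<longrightarrow>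
        (\<forall>x\<in>ball x0 r. v x - \<phi> x \<ge> v x0 - \<phi> x0) \<longrightarrow>
        - Fp F \<alpha> (D\<phi> x0) (H\<phi> x0) + b x0 * norm (D\<phi> x0) powr \<beta> + \<gamma> (v x0) \<ge> f x0)"

end

theory Submission
  imports Defs
begin

text \<open>If \<open>M = max (u - v)\<close> is positive, it is attained inside the domain. Doubling variables with the
  penalty \<open>L * norm (x - y) powr \<kappa>\<close>, \<open>\<kappa> < 1\<close>, gives \<open>u x - v y \<le> M + L * norm (x - y) powr \<kappa>\<close>: the
  concavity of the penalty in the direction \<open>x - y\<close> makes the second order term dominate
  \<open>(b y - b x) * norm p powr \<beta>\<close>, and because \<open>M > 0\<close> no localisation away from the boundary is
  needed. With this estimate for \<open>\<kappa>\<close> close to 1, the gradients \<open>p\<close> in a second doubling, now with the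
  penalty \<open>j / 2 * (norm (x - y))\<^sup>2\<close>, grow so slowly that the term with \<open>b\<close> tends to 0, and the limit
  is a point where \<open>u > v\<close> and \<open>f - g + \<gamma> u - \<gamma> v \<le> 0\<close>. Both doublings rest on the theorem on sums,
  obtained from sup-convolutions, Jensen's contact set argument and Alexandrov's theorem; the latter
  is deduced from Rademacher's theorem applied to the resolvent of the subdifferential.\<close>

section \<open>Lipschitz functions of one variable and directional derivatives\<close>

text \<open>The obstacle is the first order term. The quadratic penalty has gradient p = j (x - y),
  and boundedness of u and v controls only j |x - y|^2, which does not make |x - y|^\<theta>
  |p|^\<beta> small when \<beta> is large compared with the Hoelder exponent \<theta> of b. The
  penalty L |x - y|^\<kappa> scales better: with \<delta> = |x - y|, P = |p| and D = P / \<delta>,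
  its concavity in the direction x - y yields an elliptic gain of order P^\<alpha> D, while for P
  \<ge> 1 the term with b is at most a constant times \<delta>^\<theta> P^(\<alpha>+2) =
  \<delta>^\<theta> (\<delta> P) P^\<alpha> D, and \<delta> P is bounded. So \<beta> \<le> \<alpha>
  + 2 lets the small factor \<delta>^\<theta> decide. The resulting estimate gives |p| \<le> 2 L
  \<delta>^(\<kappa> - 1) in the second doubling, and \<kappa> is taken with (1 - \<kappa>) \<beta>
  < \<theta>. The operator degenerates in every coordinate direction in which p vanishes; the gain
  survives because it is collected along p itself, where the weights are positive.\<close>

lemma lipschitz_right_derivative_ae:
  fixes h :: "real \<Rightarrow> real"
  assumes lip: "\<And>x y. \<bar>h x - h y\<bar> \<le> L * \<bar>x - y\<bar>"
  obtains N where "negligible N"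
    "\<And>x. x \<notin> N \<Longrightarrow> \<exists>l. ((\<lambda>t. (h (x + t) - h x) / t) \<longlongrightarrow> l) (at_right 0)"
proof -
  define K where "K = \<bar>L\<bar> + 1"
  have K: "K > 0" by (simp add: K_def)
  have lipK: "\<bar>h x - h y\<bar> \<le> K * \<bar>x - y\<bar>" for x y
    using lip[of x y] by (simp add: K_def algebra_simps) (smt (verit) mult_right_mono abs_ge_zero abs_ge_self)
  \<comment> \<open>Both K * x + h x and K * x - h x are nondecreasing and continuous, so each has a
    Stieltjes measure, and the two measures sum to 2 * K times Lebesgue measure. Absolute continuity
    of the first is then immediate, and its density minus K is the derivative of h.\<close>
  define H where "H = (\<lambda>x. K * x + h x)"
  define G where "G = (\<lambda>x. K * x - h x)"
  have monoH: "H x \<le> H y" if "x \<le> y" for x y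
    using lipK[of x y] that by (simp add: H_def abs_if algebra_simps split: if_splits)
  have monoG: "G x \<le> G y" if "x \<le> y" for x y
    using lipK[of x y] that by (simp add: G_def abs_if algebra_simps split: if_splits)
  have "K-lipschitz_on UNIV h"
    using lipK K by (auto simp: lipschitz_on_def dist_real_def)
  then have conth: "continuous_on UNIV h"
    by (rule lipschitz_on_continuous_on)
  then have contH: "continuous_on UNIV H" and contG: "continuous_on UNIV G"
    unfolding H_def G_def by (auto intro!: continuous_intros)
  have rcH: "continuous (at_right x) H" and rcG: "continuous (at_right x) G" for x
    using contH contG by (auto simp: continuous_on_eq_continuous_at continuous_at_imp_continuous_at_within)
  let ?\<mu> = "interval_measure H" and ?\<nu> = "interval_measure G"
  have box: "emeasure (interval_measure F) {l<..<u} = ennreal (F u - F l)"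
    if "l \<le> u" "\<And>x y. x \<le> y \<Longrightarrow> F x \<le> F y" "continuous_on UNIV F" for F :: "real \<Rightarrow> real" and l u
  proof -
    have rc: "continuous (at_right x) F" for x
      using that by (auto simp: continuous_on_eq_continuous_at continuous_at_imp_continuous_at_within)
    have "emeasure (interval_measure F) {u} = 0"
      using emeasure_interval_measure_Icc[of u u F] that by simp
    then have "emeasure (interval_measure F) ({l<..u} - {u}) = emeasure (interval_measure F) {l<..u}"
      by (intro emeasure_Diff_null_set) (auto simp: null_sets_def)
    moreover have "{l<..u} - {u} = {l<..<u}" by auto
    ultimately show ?thesis
      using emeasure_interval_measure_Ioc[of l u F] that rc by simp
  qed
  define S where "S = measure_of UNIV (sets borel) (\<lambda>A. ennreal (1 / (2 * K)) * (emeasure ?\<mu> A + emeasure ?\<nu> A))"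
  have sets_S: "sets S = sets borel"
    unfolding S_def by (simp add: sets.sigma_sets_eq[of borel, simplified])
  have emS: "emeasure S A = ennreal (1 / (2 * K)) * (emeasure ?\<mu> A + emeasure ?\<nu> A)" if "A \<in> sets borel" for A
  proof (rule emeasure_measure_of[OF S_def])
    show "countably_additive (sets S) (\<lambda>A. ennreal (1 / (2 * K)) * (emeasure ?\<mu> A + emeasure ?\<nu> A))"
      unfolding countably_additive_def
    proof (intro allI impI)
      fix B :: "nat \<Rightarrow> real set"
      assume B: "range B \<subseteq> sets S" "disjoint_family B" "\<Union> (range B) \<in> sets S"
      then have "(\<Sum>i. emeasure ?\<mu> (B i)) = emeasure ?\<mu> (\<Union> (range B))"
        "(\<Sum>i. emeasure ?\<nu> (B i)) = emeasure ?\<nu> (\<Union> (range B))"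
        by (auto intro!: suminf_emeasure simp: sets_S)
      then show "(\<Sum>i. ennreal (1 / (2 * K)) * (emeasure ?\<mu> (B i) + emeasure ?\<nu> (B i)))
        = ennreal (1 / (2 * K)) * (emeasure ?\<mu> (\<Union> (range B)) + emeasure ?\<nu> (\<Union> (range B)))"
        by (simp add: suminf_add[symmetric])
    qed
  qed (use that sets_S in \<open>auto simp: positive_def\<close>)
  \<comment> \<open>Lebesgue measure is determined by its values on open intervals, and there the
    contributions of h to the two measures cancel.\<close>
  have "lborel = S"
  proof (rule lborel_eqI)
    fix l u :: real
    assume "\<And>b. b \<in> Basis \<Longrightarrow> l \<bullet> b \<le> u \<bullet> b"
    then have lu: "l \<le> u" by simp
    have "emeasure S (box l u) = ennreal (1 / (2 * K)) * (ennreal (H u - H l) + ennreal (G u - G l))"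
      using emS[of "box l u"] box[OF lu monoH contH] box[OF lu monoG contG] by (simp add: box_real)
    also have "\<dots> = ennreal (1 / (2 * K) * ((H u - H l) + (G u - G l)))"
      using monoH[OF lu] monoG[OF lu] K
      by (simp add: ennreal_mult[symmetric] ennreal_plus[symmetric] del: ennreal_plus)
    also have "1 / (2 * K) * ((H u - H l) + (G u - G l)) = u - l"
      using K by (simp add: H_def G_def field_simps)
    finally show "emeasure S (box l u) = (\<Prod>b\<in>Basis. (u - l) \<bullet> b)" by simp
  qed (simp add: sets_S)
  then have "absolutely_continuous lborel ?\<mu>"
    using emS K by (auto simp: absolutely_continuous_def null_sets_def)
  then obtain \<rho>' where \<rho>': "\<rho>' \<in> borel_measurable lborel" "density lborel \<rho>' = ?\<mu>"
    using sigma_finite_measure.Radon_Nikodym[OF sigma_finite_lborel, of ?\<mu>] by auto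
  have fin: "emeasure ?\<mu> {l..u} < \<infinity>" for l u
    by (cases "l \<le> u") (simp_all add: emeasure_interval_measure_Icc monoH contH)
  define \<rho> where "\<rho> = (\<lambda>x. enn2real (\<rho>' x))"
  have \<rho>m: "\<rho> \<in> borel_measurable borel"
    unfolding \<rho>_def using \<rho>'(1) by simp
  have nn: "(\<integral>\<^sup>+x. \<rho>' x * indicator {l..u} x \<partial>lborel) = ennreal (H u - H l)" if "l \<le> u" for l u
  proof -
    have "(\<integral>\<^sup>+x. \<rho>' x * indicator {l..u} x \<partial>lborel) = emeasure ?\<mu> {l..u}"
      using \<rho>' emeasure_density[of \<rho>' lborel "{l..u}"] by simp
    then show ?thesis
      using emeasure_interval_measure_Icc[OF that monoH contH] by simp
  qed
  have int: "(\<rho> has_integral (H u - H l)) {l..u}" if lu: "l \<le> u" for l u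
  proof -
    \<comment> \<open>The density has values in the extended reals; its finite integral over the
      interval makes it finite almost everywhere there, so its real version has the same
      integral.\<close>
    have "AE x in lborel. \<rho>' x * indicator {l..u} x \<noteq> \<infinity>"
      using nn[OF lu] \<rho>'(1) by (intro nn_integral_noteq_infinite) auto
    then have ae: "AE x in lborel. ennreal (\<rho> x * indicator {l..u} x) = \<rho>' x * indicator {l..u} x"
      by eventually_elim (auto simp: \<rho>_def indicator_def ennreal_enn2real_if)
    have "(\<integral>\<^sup>+x. ennreal (\<rho> x * indicator {l..u} x) \<partial>lborel) = ennreal (H u - H l)"
      using nn_integral_cong_AE[OF ae] nn[OF lu] by simp
    then have "((\<lambda>x. \<rho> x * indicator {l..u} x) has_integral (H u - H l)) UNIV"
      using \<rho>m monoH[OF lu] by (intro nn_integral_has_integral) (auto simp: \<rho>_def)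
    moreover have "(\<lambda>x. \<rho> x * indicator {l..u} x) = (\<lambda>x. if x \<in> {l..u} then \<rho> x else 0)"
      by (auto simp: indicator_def)
    ultimately show ?thesis
      by (simp only: has_integral_restrict_UNIV)
  qed
  have "\<rho> integrable_on cbox l u" for l u
    using int[of l u] by (cases "l \<le> u") (auto simp: cbox_interval)
  \<comment> \<open>Lebesgue differentiation with boxes whose lower corner is x. The mean of \<rho>
    over such a box is the right difference quotient of H, which is why the limit is
    one-sided.\<close>
  from integrable_ccontinuous_explicit[OF this] obtain N where N: "negligible N"
    "\<And>x e. \<lbrakk>x \<notin> N; 0 < e\<rbrakk> \<Longrightarrow> \<exists>d>0. \<forall>t. 0 < t \<and> t < d \<longrightarrow>
       norm (integral (cbox x (x + t *\<^sub>R One)) \<rho> /\<^sub>R t ^ DIM(real) - \<rho> x) < e" by metis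
  show thesis
  proof (rule that[OF N(1)])
    fix x assume x: "x \<notin> N"
    have "((\<lambda>t. (h (x + t) - h x) / t) \<longlongrightarrow> \<rho> x - K) (at_right 0)"
    proof (rule tendstoI)
      fix e :: real assume "e > 0"
      from N(2)[OF x this] obtain d where d: "d > 0" "\<And>t. 0 < t \<Longrightarrow> t < d \<Longrightarrow>
       norm (integral (cbox x (x + t *\<^sub>R One)) \<rho> /\<^sub>R t ^ DIM(real) - \<rho> x) < e" by auto
      have "dist ((h (x + t) - h x) / t) (\<rho> x - K) < e" if t: "0 < t" "t < d" for t
      proof -
        have "integral (cbox x (x + t *\<^sub>R One)) \<rho> = H (x + t) - H x"
          using int[of x "x + t"] t by (simp add: cbox_interval integral_unique)
        then have "integral (cbox x (x + t *\<^sub>R One)) \<rho> /\<^sub>R t ^ DIM(real) = (H (x + t) - H x) / t"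
          by (simp add: divide_inverse_commute)
        also have "\<dots> = (h (x + t) - h x) / t + K"
          using t by (simp add: H_def field_simps)
        finally show ?thesis
          using d(2)[OF t] by (simp add: dist_real_def algebra_simps)
      qed
      then show "\<forall>\<^sub>F t in at_right 0. dist ((h (x + t) - h x) / t) (\<rho> x - K) < e"
        using d(1) by (auto simp: eventually_at_right_field)
    qed
    then show "\<exists>l. ((\<lambda>t. (h (x + t) - h x) / t) \<longlongrightarrow> l) (at_right 0)" ..
  qed
qed

text \<open>For a Lipschitz function the existence of a one-sided directional derivative is phrased as a
  Cauchy criterion over rational steps, which makes measurability evident.\<close>
definition right_cauchy :: "('a::euclidean_space \<Rightarrow> real) \<Rightarrow> 'a \<Rightarrow> 'a set" where
  "right_cauchy f v = {x. \<forall>m::nat. \<exists>k::nat. \<forall>s\<in>\<rat> \<inter> {0<..<inverse (Suc k)}. \<forall>t\<in>\<rat> \<inter> {0<..<inverse (Suc k)}.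
     \<bar>(f (x + s *\<^sub>R v) - f x) / s - (f (x + t *\<^sub>R v) - f x) / t\<bar> \<le> inverse (Suc m)}"

lemma right_cauchy_borel:
  fixes f :: "'a::euclidean_space \<Rightarrow> real"
  assumes f: "continuous_on UNIV f"
  shows "right_cauchy f v \<in> sets borel"
proof -
  have m: "(\<lambda>x. f (x + s *\<^sub>R v)) \<in> borel_measurable borel" for s
    by (intro borel_measurable_continuous_onI continuous_on_compose2[OF f] continuous_intros) auto
  have m0: "f \<in> borel_measurable borel"
    by (intro borel_measurable_continuous_onI f)
  have c: "countable (\<rat> \<inter> {0<..<inverse (Suc k)} :: real set)" for k
    by (rule countable_Int1[OF countable_rat])
  have "right_cauchy f v = (\<Inter>m. \<Union>k. \<Inter>s\<in>\<rat> \<inter> {0<..<inverse (Suc k)}. \<Inter>t\<in>\<rat> \<inter> {0<..<inverse (Suc k)}.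
     {x \<in> space borel. \<bar>(f (x + s *\<^sub>R v) - f x) / s - (f (x + t *\<^sub>R v) - f x) / t\<bar> \<le> inverse (Suc m)})"
    unfolding right_cauchy_def by auto
  also have "\<dots> \<in> sets borel"
  proof (rule sets.countable_INT'')
    fix m :: nat
    have A: "{x \<in> space borel. \<bar>(f (x + s *\<^sub>R v) - f x) / s - (f (x + t *\<^sub>R v) - f x) / t\<bar> \<le> inverse (Suc m)} \<in> sets borel"
      for s t
      by (rule borel_measurable_le) (use m m0 in measurable)
    show "(\<Union>k. \<Inter>s\<in>\<rat> \<inter> {0<..<inverse (Suc k)}. \<Inter>t\<in>\<rat> \<inter> {0<..<inverse (Suc k)}.
      {x \<in> space borel. \<bar>(f (x + s *\<^sub>R v) - f x) / s - (f (x + t *\<^sub>R v) - f x) / t\<bar> \<le> inverse (Suc m)}) \<in> sets borel"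
      by (intro sets.countable_UN'' sets.countable_INT'' c A) auto
  qed auto
  finally show ?thesis .
qed

lemma right_cauchyI:
  assumes lim: "((\<lambda>t. (f (x + t *\<^sub>R v) - f x) / t) \<longlongrightarrow> l) (at_right 0)"
  shows "x \<in> right_cauchy f v"
  unfolding right_cauchy_def mem_Collect_eq
proof
  fix m :: nat
  let ?q = "\<lambda>t. (f (x + t *\<^sub>R v) - f x) / t"
  have "\<forall>\<^sub>F t in at_right 0. dist (?q t) l < inverse (Suc m) / 2"
    using lim by (rule tendstoD) simp
  then obtain d where d: "d > 0" "\<And>t. 0 < t \<Longrightarrow> t < d \<Longrightarrow> dist (?q t) l < inverse (Suc m) / 2"
    by (auto simp: eventually_at_right_field)
  obtain k where k: "inverse (Suc k) < d"
    using reals_Archimedean[OF d(1)] by blast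
  have "\<bar>?q s - ?q t\<bar> \<le> inverse (Suc m)"
    if "s \<in> \<rat> \<inter> {0<..<inverse (Suc k)}" "t \<in> \<rat> \<inter> {0<..<inverse (Suc k)}" for s t
  proof -
    have "dist (?q s) l < inverse (Suc m) / 2" "dist (?q t) l < inverse (Suc m) / 2"
      using that k by (intro d(2); simp)+
    then have "dist (?q s) (?q t) < inverse (Suc m)"
      using dist_triangle2[of "?q s" "?q t" l] by linarith
    then show ?thesis by (simp only: dist_real_def)
  qed
  then show "\<exists>k. \<forall>s\<in>\<rat> \<inter> {0<..<inverse (Suc k)}. \<forall>t\<in>\<rat> \<inter> {0<..<inverse (Suc k)}. \<bar>?q s - ?q t\<bar> \<le> inverse (Suc m)"
    by blast
qed

text \<open>Taking the limit along the fixed sequence of steps 1 / (k + 1) makes this a Borel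
  function of x for continuous f, whether or not the limit exists. On
  \<open>right_cauchy f v\<close> it is the one-sided directional derivative.\<close>

definition right_deriv :: "('a::euclidean_space \<Rightarrow> real) \<Rightarrow> 'a \<Rightarrow> 'a \<Rightarrow> real" where
  "right_deriv f v x = lim (\<lambda>k. (f (x + inverse (Suc k) *\<^sub>R v) - f x) / inverse (Suc k))"

text \<open>For fixed x the difference quotient is continuous in the positive step, so the Cauchy
  bound passes from rational to real steps; the limit along the steps 1 / (k + 1) is then the limit
  along all steps.\<close>

lemma right_cauchy_tendsto:
  fixes f :: "'a::euclidean_space \<Rightarrow> real"
  assumes f: "continuous_on UNIV f" and x: "x \<in> right_cauchy f v"
  shows "((\<lambda>t. (f (x + t *\<^sub>R v) - f x) / t) \<longlongrightarrow> right_deriv f v x) (at_right 0)"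
proof -
  let ?q = "\<lambda>t. (f (x + t *\<^sub>R v) - f x) / t"
  have contq: "continuous_on {0<..} ?q"
    by (intro continuous_intros continuous_on_compose2[OF f]) auto
  have approx: "\<exists>s'\<in>\<rat> \<inter> {0<..<d}. \<bar>?q s - ?q s'\<bar> < e" if st: "0 < s" "s < d" "e > 0" for s d e :: real
  proof -
    have "\<exists>\<delta>>0. \<forall>s'\<in>{0<..}. dist s' s < \<delta> \<longrightarrow> dist (?q s') (?q s) < e"
      using contq[unfolded continuous_on_iff] that by auto
    then obtain \<delta> where \<delta>: "\<delta> > 0" "\<And>s'. 0 < s' \<Longrightarrow> dist s' s < \<delta> \<Longrightarrow> dist (?q s') (?q s) < e"
      by auto
    obtain s' where s': "s' \<in> \<rat>" "s < s'" "s' < min d (s + \<delta>)"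
      using Rats_dense_in_real[of s "min d (s + \<delta>)"] st \<delta>(1) by auto
    then show ?thesis
      using \<delta>(2)[of s'] st by (intro bexI[of _ s']) (auto simp: dist_real_def)
  qed
  have cauchy: "\<exists>d>0. \<forall>s t. 0 < s \<and> s < d \<and> 0 < t \<and> t < d \<longrightarrow> \<bar>?q s - ?q t\<bar> \<le> e" if e: "e > 0" for e
  proof -
    obtain m where m: "inverse (Suc m) < e"
      using reals_Archimedean[OF e] by blast
    obtain k :: nat where k: "\<forall>s\<in>\<rat> \<inter> {0<..<inverse (Suc k)}. \<forall>t\<in>\<rat> \<inter> {0<..<inverse (Suc k)}. \<bar>?q s - ?q t\<bar> \<le> inverse (Suc m)"
      using x unfolding right_cauchy_def by blast
    have "\<bar>?q s - ?q t\<bar> \<le> e" if st: "0 < s" "s < inverse (Suc k)" "0 < t" "t < inverse (Suc k)" for s t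
    proof (rule field_le_epsilon)
      fix r :: real assume "r > 0"
      then obtain s' t' where "s' \<in> \<rat> \<inter> {0<..<inverse (Suc k)}" "\<bar>?q s - ?q s'\<bar> < r / 2"
        "t' \<in> \<rat> \<inter> {0<..<inverse (Suc k)}" "\<bar>?q t - ?q t'\<bar> < r / 2"
        using approx[OF st(1,2), of "r / 2"] approx[OF st(3,4), of "r / 2"] by (metis half_gt_zero)
      moreover then have "\<bar>?q s' - ?q t'\<bar> \<le> inverse (Suc m)" using k by blast
      ultimately show "\<bar>?q s - ?q t\<bar> \<le> e + r" using m by linarith
    qed
    then show ?thesis
      by (intro exI[of _ "inverse (Suc k)"]) auto
  qed
  have "Cauchy (\<lambda>k. ?q (inverse (Suc k)))"
    unfolding Cauchy_def
  proof (intro allI impI)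
    fix e :: real assume e: "e > 0"
    then obtain d where d: "d > 0" "\<And>s t. 0 < s \<Longrightarrow> s < d \<Longrightarrow> 0 < t \<Longrightarrow> t < d \<Longrightarrow> \<bar>?q s - ?q t\<bar> \<le> e / 2"
      using cauchy[of "e / 2"] by (metis half_gt_zero)
    obtain M where M: "inverse (Suc M) < d"
      using reals_Archimedean[OF d(1)] by blast
    have "inverse (Suc m) < d" if "m \<ge> M" for m
      using M that by (smt (verit) inverse_le_imp_le le_imp_inverse_le of_nat_0_less_iff of_nat_mono Suc_le_mono zero_less_Suc)
    then have "dist (?q (inverse (Suc m))) (?q (inverse (Suc n))) < e" if "m \<ge> M" "n \<ge> M" for m n
      using d(2)[of "inverse (Suc m)" "inverse (Suc n)"] that e by (simp add: dist_real_def)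
    then show "\<exists>M. \<forall>m\<ge>M. \<forall>n\<ge>M. dist (?q (inverse (Suc m))) (?q (inverse (Suc n))) < e" by blast
  qed
  then have "convergent (\<lambda>k. ?q (inverse (Suc k)))"
    by (simp only: real_Cauchy_convergent)
  then have lim: "(\<lambda>k. ?q (inverse (Suc k))) \<longlonglongrightarrow> right_deriv f v x"
    by (simp only: right_deriv_def convergent_LIMSEQ_iff)
  show ?thesis
  proof (rule tendstoI)
    fix e :: real assume e: "e > 0"
    then obtain d where d: "d > 0" "\<And>s t. 0 < s \<Longrightarrow> s < d \<Longrightarrow> 0 < t \<Longrightarrow> t < d \<Longrightarrow> \<bar>?q s - ?q t\<bar> \<le> e / 2"
      using cauchy[of "e / 2"] by (metis half_gt_zero)
    have "dist (?q t) (right_deriv f v x) < e" if t: "0 < t" "t < d" for t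
    proof -
      have "\<forall>\<^sub>F k in sequentially. inverse (Suc k) < d"
        using LIMSEQ_inverse_real_of_nat d(1) order_tendstoD(2) by blast
      then have "\<forall>\<^sub>F k in sequentially. \<bar>?q t - ?q (inverse (Suc k))\<bar> \<le> e / 2"
        by eventually_elim (use d(2) t in auto)
      moreover have "(\<lambda>k. \<bar>?q t - ?q (inverse (Suc k))\<bar>) \<longlonglongrightarrow> \<bar>?q t - right_deriv f v x\<bar>"
        by (intro tendsto_intros lim)
      ultimately have "\<bar>?q t - right_deriv f v x\<bar> \<le> e / 2"
        by (intro tendsto_upperbound[of _ _ sequentially]) auto
      then show ?thesis using e by (simp add: dist_real_def)
    qed
    then show "\<forall>\<^sub>F t in at_right 0. dist (?q t) (right_deriv f v x) < e"
      using d(1) by (auto simp: eventually_at_right_field)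
  qed
qed

section \<open>Rademacher's theorem\<close>

lemma lipschitz_continuous_on_UNIV:
  fixes f :: "'a::real_normed_vector \<Rightarrow> real"
  assumes lip: "\<And>x y. \<bar>f x - f y\<bar> \<le> L * norm (x - y)"
  shows "continuous_on UNIV f"
proof -
  have "\<bar>L\<bar>-lipschitz_on UNIV f"
  proof (rule lipschitz_onI)
    fix x y
    have "\<bar>f x - f y\<bar> \<le> \<bar>L\<bar> * norm (x - y)"
      using lip[of x y] mult_right_mono[OF abs_ge_self[of L] norm_ge_zero[of "x - y"]] by linarith
    then show "dist (f x) (f y) \<le> \<bar>L\<bar> * dist x y"
      by (simp add: dist_norm)
  qed simp
  then show ?thesis
    by (rule lipschitz_on_continuous_on)
qed

text \<open>Each line in direction v meets the exceptional set in a null set of parameters, by the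
  one-dimensional result. Translation invariance lets the measure of the set be averaged over its
  shifts by t * v with t in [0, 1], and Fubini turns this average into an integral over x of the
  measures of these line sections.\<close>

lemma negligible_right_cauchy_compl:
  fixes f :: "'a::euclidean_space \<Rightarrow> real"
  assumes lip: "\<And>x y. \<bar>f x - f y\<bar> \<le> L * norm (x - y)"
  shows "negligible (- right_cauchy f v)"
proof -
  have cont: "continuous_on UNIV f"
    using lip by (rule lipschitz_continuous_on_UNIV)
  let ?E = "- right_cauchy f v"
  have E: "?E \<in> sets borel"
    using right_cauchy_borel[OF cont, of v] by simp
  have line: "{t. x + t *\<^sub>R v \<in> ?E} \<in> null_sets lborel" for x
  proof -
    have "\<bar>f (x + s *\<^sub>R v) - f (x + t *\<^sub>R v)\<bar> \<le> (L * norm v) * \<bar>s - t\<bar>" for s t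
    proof -
      have "x + s *\<^sub>R v - (x + t *\<^sub>R v) = (s - t) *\<^sub>R v"
        by (simp add: scaleR_diff_left)
      then show ?thesis
        using lip[of "x + s *\<^sub>R v" "x + t *\<^sub>R v"] by (simp add: mult_ac)
    qed
    from lipschitz_right_derivative_ae[OF this] obtain N where N: "negligible N"
      "\<And>s. s \<notin> N \<Longrightarrow> \<exists>l. ((\<lambda>t. (f (x + (s + t) *\<^sub>R v) - f (x + s *\<^sub>R v)) / t) \<longlongrightarrow> l) (at_right 0)"
      by blast
    have "{t. x + t *\<^sub>R v \<in> ?E} \<subseteq> N"
    proof
      fix s assume s: "s \<in> {t. x + t *\<^sub>R v \<in> ?E}"
      show "s \<in> N"
      proof (rule ccontr)
        assume "s \<notin> N"
        then obtain l where "((\<lambda>t. (f (x + (s + t) *\<^sub>R v) - f (x + s *\<^sub>R v)) / t) \<longlongrightarrow> l) (at_right 0)"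
          using N(2) by blast
        then have "x + s *\<^sub>R v \<in> right_cauchy f v"
          by (intro right_cauchyI[where l = l]) (simp add: scaleR_add_left add.assoc)
        then show False using s by simp
      qed
    qed
    then have "negligible {t. x + t *\<^sub>R v \<in> ?E}"
      using N(1) negligible_subset by blast
    moreover have "{t. x + t *\<^sub>R v \<in> ?E} \<in> sets borel"
      using measurable_sets[OF _ E, of "\<lambda>t. x + t *\<^sub>R v" borel]
      by (simp add: vimage_def del: Compl_iff)
    ultimately show ?thesis
      by (simp add: negligible_iff_null_sets null_sets_completion_iff)
  qed
  have meas: "(\<lambda>(x, t). indicator ?E (x + t *\<^sub>R v) * indicator {0..1} t :: ennreal) \<in> borel_measurable (lborel \<Otimes>\<^sub>M lborel)"
  proof -
    have "(\<lambda>p. fst p + snd p *\<^sub>R v) \<in> borel_measurable (lborel \<Otimes>\<^sub>M lborel)"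
      by measurable
    then have "(\<lambda>p. indicator ?E (fst p + snd p *\<^sub>R v) :: ennreal) \<in> borel_measurable (lborel \<Otimes>\<^sub>M lborel)"
      using E by (intro measurable_compose[OF _ borel_measurable_indicator])
    then show ?thesis
      unfolding case_prod_beta by (intro borel_measurable_times_ennreal) auto
  qed
  have "emeasure lborel ?E = (\<integral>\<^sup>+t. emeasure lborel ?E * indicator {0..1::real} t \<partial>lborel)"
    by (subst nn_integral_cmult) auto
  also have "\<dots> = (\<integral>\<^sup>+t. (\<integral>\<^sup>+x. indicator ?E (x + t *\<^sub>R v) * indicator {0..1} t \<partial>lborel) \<partial>lborel)"
  proof (rule nn_integral_cong)
    fix t :: real
    have "(\<integral>\<^sup>+x. indicator ?E (x + t *\<^sub>R v) \<partial>lborel) = (\<integral>\<^sup>+x. indicator ?E x \<partial>distr lborel borel ((+) (t *\<^sub>R v)))"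
      using E by (subst nn_integral_distr) (auto simp: add.commute)
    also have "\<dots> = emeasure lborel ?E"
      using E by (simp add: lborel_distr_plus del: Compl_iff)
    finally have *: "(\<integral>\<^sup>+x. indicator ?E (x + t *\<^sub>R v) \<partial>lborel) = emeasure lborel ?E" .
    have "(\<lambda>x. indicator ?E (x + t *\<^sub>R v) :: ennreal) \<in> borel_measurable lborel"
      using E by (intro measurable_compose[OF _ borel_measurable_indicator]) auto
    then show "emeasure lborel ?E * indicator {0..1} t = (\<integral>\<^sup>+x. indicator ?E (x + t *\<^sub>R v) * indicator {0..1} t \<partial>lborel)"
      by (subst nn_integral_multc) (auto simp: *)
  qed
  also have "\<dots> = (\<integral>\<^sup>+x. (\<integral>\<^sup>+t. indicator ?E (x + t *\<^sub>R v) * indicator {0..1} t \<partial>lborel) \<partial>lborel)"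
    using meas by (intro lborel_pair.Fubini') auto
  also have "\<dots> = (\<integral>\<^sup>+x. 0 \<partial>(lborel :: 'a measure))"
  proof (rule nn_integral_cong)
    fix x :: 'a
    have "AE t in lborel. t \<notin> {t. x + t *\<^sub>R v \<in> ?E}"
      by (rule AE_not_in[OF line])
    then have "(\<integral>\<^sup>+t. indicator ?E (x + t *\<^sub>R v) * indicator {0..1::real} t \<partial>lborel) = (\<integral>\<^sup>+t. 0 \<partial>(lborel :: real measure))"
      by (intro nn_integral_cong_AE) (auto elim!: eventually_mono simp: indicator_def)
    then show "(\<integral>\<^sup>+t. indicator ?E (x + t *\<^sub>R v) * indicator {0..1::real} t \<partial>lborel) = 0" by simp
  qed
  finally have "?E \<in> null_sets lborel"
    using E by (simp add: null_sets_def)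
  then show ?thesis
    using null_sets_completionI negligible_iff_null_sets by blast
qed


lemma AE_not_in_negligible:
  assumes "negligible N" "N \<in> sets borel"
  shows "AE x in lborel. x \<notin> N"
  using assms by (intro AE_not_in) (simp add: negligible_iff_null_sets null_sets_completion_iff)

text \<open>The additivity defect of the one-sided derivative has integral 0 over every box, because
  the corresponding defect of the quotients is an increment under a small translation. Lebesgue
  differentiation then makes it vanish almost everywhere.\<close>

lemma right_deriv_add_ae:
  fixes f :: "'a::euclidean_space \<Rightarrow> real"
  assumes lip: "\<And>x y. \<bar>f x - f y\<bar> \<le> L * norm (x - y)"
  obtains N where "negligible N"
    "\<And>x. x \<notin> N \<Longrightarrow> right_deriv f (v + w) x = right_deriv f v x + right_deriv f w x"
proof -
  have cont: "continuous_on UNIV f"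
    using lip by (rule lipschitz_continuous_on_UNIV)
  have fm [measurable]: "f \<in> borel_measurable borel"
    by (rule borel_measurable_continuous_onI[OF cont])
  define i where "i = (\<lambda>k::nat. inverse (real (Suc k)))"
  have i: "i k > 0" "i k \<le> 1" for k
    by (auto simp: i_def field_simps)
  have i0: "i \<longlonglongrightarrow> 0"
    unfolding i_def by (rule LIMSEQ_inverse_real_of_nat)
  define q where "q = (\<lambda>k u x. (f (x + i k *\<^sub>R u) - f x) / i k)"
  have qm [measurable]: "q k u \<in> borel_measurable borel" for k u
    unfolding q_def by measurable
  have qb: "\<bar>q k u x\<bar> \<le> \<bar>L\<bar> * norm u" for k u x
  proof -
    have "\<bar>f (x + i k *\<^sub>R u) - f x\<bar> \<le> L * (i k * norm u)"
      using lip[of "x + i k *\<^sub>R u" x] i[of k] by simp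
    also have "\<dots> \<le> \<bar>L\<bar> * (i k * norm u)"
      using i[of k] by (intro mult_right_mono) auto
    finally show ?thesis
      using i[of k] by (simp add: q_def abs_divide divide_le_eq mult_ac)
  qed
  have rd: "right_deriv f u x = lim (\<lambda>k. q k u x)" for u x
    by (simp add: right_deriv_def q_def i_def)
  define G where "G = right_cauchy f v \<inter> right_cauchy f w \<inter> right_cauchy f (v + w)"
  have G [measurable]: "G \<in> sets borel"
    unfolding G_def by (intro sets.Int right_cauchy_borel cont)
  have "- G = - right_cauchy f v \<union> - right_cauchy f w \<union> - right_cauchy f (v + w)"
    by (auto simp: G_def)
  then have negG: "negligible (- G)"
    using negligible_right_cauchy_compl[OF lip] by (simp add: negligible_Un)
  have aeG: "AE x in lborel. x \<in> G"
    using AE_not_in_negligible[OF negG] by simp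
  have qlim: "(\<lambda>k. q k u x) \<longlonglongrightarrow> right_deriv f u x" if "x \<in> right_cauchy f u" for u x
  proof -
    have "filterlim i (at_right 0) sequentially"
      using i i0 order.strict_implies_not_eq[OF i(1)] by (auto simp: filterlim_at)
    from filterlim_compose[OF right_cauchy_tendsto[OF cont that] this] show ?thesis
      by (simp add: q_def)
  qed
  \<comment> \<open>The indicator restricts the defect to the points where all three limits exist;
    only there is it bounded by the Lipschitz constant.\<close>
  define e where "e = (\<lambda>x. indicator G x * (right_deriv f (v + w) x - right_deriv f v x - right_deriv f w x))"
  have em [measurable]: "e \<in> borel_measurable borel"
    unfolding e_def rd by measurable
  define s where "s = (\<lambda>k x. q k (v + w) x - q k v x - q k w x)"
  have sm [measurable]: "s k \<in> borel_measurable borel" for k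
    unfolding s_def by measurable
  define C where "C = \<bar>L\<bar> * norm (v + w) + \<bar>L\<bar> * norm v + \<bar>L\<bar> * norm w"
  have C0: "C \<ge> 0" by (simp add: C_def)
  have sb: "\<bar>s k x\<bar> \<le> C" for k x
    using qb[of k "v + w" x] qb[of k v x] qb[of k w x] unfolding s_def C_def by linarith
  have qC: "\<bar>q k w x\<bar> \<le> C" for k x
    using qb[of k w x] mult_nonneg_nonneg[OF abs_ge_zero[of L] norm_ge_zero[of "v + w"]]
      mult_nonneg_nonneg[OF abs_ge_zero[of L] norm_ge_zero[of v]]
    unfolding C_def by linarith
  have slim: "(\<lambda>k. s k x) \<longlonglongrightarrow> e x" if "x \<in> G" for x
    using that unfolding s_def e_def by (auto simp: G_def intro!: tendsto_intros qlim)
  \<comment> \<open>Expanded, the defect is the difference of the quotients in direction w at two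
    points that are i k * v apart.\<close>
  have s_eq: "s k x = q k w (x + i k *\<^sub>R v) - q k w x" for k x
    using i[of k] by (simp add: s_def q_def scaleR_add_right add.assoc diff_divide_distrib)
  have eb: "\<bar>e x\<bar> \<le> C" for x
  proof (cases "x \<in> G")
    case True
    have "(\<lambda>k. \<bar>s k x\<bar>) \<longlonglongrightarrow> \<bar>e x\<bar>"
      by (intro tendsto_intros slim True)
    then show ?thesis
      by (rule LIMSEQ_le_const2) (use sb in auto)
  qed (simp add: e_def C0)
  have intb: "integrable lborel (\<lambda>x. indicator B x * g x)"
    if B: "bounded B" "B \<in> sets borel" and g: "g \<in> borel_measurable borel" "\<And>x. \<bar>g x\<bar> \<le> C" for B :: "'a set" and g :: "'a \<Rightarrow> real"
  proof (rule Bochner_Integration.integrable_bound)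
    show "integrable lborel (\<lambda>x. indicator B x * C)"
      using B emeasure_bounded_finite[OF B(1)] by (intro integrable_mult_left) auto
    show "(\<lambda>x. indicator B x * g x) \<in> borel_measurable lborel"
      using B(2) g(1) by measurable
    show "AE x in lborel. norm (indicator B x * g x) \<le> norm (indicator B x * C)"
      using g(2) C0 by (auto simp: indicator_def)
  qed
  have zero: "(\<integral>x. indicator (cbox a b) x * e x \<partial>lborel) = 0" for a b
  proof -
    let ?B = "cbox a b"
    obtain R where R: "\<And>x. x \<in> ?B \<Longrightarrow> norm x \<le> R"
      using bounded_cbox[of a b] by (auto simp: bounded_iff)
    \<comment> \<open>This ball contains the box and all its translates by i k * v, since i k \<le>
      1; outside it the integrand below is 0.\<close>
    define D where "D = cball (0::'a) (R + norm v)"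
    have l1: "(\<lambda>k. \<integral>x. indicator ?B x * s k x \<partial>lborel) \<longlonglongrightarrow> (\<integral>x. indicator ?B x * e x \<partial>lborel)"
    proof (rule integral_dominated_convergence)
      show "integrable lborel (\<lambda>x. indicator ?B x * C)"
        using intb[of ?B "\<lambda>_. C"] C0 by auto
      show "AE x in lborel. (\<lambda>k. indicator ?B x * s k x) \<longlonglongrightarrow> indicator ?B x * e x"
        using aeG by eventually_elim (intro tendsto_intros slim)
      show "AE x in lborel. norm (indicator ?B x * s k x) \<le> indicator ?B x * C" for k
        using sb by (auto simp: indicator_def)
    qed measurable
    have sint: "(\<integral>x. indicator ?B x * s k x \<partial>lborel) = (\<integral>x. (indicator ?B (x - i k *\<^sub>R v) - indicator ?B x) * q k w x \<partial>lborel)" for k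
    proof -
      have i1: "integrable lborel (\<lambda>x. indicator ?B x * q k w x)"
        by (rule intb) (auto simp: qC)
      have i2: "integrable lborel (\<lambda>x. indicator ?B x * q k w (x + i k *\<^sub>R v))"
        by (rule intb) (auto simp: qC)
      have "(\<integral>x. indicator ?B x * q k w (x + i k *\<^sub>R v) \<partial>lborel)
          = (\<integral>x. indicator ?B (x - i k *\<^sub>R v) * q k w x \<partial>distr lborel borel ((+) (i k *\<^sub>R v)))"
        by (subst integral_distr) (auto simp: add.commute)
      then have eq: "(\<integral>x. indicator ?B x * q k w (x + i k *\<^sub>R v) \<partial>lborel)
          = (\<integral>x. indicator ?B (x - i k *\<^sub>R v) * q k w x \<partial>lborel)"
        by (simp add: lborel_distr_plus)
      have i3: "integrable lborel (\<lambda>x. indicator ?B (x - i k *\<^sub>R v) * q k w x)"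
      proof -
        have "indicator ?B (x - i k *\<^sub>R v) = (indicator ((+) (i k *\<^sub>R v) ` ?B) x :: real)" for x
          by (auto simp: indicator_def image_iff algebra_simps)
        moreover have "integrable lborel (\<lambda>x. indicator ((+) (i k *\<^sub>R v) ` ?B) x * q k w x)"
          by (rule intb) (auto simp: qC bounded_translation cbox_translation[symmetric])
        ultimately show ?thesis by simp
      qed
      show ?thesis
        unfolding s_eq using i1 i2 i3 eq by (simp add: right_diff_distrib left_diff_distrib)
    qed
    \<comment> \<open>The change of variables has moved the shift onto the box. Off the frontier, a
      null set, the two indicators agree for all large k.\<close>
    have l2: "(\<lambda>k. \<integral>x. (indicator ?B (x - i k *\<^sub>R v) - indicator ?B x) * q k w x \<partial>lborel) \<longlonglongrightarrow> (\<integral>x. 0 \<partial>(lborel :: 'a measure))"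
    proof (rule integral_dominated_convergence)
      show "integrable lborel (\<lambda>x. indicator D x * C)"
        using intb[of D "\<lambda>_. C"] C0 by (auto simp: D_def)
      have "negligible (frontier ?B)"
        by (intro negligible_convex_frontier) simp
      then have "AE x in lborel. x \<notin> frontier ?B"
        by (intro AE_not_in_negligible) (auto simp: borel_closed)
      then show "AE x in lborel. (\<lambda>k. (indicator ?B (x - i k *\<^sub>R v) - indicator ?B x) * q k w x) \<longlonglongrightarrow> 0"
      proof eventually_elim
        fix x assume x: "x \<notin> frontier ?B"
        have "(\<lambda>k. x - i k *\<^sub>R v) \<longlonglongrightarrow> x - 0 *\<^sub>R v"
          by (intro tendsto_intros i0)
        then have xl: "(\<lambda>k. x - i k *\<^sub>R v) \<longlonglongrightarrow> x" by simp
        have "\<forall>\<^sub>F k in sequentially. indicator ?B (x - i k *\<^sub>R v) = (indicator ?B x :: real)"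
        proof (cases "x \<in> ?B")
          case True
          then have "x \<in> interior ?B" using x by (simp add: frontier_def)
          then have "\<forall>\<^sub>F k in sequentially. x - i k *\<^sub>R v \<in> interior ?B"
            using xl topological_tendstoD open_interior by blast
          then show ?thesis
            by eventually_elim (use True box_subset_cbox[of a b] in \<open>auto simp: indicator_def\<close>)
        next
          case False
          then have "\<forall>\<^sub>F k in sequentially. x - i k *\<^sub>R v \<in> - ?B"
            using False by (intro topological_tendstoD[OF xl]) (auto simp: open_Compl)
          then show ?thesis
            by eventually_elim (use False in \<open>auto simp: indicator_def\<close>)
        qed
        then have "\<forall>\<^sub>F k in sequentially. (indicator ?B (x - i k *\<^sub>R v) - indicator ?B x) * q k w x = 0"
          by eventually_elim simp
        then show "(\<lambda>k. (indicator ?B (x - i k *\<^sub>R v) - indicator ?B x) * q k w x) \<longlonglongrightarrow> 0"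
          by (rule tendsto_eventually)
      qed
      show "AE x in lborel. norm ((indicator ?B (x - i k *\<^sub>R v) - indicator ?B x) * q k w x) \<le> indicator D x * C" for k
      proof (rule AE_I2)
        fix x
        have nv: "norm (i k *\<^sub>R v) \<le> norm v"
          using i[of k] by (simp add: mult_left_le_one_le)
        show "norm ((indicator ?B (x - i k *\<^sub>R v) - indicator ?B x) * q k w x) \<le> indicator D x * C"
        proof (cases "x \<in> D")
          case True
          then show ?thesis using qC C0 by (auto simp: indicator_def)
        next
          case False
          then have "norm x > R + norm v" by (simp add: D_def)
          moreover have "norm x \<le> norm (x - i k *\<^sub>R v) + norm v"
            using norm_triangle_sub[of x "i k *\<^sub>R v"] nv by linarith
          ultimately have "x \<notin> ?B" "x - i k *\<^sub>R v \<notin> ?B"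
            using R[of x] R[of "x - i k *\<^sub>R v"] norm_ge_zero[of v] by (auto simp del: norm_ge_zero)
          then show ?thesis using C0 by (simp add: indicator_def)
        qed
      qed
    qed measurable
    show ?thesis
      using l1 l2 unfolding sint by (simp add: LIMSEQ_unique)
  qed
  have sie: "set_integrable lborel (cbox a b) e" for a b
    using intb[of "cbox a b" e] eb by (simp add: set_integrable_def)
  have ie: "e integrable_on cbox a b" "integral (cbox a b) e = 0" for a b
    using set_borel_integral_eq_integral[OF sie[of a b]] zero[of a b]
    by (auto simp: set_lebesgue_integral_def)
  \<comment> \<open>At a Lebesgue point the value is a limit of means over boxes, and all these
    means are 0.\<close>
  from integrable_ccontinuous_explicit[OF ie(1)] obtain N where N: "negligible N"
    "\<And>x r. \<lbrakk>x \<notin> N; 0 < r\<rbrakk> \<Longrightarrow> \<exists>d>0. \<forall>h. 0 < h \<and> h < d \<longrightarrow>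
       norm (integral (cbox x (x + h *\<^sub>R One)) e /\<^sub>R h ^ DIM('a) - e x) < r"
    by blast
  have e0: "e x = 0" if x: "x \<notin> N" for x
  proof (rule ccontr)
    assume "e x \<noteq> 0"
    then obtain d where d: "d > 0" "\<And>h. 0 < h \<and> h < d \<Longrightarrow>
       norm (integral (cbox x (x + h *\<^sub>R One)) e /\<^sub>R h ^ DIM('a) - e x) < \<bar>e x\<bar>"
      using N(2)[OF x, of "\<bar>e x\<bar>"] by auto
    show False
      using d(2)[of "d / 2"] d(1) by (simp add: ie(2))
  qed
  show thesis
  proof (rule that)
    show "negligible (N \<union> - G)"
      using N(1) negG by (rule negligible_Un)
    show "right_deriv f (v + w) x = right_deriv f v x + right_deriv f w x" if "x \<notin> N \<union> - G" for x
      using e0[of x] that by (simp add: e_def)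
  qed
qed

text \<open>Compactness of the unit sphere gives finitely many directions of D forming an r-net, on
  which the quotients converge uniformly. The Lipschitz bounds of f and f' carry this to all
  directions at once, which is full differentiability.\<close>

lemma lipschitz_right_deriv_diff:
  fixes f :: "'a::euclidean_space \<Rightarrow> real"
  assumes lip: "\<And>x y. \<bar>f x - f y\<bar> \<le> L * norm (x - y)"
    and D: "closure D = UNIV" and cauchy: "\<And>v. v \<in> D \<Longrightarrow> x \<in> right_cauchy f v"
    and f': "linear f'" "\<And>v. v \<in> D \<Longrightarrow> right_deriv f v x = f' v"
  shows "(f has_derivative f') (at x)"
proof -
  have cont: "continuous_on UNIV f"
    using lip by (rule lipschitz_continuous_on_UNIV)
  have bl: "bounded_linear f'"
    using f'(1) linear_conv_bounded_linear by blast
  from bounded_linear.pos_bounded[OF bl]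
  obtain K where K: "K > 0" "\<And>v. \<bar>f' v\<bar> \<le> K * norm v"
    by (auto simp: mult.commute)
  have "\<exists>d>0. \<forall>y. 0 < norm (y - x) \<and> norm (y - x) < d \<longrightarrow> norm (f y - f x - f' (y - x)) / norm (y - x) < e" if e: "e > 0" for e
  proof -
    \<comment> \<open>Replacing a unit direction by a net direction costs (\<bar>L\<bar> + K) * r =
      e / 4, and the quotient along the net direction another e / 4, so the total stays strictly
      below e.\<close>
    define r where "r = e / (4 * (\<bar>L\<bar> + K))"
    have r: "r > 0" using e K(1) by (simp add: r_def)
    have rLK: "(\<bar>L\<bar> + K) * r = e / 4" using K(1) by (simp add: r_def field_simps)
    have "sphere (0::'a) 1 \<subseteq> (\<Union>v\<in>D. ball v r)"
    proof
      fix u :: 'a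
      have "u \<in> closure D" using D by simp
      then show "u \<in> (\<Union>v\<in>D. ball v r)"
        using r by (auto simp: closure_approachable)
    qed
    then obtain D' where D': "D' \<subseteq> D" "finite D'" "sphere (0::'a) 1 \<subseteq> (\<Union>v\<in>D'. ball v r)"
      using compactE_image[OF compact_sphere, of D "\<lambda>v. ball v r" 0 1] by auto
    have "\<forall>\<^sub>F t in at_right 0. dist ((f (x + t *\<^sub>R v) - f x) / t) (f' v) < e / 4" if "v \<in> D'" for v
      using right_cauchy_tendsto[OF cont cauchy, of v] f'(2)[of v] that D'(1) e
      by (intro tendstoD) auto
    then have "\<forall>\<^sub>F t in at_right 0. \<forall>v\<in>D'. dist ((f (x + t *\<^sub>R v) - f x) / t) (f' v) < e / 4"
      using D'(2) by (intro eventually_ball_finite) auto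
    then obtain d where d: "d > 0"
      "\<And>t v. 0 < t \<Longrightarrow> t < d \<Longrightarrow> v \<in> D' \<Longrightarrow> dist ((f (x + t *\<^sub>R v) - f x) / t) (f' v) < e / 4"
      by (auto simp: eventually_at_right_field)
    have "norm (f y - f x - f' (y - x)) / norm (y - x) < e" if y: "0 < norm (y - x)" "norm (y - x) < d" for y
    proof -
      define t where "t = norm (y - x)"
      define u where "u = (1 / t) *\<^sub>R (y - x)"
      have t: "0 < t" "t < d" using y by (auto simp: t_def)
      have yx: "y = x + t *\<^sub>R u" using t by (simp add: u_def)
      have "norm u = 1" using t by (simp add: u_def t_def)
      then obtain v where v: "v \<in> D'" "norm (v - u) < r"
        using D'(3) by (force simp: dist_norm)
      have a1: "\<bar>f (x + t *\<^sub>R u) - f (x + t *\<^sub>R v)\<bar> \<le> \<bar>L\<bar> * (t * r)"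
      proof -
        have "\<bar>f (x + t *\<^sub>R u) - f (x + t *\<^sub>R v)\<bar> \<le> L * (t * norm (u - v))"
          using lip[of "x + t *\<^sub>R u" "x + t *\<^sub>R v"] t by (simp add: scaleR_diff_right[symmetric])
        also have "\<dots> \<le> \<bar>L\<bar> * (t * r)"
          using v(2) t by (intro mult_mono mult_left_mono) (auto simp: norm_minus_commute)
        finally show ?thesis .
      qed
      have a2: "\<bar>f (x + t *\<^sub>R v) - f x - t * f' v\<bar> \<le> t * (e / 4)"
      proof -
        have "\<bar>(f (x + t *\<^sub>R v) - f x) / t - f' v\<bar> < e / 4"
          using d(2)[OF t v(1)] by (simp add: dist_real_def)
        moreover have "(f (x + t *\<^sub>R v) - f x) / t - f' v = (f (x + t *\<^sub>R v) - f x - t * f' v) / t"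
          using t by (simp add: field_simps)
        ultimately show ?thesis
          using t by (simp add: abs_divide divide_less_eq mult.commute less_imp_le)
      qed
      have a3: "\<bar>t * f' v - t * f' u\<bar> \<le> t * (K * r)"
      proof -
        have "\<bar>f' v - f' u\<bar> \<le> K * norm (v - u)"
          using K(2)[of "v - u"] linear_diff[OF f'(1)] by simp
        also have "\<dots> \<le> K * r" using v(2) K(1) by simp
        finally show ?thesis
          using t by (simp add: right_diff_distrib[symmetric] abs_mult)
      qed
      have "f' (y - x) = t * f' u"
        using yx linear_scale[OF f'(1)] by simp
      then have "norm (f y - f x - f' (y - x)) \<le> \<bar>L\<bar> * (t * r) + t * (e / 4) + t * (K * r)"
        using a1 a2 a3 unfolding yx real_norm_def by linarith
      also have "\<dots> = t * ((\<bar>L\<bar> + K) * r + e / 4)" by (simp add: algebra_simps)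
      also have "\<dots> = t * (e / 2)" by (simp add: rLK)
      also have "\<dots> < t * e" using t e by simp
      finally show ?thesis
        using t unfolding t_def[symmetric] by (simp add: divide_less_eq mult.commute)
    qed
    then show ?thesis using d(1) by blast
  qed
  then show ?thesis
    using bl by (simp add: has_derivative_at')
qed

lemma right_deriv_scale:
  fixes f :: "'a::euclidean_space \<Rightarrow> real"
  assumes f: "continuous_on UNIV f" and x: "x \<in> right_cauchy f v" "x \<in> right_cauchy f (c *\<^sub>R v)" and c: "c > 0"
  shows "right_deriv f (c *\<^sub>R v) x = c * right_deriv f v x"
proof -
  have "filterlim (\<lambda>t. c * t) (at_right 0) (at_right 0)"
    unfolding filterlim_at using c
    by (auto simp: eventually_at_right_field intro!: tendsto_eq_intros exI[of _ 1])
  then have "((\<lambda>t. (f (x + (c * t) *\<^sub>R v) - f x) / (c * t)) \<longlongrightarrow> right_deriv f v x) (at_right 0)"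
    by (rule filterlim_compose[OF right_cauchy_tendsto[OF f x(1)]])
  then have "((\<lambda>t. c * ((f (x + (c * t) *\<^sub>R v) - f x) / (c * t))) \<longlongrightarrow> c * right_deriv f v x) (at_right 0)"
    by (intro tendsto_intros)
  moreover have "c * ((f (x + (c * t) *\<^sub>R v) - f x) / (c * t)) = (f (x + t *\<^sub>R c *\<^sub>R v) - f x) / t" for t
    using c by (simp add: mult.commute)
  ultimately have "((\<lambda>t. (f (x + t *\<^sub>R c *\<^sub>R v) - f x) / t) \<longlongrightarrow> c * right_deriv f v x) (at_right 0)"
    by simp
  then show ?thesis
    using right_cauchy_tendsto[OF f x(2)] by (intro tendsto_unique[of "at_right (0::real)"]) auto
qed

lemma right_deriv_zero: "right_deriv f 0 x = 0"
  by (simp add: right_deriv_def)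

lemma right_deriv_scale_ae:
  fixes f :: "'a::euclidean_space \<Rightarrow> real"
  assumes lip: "\<And>x y. \<bar>f x - f y\<bar> \<le> L * norm (x - y)"
  obtains N where "negligible N" "\<And>x. x \<notin> N \<Longrightarrow> right_deriv f (c *\<^sub>R v) x = c * right_deriv f v x"
proof -
  have cont: "continuous_on UNIV f"
    using lip by (rule lipschitz_continuous_on_UNIV)
  have neg: "negligible (- right_cauchy f u)" for u
    by (rule negligible_right_cauchy_compl[OF lip])
  consider "c = 0" | "c > 0" | "c < 0" by linarith
  then show thesis
  proof cases
    case 1
    then show ?thesis by (intro that[of "{}"]) (auto simp: right_deriv_zero)
  next
    case 2
    show ?thesis
      by (rule that[of "- right_cauchy f v \<union> - right_cauchy f (c *\<^sub>R v)"])
        (use neg negligible_Un right_deriv_scale[OF cont _ _ 2] in auto)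
  next
    case 3
    \<comment> \<open>One-sided derivatives scale directly only by positive factors. For negative c
      the sign is turned by additivity applied to c * v and - c * v, whose sum is 0.\<close>
    obtain N where N: "negligible N"
      "\<And>x. x \<notin> N \<Longrightarrow> right_deriv f (c *\<^sub>R v + (- c) *\<^sub>R v) x = right_deriv f (c *\<^sub>R v) x + right_deriv f ((- c) *\<^sub>R v) x"
      using right_deriv_add_ae[OF lip] by blast
    show ?thesis
    proof (rule that)
      show "negligible (N \<union> (- right_cauchy f v \<union> - right_cauchy f ((- c) *\<^sub>R v)))"
        using N(1) neg negligible_Un by blast
      fix x assume "x \<notin> N \<union> (- right_cauchy f v \<union> - right_cauchy f ((- c) *\<^sub>R v))"
      then show "right_deriv f (c *\<^sub>R v) x = c * right_deriv f v x"
        using N(2)[of x] right_deriv_scale[OF cont, of x v "- c"] 3 by (simp add: right_deriv_zero)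
    qed
  qed
qed

lemma right_deriv_sum_ae:
  fixes f :: "'a::euclidean_space \<Rightarrow> real"
  assumes lip: "\<And>x y. \<bar>f x - f y\<bar> \<le> L * norm (x - y)" and "finite B"
  shows "\<exists>N. negligible N \<and> (\<forall>x. x \<notin> N \<longrightarrow> right_deriv f (\<Sum>b\<in>B. c b *\<^sub>R b) x = (\<Sum>b\<in>B. c b * right_deriv f b x))"
  using \<open>finite B\<close>
proof induction
  case empty
  then show ?case by (intro exI[of _ "{}"]) (simp add: right_deriv_zero)
next
  case (insert b B)
  then obtain N where N: "negligible N"
    "\<And>x. x \<notin> N \<Longrightarrow> right_deriv f (\<Sum>b\<in>B. c b *\<^sub>R b) x = (\<Sum>b\<in>B. c b * right_deriv f b x)" by blast
  obtain N1 where N1: "negligible N1"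
    "\<And>x. x \<notin> N1 \<Longrightarrow> right_deriv f (c b *\<^sub>R b + (\<Sum>b\<in>B. c b *\<^sub>R b)) x = right_deriv f (c b *\<^sub>R b) x + right_deriv f (\<Sum>b\<in>B. c b *\<^sub>R b) x"
    using right_deriv_add_ae[OF lip] by blast
  obtain N2 where N2: "negligible N2" "\<And>x. x \<notin> N2 \<Longrightarrow> right_deriv f (c b *\<^sub>R b) x = c b * right_deriv f b x"
    using right_deriv_scale_ae[OF lip] by blast
  have "negligible (N \<union> (N1 \<union> N2))"
    using N(1) N1(1) N2(1) by (simp add: negligible_Un)
  then show ?case
    using insert.hyps N(2) N1(2) N2(2) by (intro exI[of _ "N \<union> (N1 \<union> N2)"]) simp
qed

text \<open>Linearity in the direction holds off a null set that depends on the direction. It is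
  therefore required only for a countable dense set D of directions, and the partial derivatives
  along the basis supply the candidate for the derivative.\<close>

theorem rademacher:
  fixes f :: "'a::euclidean_space \<Rightarrow> real"
  assumes lip: "\<And>x y. \<bar>f x - f y\<bar> \<le> L * norm (x - y)"
  obtains N where "negligible N" "\<And>x. x \<notin> N \<Longrightarrow> f differentiable (at x)"
proof -
  obtain D :: "'a set" where D: "countable D" "\<And>X. open X \<Longrightarrow> X \<noteq> {} \<Longrightarrow> \<exists>d\<in>D. d \<in> X"
    by (rule countable_dense_setE) blast
  have clD: "closure D = UNIV"
  proof (intro set_eqI iffI UNIV_I)
    fix x :: 'a
    show "x \<in> closure D"
      unfolding closure_approachable
    proof (intro allI impI)
      fix e :: real assume "e > 0"
      then show "\<exists>y\<in>D. dist y x < e"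
        using D(2)[of "ball x e"] by (auto simp: dist_commute)
    qed
  qed
  let ?f' = "\<lambda>x v. \<Sum>b\<in>Basis. (v \<bullet> b) * right_deriv f b x"
  have "\<exists>N. negligible N \<and> (\<forall>x. x \<notin> N \<longrightarrow> right_deriv f v x = ?f' x v)" for v
    using right_deriv_sum_ae[OF lip finite_Basis, of "\<lambda>b. v \<bullet> b"] by (simp add: euclidean_representation)
  then have "\<exists>M. \<forall>v. negligible (M v) \<and> (\<forall>x. x \<notin> M v \<longrightarrow> right_deriv f v x = ?f' x v)"
    by (intro choice allI)
  then obtain M where M: "\<forall>v. negligible (M v) \<and> (\<forall>x. x \<notin> M v \<longrightarrow> right_deriv f v x = ?f' x v)" ..
  let ?N = "(\<Union>v\<in>D. M v \<union> - right_cauchy f v)"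
  have "negligible (M v \<union> - right_cauchy f v)" for v
    using M negligible_right_cauchy_compl[OF lip] by (simp add: negligible_Un)
  then have "negligible ?N"
    unfolding negligible_iff_null_sets by (intro null_sets_UN' D(1)) simp
  moreover have "f differentiable (at x)" if x: "x \<notin> ?N" for x
  proof -
    have "linear (?f' x)"
      by (rule linearI) (simp_all add: inner_add_left sum.distrib sum_distrib_left distrib_right mult.assoc)
    moreover have "v \<in> D \<Longrightarrow> x \<in> right_cauchy f v" "v \<in> D \<Longrightarrow> right_deriv f v x = ?f' x v" for v
      using x M by blast+
    ultimately have "(f has_derivative ?f' x) (at x)"
      by (intro lipschitz_right_deriv_diff[OF lip clD])
    then show ?thesis by (rule differentiableI)
  qed
  ultimately show thesis by (rule that)
qed

corollary rademacher_vector: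
  fixes f :: "'a::euclidean_space \<Rightarrow> 'b::euclidean_space"
  assumes lip: "\<And>x y. norm (f x - f y) \<le> L * norm (x - y)"
  obtains N where "negligible N" "\<And>x. x \<notin> N \<Longrightarrow> f differentiable (at x)"
proof -
  have "\<exists>N. negligible N \<and> (\<forall>x. x \<notin> N \<longrightarrow> (\<lambda>x. f x \<bullet> b) differentiable (at x))" if "b \<in> Basis" for b
  proof -
    have "\<bar>f x \<bullet> b - f y \<bullet> b\<bar> \<le> L * norm (x - y)" for x y
      using Basis_le_norm[OF that, of "f x - f y"] lip[of x y] by (simp add: inner_diff_left)
    then show ?thesis
      by (rule rademacher[of "\<lambda>x. f x \<bullet> b" L]) (intro exI conjI allI impI)
  qed
  then have "\<exists>M. \<forall>b\<in>Basis. negligible (M b) \<and> (\<forall>x. x \<notin> M b \<longrightarrow> (\<lambda>x. f x \<bullet> b) differentiable (at x))"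
    by (intro bchoice ballI)
  then obtain M where M: "\<forall>b\<in>Basis. negligible (M b) \<and> (\<forall>x. x \<notin> M b \<longrightarrow> (\<lambda>x. f x \<bullet> b) differentiable (at x))" ..
  have "negligible (\<Union>b\<in>Basis. M b)"
    using M by (intro negligible_Union) auto
  moreover have "f differentiable (at x)" if "x \<notin> (\<Union>b\<in>Basis. M b)" for x
    using M that by (simp add: differentiable_componentwise_within[of f])
  ultimately show thesis by (rule that)
qed

section \<open>Alexandrov's theorem\<close>

definition is_subgradient :: "('a::real_inner \<Rightarrow> real) \<Rightarrow> 'a \<Rightarrow> 'a \<Rightarrow> bool" where
  "is_subgradient f x q \<longleftrightarrow> (\<forall>y. f x + q \<bullet> (y - x) \<le> f y)"

lemma subgradient_convex_on:
  fixes f :: "'a::real_inner \<Rightarrow> real"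
  assumes "\<And>x. \<exists>q. is_subgradient f x q"
  shows "convex_on UNIV f"
proof (rule convex_onI)
  fix t :: real and x y :: 'a
  assume t: "0 < t" "t < 1"
  let ?m = "(1 - t) *\<^sub>R x + t *\<^sub>R y"
  obtain q where q: "is_subgradient f ?m q" using assms by blast
  have "(1 - t) * (f ?m + q \<bullet> (x - ?m)) + t * (f ?m + q \<bullet> (y - ?m)) \<le> (1 - t) * f x + t * f y"
    using q t unfolding is_subgradient_def by (intro add_mono mult_left_mono) auto
  moreover have "(1 - t) * (f ?m + q \<bullet> (x - ?m)) + t * (f ?m + q \<bullet> (y - ?m)) = f ?m"
    by (simp add: inner_simps algebra_simps)
  ultimately show "f ?m \<le> (1 - t) * f x + t * f y" by simp
qed simp

section \<open>Resolvents of subdifferentials of convex functions\<close>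

lemma subgradient_monotone:
  assumes "is_subgradient f x q" "is_subgradient f x' q'"
  shows "0 \<le> (q - q') \<bullet> (x - x')"
proof -
  have "f x + q \<bullet> (x' - x) \<le> f x'" "f x' + q' \<bullet> (x - x') \<le> f x"
    using assms by (auto simp: is_subgradient_def)
  then show ?thesis by (simp add: inner_simps)
qed

text \<open>The condition \<open>is_subgradient f x (z - x)\<close> says that z lies in x plus the
  subdifferential at x, so x is the resolvent of the subdifferential at z. Monotonicity of
  subgradients and Cauchy-Schwarz give the bound; with z = z' it also gives uniqueness of x.\<close>

lemma resolvent_nonexpansive:
  assumes "is_subgradient f x (z - x)" "is_subgradient f x' (z' - x')"
  shows "norm (x - x') \<le> norm (z - z')"
proof -
  have "0 \<le> ((z - x) - (z' - x')) \<bullet> (x - x')"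
    using subgradient_monotone[OF assms] .
  then have "(x - x') \<bullet> (x - x') \<le> (z - z') \<bullet> (x - x')"
    by (simp add: inner_simps)
  also have "\<dots> \<le> norm (z - z') * norm (x - x')"
    by (rule norm_cauchy_schwarz)
  finally have "norm (x - x') * norm (x - x') \<le> norm (z - z') * norm (x - x')"
    by (simp add: dot_square_norm power2_eq_square)
  then show ?thesis
    by (cases "x = x'") (auto simp: mult_le_cancel_right)
qed

text \<open>The point is the minimiser of f y + |y - z|^2 / 2, and the subgradient inequality is its
  first order optimality condition.\<close>

lemma resolvent_exists:
  fixes f :: "'a::euclidean_space \<Rightarrow> real"
  assumes sub: "\<And>x. \<exists>q. is_subgradient f x q"
  shows "\<exists>x. is_subgradient f x (z - x)"
proof -
  have conv: "convex_on UNIV f" by (rule subgradient_convex_on[OF sub])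
  then have cont: "continuous_on UNIV f"
    by (intro convex_on_continuous) auto
  obtain q where q: "is_subgradient f z q" using sub by blast
  define \<Phi> where "\<Phi> = (\<lambda>y. f y + (norm (y - z))\<^sup>2 / 2)"
  \<comment> \<open>Outside this ball half the squared distance exceeds norm q * norm (y - z), the
    largest decrease that the subgradient q at z allows, so \<Phi> is at least f z there.\<close>
  have "continuous_on (cball z (2 * norm q)) \<Phi>"
    unfolding \<Phi>_def by (intro continuous_intros continuous_on_subset[OF cont]) auto
  then obtain x where x: "x \<in> cball z (2 * norm q)" "\<And>y. y \<in> cball z (2 * norm q) \<Longrightarrow> \<Phi> x \<le> \<Phi> y"
    using continuous_attains_inf[of "cball z (2 * norm q)" \<Phi>] by auto
  have min: "\<Phi> x \<le> \<Phi> y" for y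
  proof (cases "y \<in> cball z (2 * norm q)")
    case True
    then show ?thesis by (rule x(2))
  next
    case False
    then have n: "2 * norm q < norm (y - z)" by (simp add: dist_norm norm_minus_commute)
    have "\<bar>q \<bullet> (y - z)\<bar> \<le> norm q * norm (y - z)" by (rule Cauchy_Schwarz_ineq2)
    also have "\<dots> \<le> norm (y - z) / 2 * norm (y - z)" using n by (intro mult_right_mono) auto
    finally have "f z \<le> \<Phi> y"
      using q[unfolded is_subgradient_def, rule_format, of y] by (simp add: \<Phi>_def power2_eq_square)
    moreover have "\<Phi> x \<le> f z" using x(2)[of z] by (simp add: \<Phi>_def)
    ultimately show ?thesis by simp
  qed
  have "f x + (z - x) \<bullet> (y - x) \<le> f y" for y
  proof -
    \<comment> \<open>Minimality is tested at x + t * (y - x), where f is bounded by convexity;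
      after division by t only the quadratic term still carries t, and t tends to 0.\<close>
    have ineq: "(f x - f y) + (z - x) \<bullet> (y - x) \<le> t * ((norm (y - x))\<^sup>2 / 2)" if t: "0 < t" "t < 1" for t
    proof -
      have eq: "(1 - t) *\<^sub>R x + t *\<^sub>R y = x + t *\<^sub>R (y - x)" by (simp add: algebra_simps)
      have c: "f (x + t *\<^sub>R (y - x)) \<le> (1 - t) * f x + t * f y"
        using convex_onD[OF conv, of t x y] t by (simp add: eq)
      have e: "(norm (x + t *\<^sub>R (y - x) - z))\<^sup>2 = (norm (x - z))\<^sup>2 - 2 * t * ((z - x) \<bullet> (y - x)) + t\<^sup>2 * (norm (y - x))\<^sup>2"
        unfolding power2_norm_eq_inner by (simp add: inner_simps inner_commute power2_eq_square algebra_simps)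
      have "t * ((f x - f y) + (z - x) \<bullet> (y - x)) \<le> t * (t * ((norm (y - x))\<^sup>2 / 2))"
        using min[of "x + t *\<^sub>R (y - x)"] c unfolding \<Phi>_def e
        by (simp add: field_simps power2_eq_square)
      then show ?thesis using t by simp
    qed
    have "((\<lambda>t. t * ((norm (y - x))\<^sup>2 / 2)) \<longlongrightarrow> 0) (at_right 0)"
      by (auto intro!: tendsto_eq_intros)
    moreover have "\<forall>\<^sub>F t in at_right 0. (f x - f y) + (z - x) \<bullet> (y - x) \<le> t * ((norm (y - x))\<^sup>2 / 2)"
      using ineq by (auto simp: eventually_at_right_field intro!: exI[of _ 1])
    ultimately have "(f x - f y) + (z - x) \<bullet> (y - x) \<le> 0"
      by (rule tendsto_lowerbound) auto
    then show ?thesis by simp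
  qed
  then show ?thesis
    unfolding is_subgradient_def by blast
qed

text \<open>On n + 1 equal pieces the linear bounds still add up to A, while the quadratic errors
  add up to B / (n + 1). This serves as a mean value theorem for a function that need not be
  differentiable.\<close>

lemma telescoping_bound:
  fixes k :: "real \<Rightarrow> real"
  assumes k: "\<And>s t. 0 \<le> s \<Longrightarrow> s \<le> t \<Longrightarrow> t \<le> 1 \<Longrightarrow> \<bar>k t - k s\<bar> \<le> A * (t - s) + B * (t - s)\<^sup>2"
  shows "\<bar>k 1 - k 0\<bar> \<le> A"
proof -
  have "\<bar>k 1 - k 0\<bar> \<le> A + B * inverse (real (Suc n))" for n
  proof -
    let ?t = "\<lambda>j. real j / real (Suc n)"
    have "k 1 - k 0 = (\<Sum>j<Suc n. k (?t (Suc j)) - k (?t j))"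
      by (subst sum_lessThan_telescope) simp
    also have "\<bar>\<dots>\<bar> \<le> (\<Sum>j<Suc n. \<bar>k (?t (Suc j)) - k (?t j)\<bar>)"
      by (rule sum_abs)
    also have "\<dots> \<le> (\<Sum>j<Suc n. A * inverse (real (Suc n)) + B * (inverse (real (Suc n)))\<^sup>2)"
    proof (rule sum_mono)
      fix j assume "j \<in> {..<Suc n}"
      then have j: "j < Suc n" by simp
      have "?t (Suc j) - ?t j = inverse (real (Suc n))"
        by (simp add: diff_divide_distrib[symmetric] inverse_eq_divide)
      moreover have "?t j \<le> ?t (Suc j)" by (intro divide_right_mono) auto
      moreover have "?t (Suc j) \<le> 1" using j by simp
      ultimately show "\<bar>k (?t (Suc j)) - k (?t j)\<bar> \<le> A * inverse (real (Suc n)) + B * (inverse (real (Suc n)))\<^sup>2"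
        using k[of "?t j" "?t (Suc j)"] by simp
    qed
    also have "\<dots> = A + B * inverse (real (Suc n))"
    proof -
      have "m * (A * inverse m + B * (inverse m)\<^sup>2) = A + B * inverse m" if "m \<noteq> 0" for m :: real
        using that by (simp add: field_simps power2_eq_square)
      then have "real (Suc n) * (A * inverse (real (Suc n)) + B * (inverse (real (Suc n)))\<^sup>2) = A + B * inverse (real (Suc n))"
        by (metis of_nat_neq_0)
      then show ?thesis by (simp only: sum_constant card_lessThan)
    qed
    finally show ?thesis .
  qed
  moreover have "(\<lambda>n. A + B * inverse (real (Suc n))) \<longlonglongrightarrow> A + B * 0"
    by (intro tendsto_intros LIMSEQ_inverse_real_of_nat)
  ultimately show ?thesis
    by (intro LIMSEQ_le_const[of _ A]) auto
qed

text \<open>A first order expansion of all nearby subgradients is integrated along the segment from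
  x to x + h. Increments of f are squeezed between the subgradients at the two ends of each small
  piece, so k, which is f minus its quadratic model, satisfies the hypothesis of
  \<open>telescoping_bound\<close>.\<close>

lemma second_order_expansion:
  fixes f :: "'a::real_inner \<Rightarrow> real"
  assumes sub: "\<And>x. \<exists>q. is_subgradient f x q" and H: "linear H"
    and est: "\<And>h q'. norm h < d \<Longrightarrow> is_subgradient f (x + h) q' \<Longrightarrow> norm (q' - q - H h) \<le> e * norm h"
    and h: "norm h < d" and e: "e \<ge> 0"
  shows "\<bar>f (x + h) - f x - q \<bullet> h - H h \<bullet> h / 2\<bar> \<le> e * (norm h)\<^sup>2"
proof -
  define k where "k = (\<lambda>s. f (x + s *\<^sub>R h) - s * (q \<bullet> h) - s\<^sup>2 * (H h \<bullet> h / 2))"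
  have gr: "\<bar>q' \<bullet> h - q \<bullet> h - s * (H h \<bullet> h)\<bar> \<le> e * (norm h)\<^sup>2"
    if s: "0 \<le> s" "s \<le> 1" and q': "is_subgradient f (x + s *\<^sub>R h) q'" for s q'
  proof -
    have sh: "norm (s *\<^sub>R h) \<le> norm h" using s by (simp add: mult_left_le_one_le)
    then have "norm (q' - q - H (s *\<^sub>R h)) \<le> e * norm (s *\<^sub>R h)"
      using est[of "s *\<^sub>R h" q'] q' h by simp
    also have "\<dots> \<le> e * norm h" using sh e by (intro mult_left_mono) auto
    finally have n: "norm (q' - q - s *\<^sub>R H h) \<le> e * norm h"
      by (simp add: linear_scale[OF H])
    have "\<bar>(q' - q - s *\<^sub>R H h) \<bullet> h\<bar> \<le> norm (q' - q - s *\<^sub>R H h) * norm h"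
      by (rule Cauchy_Schwarz_ineq2)
    also have "\<dots> \<le> e * norm h * norm h" using n by (intro mult_right_mono) auto
    finally show ?thesis by (simp add: inner_simps power2_eq_square mult.assoc)
  qed
  have "\<bar>k 1 - k 0\<bar> \<le> e * (norm h)\<^sup>2"
  proof (rule telescoping_bound)
    fix s t :: real assume st: "0 \<le> s" "s \<le> t" "t \<le> 1"
    obtain qs qt where qs: "is_subgradient f (x + s *\<^sub>R h) qs" and qt: "is_subgradient f (x + t *\<^sub>R h) qt"
      using sub by blast
    define X where "X = H h \<bullet> h"
    have up: "f (x + t *\<^sub>R h) - f (x + s *\<^sub>R h) \<le> (t - s) * (qt \<bullet> h)"
      using qt[unfolded is_subgradient_def, rule_format, of "x + s *\<^sub>R h"]
      by (simp add: inner_simps algebra_simps)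
    have lo: "(t - s) * (qs \<bullet> h) \<le> f (x + t *\<^sub>R h) - f (x + s *\<^sub>R h)"
      using qs[unfolded is_subgradient_def, rule_format, of "x + t *\<^sub>R h"]
      by (simp add: inner_simps algebra_simps)
    \<comment> \<open>The slope is evaluated at the end t of the piece instead of its midpoint;
      relative to the quadratic model this costs X / 2 * (t - s)^2, which the telescoping
      removes.\<close>
    have "(t - s) * (qt \<bullet> h) \<le> (t - s) * (q \<bullet> h + t * X + e * (norm h)\<^sup>2)"
      using gr[OF _ _ qt] st unfolding X_def by (intro mult_left_mono) auto
    then have "k t - k s \<le> e * (norm h)\<^sup>2 * (t - s) + X / 2 * (t - s)\<^sup>2"
      using up unfolding k_def X_def[symmetric] by (simp add: power2_eq_square field_simps)
    moreover have "(t - s) * (q \<bullet> h + s * X - e * (norm h)\<^sup>2) \<le> (t - s) * (qs \<bullet> h)"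
      using gr[OF _ _ qs] st unfolding X_def by (intro mult_left_mono) auto
    then have "k t - k s \<ge> - (e * (norm h)\<^sup>2 * (t - s)) - X / 2 * (t - s)\<^sup>2"
      using lo unfolding k_def X_def[symmetric] by (simp add: power2_eq_square field_simps)
    moreover have "X / 2 * (t - s)\<^sup>2 \<le> \<bar>X\<bar> / 2 * (t - s)\<^sup>2"
      by (intro mult_right_mono) auto
    ultimately show "\<bar>k t - k s\<bar> \<le> e * (norm h)\<^sup>2 * (t - s) + \<bar>X\<bar> / 2 * (t - s)\<^sup>2"
      by linarith
  qed
  then show ?thesis
    by (simp add: k_def algebra_simps)
qed


text \<open>Between the supporting plane of slope q' and the paraboloid of slope q there is room
  only if (q' - q) \<bullet> k \<le> C |k|^2 for all k. Take k = s * (q' - q) and let s tend to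
  0.\<close>

lemma subgradient_unique_touching:
  fixes f :: "'a::real_inner \<Rightarrow> real"
  assumes q': "is_subgradient f x q'"
    and touch: "\<And>y. f y \<le> f x + q \<bullet> (y - x) + C * (norm (y - x))\<^sup>2"
  shows "q' = q"
proof -
  have le: "(q' - q) \<bullet> k \<le> C * (norm k)\<^sup>2" for k
    using q'[unfolded is_subgradient_def, rule_format, of "x + k"] touch[of "x + k"]
    by (simp add: inner_simps)
  have "(norm (q' - q))\<^sup>2 \<le> s * (C * (norm (q' - q))\<^sup>2)" if s: "s > 0" for s
  proof -
    have "s * (norm (q' - q))\<^sup>2 \<le> s * (s * (C * (norm (q' - q))\<^sup>2))"
      using le[of "s *\<^sub>R (q' - q)"] s by (simp add: power_mult_distrib dot_square_norm power2_eq_square mult_ac)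
    then show ?thesis using s by simp
  qed
  then have "\<forall>\<^sub>F s in at_right 0. (norm (q' - q))\<^sup>2 \<le> s * (C * (norm (q' - q))\<^sup>2)"
    by (auto simp: eventually_at_right_field intro!: exI[of _ 1])
  moreover have "((\<lambda>s. s * (C * (norm (q' - q))\<^sup>2)) \<longlongrightarrow> 0) (at_right (0::real))"
    by (auto intro!: tendsto_eq_intros)
  ultimately have "(norm (q' - q))\<^sup>2 \<le> 0"
    by (intro tendsto_lowerbound[of _ 0 "at_right (0::real)"]) auto
  then show ?thesis by simp
qed

text \<open>Move from x' by a vector k in the direction of q' - q with the length of h = x' - x, and
  compare the plane at x' with the paraboloid at x. The point reached is at distance at most 2 |h|
  from x, whence the factor 4.\<close>

lemma subgradient_lipschitz_touching:
  fixes f :: "'a::real_inner \<Rightarrow> real"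
  assumes q: "is_subgradient f x q" and q': "is_subgradient f x' q'"
    and touch: "\<And>y. f y \<le> f x + q \<bullet> (y - x) + C * (norm (y - x))\<^sup>2" and C: "C \<ge> 0"
  shows "norm (q' - q) \<le> 4 * C * norm (x' - x)"
proof (cases "x' = x \<or> q' = q")
  case True
  then show ?thesis
    using subgradient_unique_touching[OF _ touch] q' C by auto
next
  case False
  define h where "h = x' - x"
  define w where "w = q' - q"
  have h: "norm h > 0" and w: "norm w > 0" using False by (auto simp: h_def w_def)
  define k where "k = (norm h / norm w) *\<^sub>R w"
  have nk: "norm k = norm h" using w by (simp add: k_def)
  have "f x' + q' \<bullet> k \<le> f (x' + k)" "f x + q \<bullet> h \<le> f x'"
    using q'[unfolded is_subgradient_def, rule_format, of "x' + k"]
      q[unfolded is_subgradient_def, rule_format, of x'] by (auto simp: h_def)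
  moreover have "f (x' + k) \<le> f x + q \<bullet> (h + k) + C * (norm (h + k))\<^sup>2"
    using touch[of "x' + k"] by (simp add: h_def algebra_simps)
  moreover have "C * (norm (h + k))\<^sup>2 \<le> C * (2 * norm h)\<^sup>2"
    using norm_triangle_ineq[of h k] nk C by (intro mult_left_mono power_mono) auto
  ultimately have "w \<bullet> k \<le> 4 * C * norm h * norm h"
    by (simp add: w_def inner_simps power2_eq_square)
  moreover have "w \<bullet> k = norm w * norm h"
    using w by (simp add: k_def dot_square_norm power2_eq_square)
  ultimately have "norm w \<le> 4 * C * norm h" using h by simp
  then show ?thesis by (simp add: w_def h_def)
qed

text \<open>Alexandrov's theorem at the points where the convex function is touched from above by a
  paraboloid. The resolvent of the subdifferential is nonexpansive, hence differentiable almost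
  everywhere; the paraboloid makes its derivative injective, so no Sard-type argument is needed.\<close>
theorem alexandrov_touching:
  fixes f :: "'a::euclidean_space \<Rightarrow> real"
  assumes sub: "\<And>x. \<exists>q. is_subgradient f x q"
  obtains N where "negligible N"
    "\<And>x q C. x \<notin> N \<Longrightarrow> (\<And>y. f y \<le> f x + q \<bullet> (y - x) + C * (norm (y - x))\<^sup>2) \<Longrightarrow>
       \<exists>H. linear H \<and> (\<forall>e>0. \<exists>d>0. \<forall>h. norm h < d \<longrightarrow>
         \<bar>f (x + h) - f x - q \<bullet> h - H h \<bullet> h / 2\<bar> \<le> e * (norm h)\<^sup>2)"
proof -
  have "\<exists>P. \<forall>z. is_subgradient f (P z) (z - P z)"
    using resolvent_exists[OF sub] by (intro choice allI)
  then obtain P where P: "\<And>z. is_subgradient f (P z) (z - P z)" by blast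
  have Plip: "norm (P z - P z') \<le> 1 * norm (z - z')" for z z'
    using resolvent_nonexpansive[OF P P] by simp
  obtain N where N: "negligible N" "\<And>z. z \<notin> N \<Longrightarrow> P differentiable (at z)"
    by (rule rademacher_vector[OF Plip]) blast
  \<comment> \<open>The exceptional z are turned into exceptional x = P z; a nonexpansive map sends
    null sets to null sets.\<close>
  have neg: "negligible (P ` N)"
  proof (rule negligible_locally_Lipschitz_image[OF order_refl N(1)])
    fix z
    show "\<exists>T B. open T \<and> z \<in> T \<and> (\<forall>y\<in>N \<inter> T. norm (P y - P z) \<le> B * norm (y - z))"
      using Plip by (intro exI[of _ UNIV] exI[of _ 1]) auto
  qed
  show thesis
  proof (rule that[OF neg])
    fix x q C0
    assume x: "x \<notin> P ` N" and touch0: "\<And>y. f y \<le> f x + q \<bullet> (y - x) + C0 * (norm (y - x))\<^sup>2"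
    define C where "C = \<bar>C0\<bar>"
    have C: "C \<ge> 0" by (simp add: C_def)
    have touch: "f y \<le> f x + q \<bullet> (y - x) + C * (norm (y - x))\<^sup>2" for y
    proof -
      have "C0 * (norm (y - x))\<^sup>2 \<le> C * (norm (y - x))\<^sup>2"
        by (intro mult_right_mono) (auto simp: C_def)
      then show ?thesis using touch0[of y] by linarith
    qed
    have q: "is_subgradient f x q"
      using sub[of x] subgradient_unique_touching[OF _ touch] by auto
    define z where "z = x + q"
    have Puniq: "P (y + p) = y" if "is_subgradient f y p" for y p
      using resolvent_nonexpansive[of f y "y + p" "P (y + p)" "y + p"] that P by simp
    have Pz: "P z = x" unfolding z_def by (rule Puniq[OF q])
    then have "z \<notin> N" using x by blast
    then obtain T where T: "(P has_derivative T) (at z)"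
      using N(2) differentiable_def by blast
    have linT: "linear T" using T has_derivative_linear by blast
    have Tapp: "\<exists>d>0. \<forall>z'. norm (z' - z) < d \<longrightarrow> norm (P z' - x - T (z' - z)) \<le> e * norm (z' - z)" if "e > 0" for e
      using T[unfolded has_derivative_at_alt] that Pz by auto
    define K where "K = 1 + 4 * C"
    have K: "K \<ge> 1" using C by (simp add: K_def)
    \<comment> \<open>The paraboloid at x bounds the variation of subgradients near x, so z' - z =
      (q' - q) + (P z' - x) is controlled by P z' - x. Passing to the derivative T along short steps
      t * v, this becomes the lower bound \<open>Tinj\<close>.\<close>
    have zx: "norm (z' - z) \<le> K * norm (P z' - x)" for z'
    proof -
      have "norm ((z' - P z') - q) \<le> 4 * C * norm (P z' - x)"
        by (rule subgradient_lipschitz_touching[OF q P touch C])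
      moreover have "z' - z = ((z' - P z') - q) + (P z' - x)" by (simp add: z_def)
      ultimately show ?thesis
        using norm_triangle_ineq[of "(z' - P z') - q" "P z' - x"] by (simp add: K_def algebra_simps)
    qed
    have Tinj: "norm v \<le> K * norm (T v)" for v
    proof (cases "v = 0")
      case False
      have "norm v \<le> K * norm (T v) + e * (K * norm v)" if e: "e > 0" for e
      proof -
        obtain d where d: "d > 0" "\<And>z'. norm (z' - z) < d \<Longrightarrow> norm (P z' - x - T (z' - z)) \<le> e * norm (z' - z)"
          using Tapp[OF e] by blast
        define t where "t = d / (2 * norm v)"
        have t: "t > 0" "t * norm v < d" using False d(1) by (auto simp: t_def)
        let ?z' = "z + t *\<^sub>R v"
        have "norm (P ?z' - x - t *\<^sub>R T v) \<le> e * (t * norm v)"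
          using d(2)[of ?z'] t by (simp add: linear_scale[OF linT])
        moreover have "norm (P ?z' - x) \<le> norm (P ?z' - x - t *\<^sub>R T v) + norm (t *\<^sub>R T v)"
          by (metis diff_add_cancel norm_triangle_ineq)
        ultimately have "norm (P ?z' - x) \<le> t * (e * norm v + norm (T v))"
          using t by (simp add: algebra_simps)
        then have "K * norm (P ?z' - x) \<le> K * (t * (e * norm v + norm (T v)))"
          using K by (intro mult_left_mono) auto
        moreover have "t * norm v \<le> K * norm (P ?z' - x)"
          using zx[of ?z'] t by simp
        ultimately have "t * norm v \<le> t * (K * norm (T v) + e * (K * norm v))"
          by (simp add: algebra_simps)
        then show ?thesis using t by simp
      qed
      then have "\<forall>\<^sub>F e in at_right 0. norm v \<le> K * norm (T v) + e * (K * norm v)"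
        by (auto simp: eventually_at_right_field intro!: exI[of _ 1])
      moreover have "((\<lambda>e. K * norm (T v) + e * (K * norm v)) \<longlongrightarrow> K * norm (T v)) (at_right (0::real))"
        by (auto intro!: tendsto_eq_intros)
      ultimately show ?thesis
        by (intro tendsto_lowerbound[of _ _ "at_right (0::real)"]) auto
    qed (use linear_0[OF linT] in simp)
    have "inj T"
    proof (rule linear_injective_0[OF linT, THEN iffD2], intro allI impI)
      fix v assume "T v = 0"
      then show "v = 0" using Tinj[of v] by simp
    qed
    then obtain S where S: "linear S" "\<And>v. S (T v) = v" "\<And>v. T (S v) = v"
      using linear_injective_isomorphism[OF linT] by blast
    \<comment> \<open>P inverts the identity plus the subdifferential, so S, the inverse of T, is
      the derivative of that sum, and S minus the identity is the Hessian.\<close>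
    define H where "H = (\<lambda>h. S h - h)"
    have linH: "linear H"
      unfolding H_def by (intro linear_compose_sub S(1) linear_id[unfolded id_def])
    have Sb: "norm (S y) \<le> K * norm y" for y
      using Tinj[of "S y"] by (simp add: S(3))
    have "\<exists>d>0. \<forall>h. norm h < d \<longrightarrow> \<bar>f (x + h) - f x - q \<bullet> h - H h \<bullet> h / 2\<bar> \<le> e * (norm h)\<^sup>2" if e: "e > 0" for e
    proof -
      \<comment> \<open>One factor K comes from |z' - z| \<le> K |h|, the other from |S y| \<le> K
        |y|.\<close>
      define e' where "e' = e / (K * K)"
      have e': "e' > 0" using e K by (simp add: e'_def)
      obtain d where d: "d > 0" "\<And>z'. norm (z' - z) < d \<Longrightarrow> norm (P z' - x - T (z' - z)) \<le> e' * norm (z' - z)"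
        using Tapp[OF e'] by blast
      have est: "norm (q' - q - H h) \<le> e * norm h"
        if h: "norm h < d / K" and q': "is_subgradient f (x + h) q'" for h q'
      proof -
        define z' where "z' = x + h + q'"
        have Pz': "P z' = x + h" unfolding z'_def by (rule Puniq[OF q'])
        have z1: "norm (z' - z) \<le> K * norm h" using zx[of z'] by (simp add: Pz')
        also have "\<dots> < d" using h K by (simp add: field_simps)
        finally have "norm (h - T (z' - z)) \<le> e' * norm (z' - z)"
          using d(2)[of z'] by (simp add: Pz')
        also have "\<dots> \<le> e' * (K * norm h)" using z1 e' by simp
        finally have "K * norm (h - T (z' - z)) \<le> K * (e' * (K * norm h))"
          using K by simp
        also have "\<dots> = e * norm h" using K by (simp add: e'_def)
        finally have "norm (S (h - T (z' - z))) \<le> e * norm h"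
          using Sb[of "h - T (z' - z)"] by linarith
        moreover have "S (h - T (z' - z)) = - (q' - q - H h)"
          by (simp add: linear_diff[OF S(1)] S(2) H_def z'_def z_def)
        ultimately show ?thesis by (simp only: norm_minus_cancel)
      qed
      have "\<bar>f (x + h) - f x - q \<bullet> h - H h \<bullet> h / 2\<bar> \<le> e * (norm h)\<^sup>2" if "norm h < d / K" for h
        using second_order_expansion[OF sub linH est that] e by simp
      then show ?thesis using d(1) K by (intro exI[of _ "d / K"]) auto
    qed
    then show "\<exists>H. linear H \<and> (\<forall>e>0. \<exists>d>0. \<forall>h. norm h < d \<longrightarrow>
         \<bar>f (x + h) - f x - q \<bullet> h - H h \<bullet> h / 2\<bar> \<le> e * (norm h)\<^sup>2)"
      using linH by blast
  qed
qed

section \<open>Jensen's lemma and sup-convolutions\<close>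

lemma usc_on_attains_max:
  fixes u :: "'a::metric_space \<Rightarrow> real"
  assumes D: "compact D" "D \<noteq> {}" and u: "usc_on D u"
  obtains x where "x \<in> D" "\<And>y. y \<in> D \<Longrightarrow> u y \<le> u x"
proof -
  have "\<exists>x\<in>D. \<forall>y\<in>D. u y \<le> u x"
  proof (rule ccontr)
    assume "\<not> ?thesis"
    then have "\<forall>x\<in>D. \<exists>y\<in>D. u x < u y" by (auto simp: not_le)
    then obtain Y where Y: "\<And>x. x \<in> D \<Longrightarrow> Y x \<in> D" "\<And>x. x \<in> D \<Longrightarrow> u x < u (Y x)" by metis
    have "\<forall>x\<in>D. \<exists>d>0. \<forall>z\<in>D. dist z x < d \<longrightarrow> u z < u (Y x)"
    proof
      fix x assume x: "x \<in> D"
      show "\<exists>d>0. \<forall>z\<in>D. dist z x < d \<longrightarrow> u z < u (Y x)"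
        using u[unfolded usc_on_def, rule_format, of x "u (Y x) - u x"] Y(2)[OF x] x by auto
    qed
    then obtain d where d: "\<And>x. x \<in> D \<Longrightarrow> d x > 0"
      "\<And>x z. x \<in> D \<Longrightarrow> z \<in> D \<Longrightarrow> dist z x < d x \<Longrightarrow> u z < u (Y x)" by metis
    have cover: "D \<subseteq> (\<Union>x\<in>D. ball x (d x))" using d(1) by force
    obtain C where C: "C \<subseteq> D" "finite C" "D \<subseteq> (\<Union>x\<in>C. ball x (d x))"
      by (rule compactE_image[OF D(1) _ cover]) auto
    have "C \<noteq> {}" using C(3) D(2) by auto
    define c where "c = Max ((\<lambda>x. u (Y x)) ` C)"
    have "c \<in> (\<lambda>x. u (Y x)) ` C"
      unfolding c_def using C(2) \<open>C \<noteq> {}\<close> by (intro Max_in) auto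
    then obtain x where x: "x \<in> C" "u (Y x) = c" by auto
    then have "Y x \<in> D" using C(1) Y(1) by blast
    then obtain x' where x': "x' \<in> C" "dist (Y x) x' < d x'"
      using C(3) by (auto simp: dist_commute)
    have "u (Y x) < u (Y x')" using d(2)[of x' "Y x"] x' C(1) \<open>Y x \<in> D\<close> by blast
    moreover have "u (Y x') \<le> c"
      unfolding c_def using C(2) x'(1) by (intro Max_ge) auto
    ultimately show False using x(2) by simp
  qed
  then show thesis using that by blast
qed

lemma usc_on_add_continuous:
  assumes u: "usc_on D u" and c: "continuous_on D c"
  shows "usc_on D (\<lambda>x. u x + c x)"
  unfolding usc_on_def
proof (intro ballI allI impI)
  fix x :: 'a and e :: real assume x: "x \<in> D" and e: "e > 0"
  obtain d1 where d1: "d1 > 0" "\<And>y. y \<in> D \<Longrightarrow> dist y x < d1 \<Longrightarrow> u y < u x + e / 2"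
    using u[unfolded usc_on_def, rule_format, OF x, of "e / 2"] e by auto
  obtain d2 where d2: "d2 > 0" "\<And>y. y \<in> D \<Longrightarrow> dist y x < d2 \<Longrightarrow> dist (c y) (c x) < e / 2"
    using c[unfolded continuous_on_iff, rule_format, OF x, of "e / 2"] e by auto
  have "u y + c y < u x + c x + e" if y: "y \<in> D" "dist y x < min d1 d2" for y
  proof -
    have "u y < u x + e / 2" "\<bar>c y - c x\<bar> < e / 2"
      using d1(2)[of y] d2(2)[of y] y unfolding dist_real_def by auto
    then show ?thesis by linarith
  qed
  then show "\<exists>d>0. \<forall>y\<in>D. dist y x < d \<longrightarrow> u y + c y < u x + c x + e"
    using d1(1) d2(1) by (intro exI[of _ "min d1 d2"]) auto
qed

lemma semiconvex_imp_subgradient: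
  fixes U :: "'a::real_inner \<Rightarrow> real"
  assumes "\<And>y. U x + q \<bullet> (y - x) - C / 2 * (norm (y - x))\<^sup>2 \<le> U y"
  shows "is_subgradient (\<lambda>x. U x + C / 2 * (norm x)\<^sup>2) x (q + C *\<^sub>R x)"
  unfolding is_subgradient_def
proof
  fix y
  have "C / 2 * (norm (y - x))\<^sup>2 = C / 2 * ((norm y)\<^sup>2 - 2 * (x \<bullet> y) + (norm x)\<^sup>2)" "(norm x)\<^sup>2 = x \<bullet> x"
    unfolding power2_norm_eq_inner by (simp_all add: inner_simps inner_commute)
  then show "U x + C / 2 * (norm x)\<^sup>2 + (q + C *\<^sub>R x) \<bullet> (y - x) \<le> U y + C / 2 * (norm y)\<^sup>2"
    using assms[of y] by (simp add: inner_simps algebra_simps)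
qed

lemma touching_add_square:
  fixes U :: "'a::real_inner \<Rightarrow> real"
  assumes "U y \<le> U x + p \<bullet> (y - x) + c * (norm (y - x))\<^sup>2"
  shows "U y + C / 2 * (norm y)\<^sup>2 \<le> U x + C / 2 * (norm x)\<^sup>2 + (p + C *\<^sub>R x) \<bullet> (y - x) + (c + C / 2) * (norm (y - x))\<^sup>2"
proof -
  have "C / 2 * (norm (y - x))\<^sup>2 = C / 2 * ((norm y)\<^sup>2 - 2 * (x \<bullet> y) + (norm x)\<^sup>2)" "(norm x)\<^sup>2 = x \<bullet> x"
    unfolding power2_norm_eq_inner by (simp_all add: inner_simps inner_commute)
  then show ?thesis
    using assms by (simp add: inner_simps algebra_simps)
qed

text \<open>Let E be the set where W is touched from above by a plane of slope less than \<delta>.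
  By semiconvexity the slope is a Lipschitz function of the contact point, and the strict maximum at
  0 makes every slope in the ball of radius \<delta> occur. A null set cannot be mapped onto a ball
  by a Lipschitz map, so E has points outside N.\<close>

lemma jensen_contact:
  fixes W :: "'a::euclidean_space \<Rightarrow> real"
  assumes semi: "\<And>x. \<exists>q. \<forall>y. W x + q \<bullet> (y - x) - C / 2 * (norm (y - x))\<^sup>2 \<le> W y" and C: "C \<ge> 0"
    and W0: "W 0 = 0" and W: "\<And>x. W x \<le> - \<eta> * (norm x)\<^sup>2" and \<eta>: "\<eta> > 0"
    and N: "negligible N" and \<delta>: "\<delta> > 0"
  shows "\<exists>x p. x \<notin> N \<and> norm p < \<delta> \<and> norm x \<le> norm p / \<eta> \<and> (\<forall>y. W y \<le> W x + p \<bullet> (y - x))"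
proof -
  define E where "E = {x. \<exists>p. norm p < \<delta> \<and> (\<forall>y. W y \<le> W x + p \<bullet> (y - x))}"
  let ?g = "\<lambda>x. W x + C / 2 * (norm x)\<^sup>2"
  have gsub: "\<exists>q. is_subgradient ?g x q" for x
    using semi[of x] semiconvex_imp_subgradient[of W x _ C] by blast
  have "continuous_on UNIV ?g"
    using subgradient_convex_on[OF gsub] by (intro convex_on_continuous) auto
  then have "continuous_on UNIV (\<lambda>x. ?g x - C / 2 * (norm x)\<^sup>2)"
    by (rule continuous_on_diff) (intro continuous_intros)
  moreover have "(\<lambda>x. ?g x - C / 2 * (norm x)\<^sup>2) = W" by auto
  ultimately have contW: "continuous_on UNIV W" by (simp only:)
  have small: "norm x \<le> norm p / \<eta>" if "\<And>y. W y \<le> W x + p \<bullet> (y - x)" for x p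
  proof -
    have "\<eta> * (norm x)\<^sup>2 \<le> - (p \<bullet> x)"
      using that[of 0] W0 W[of x] by simp
    also have "\<dots> \<le> norm p * norm x"
      using Cauchy_Schwarz_ineq2[of p x] by linarith
    finally show ?thesis
      using \<eta> by (cases "x = 0") (auto simp: power2_eq_square field_simps)
  qed
  \<comment> \<open>2 * C is the bound for the subgradients of the convex function
    \<open>?g\<close>, touched by a paraboloid with constant C / 2; the remaining C undoes the shift
    by C * x.\<close>
  have lips: "norm (p' - p) \<le> 3 * C * norm (x' - x)"
    if p: "\<And>y. W y \<le> W x + p \<bullet> (y - x)" and p': "\<And>y. W y \<le> W x' + p' \<bullet> (y - x')" for x x' p p'
  proof -
    have t: "?g y \<le> ?g x + (p + C *\<^sub>R x) \<bullet> (y - x) + C / 2 * (norm (y - x))\<^sup>2"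
      if "\<And>y. W y \<le> W x + p \<bullet> (y - x)" for x p y
      using touching_add_square[of W y x p 0 C] that[of y] by simp
    have s: "is_subgradient ?g x (p + C *\<^sub>R x)" if "\<And>y. W y \<le> W x + p \<bullet> (y - x)" for x p
      using gsub[of x] subgradient_unique_touching[OF _ t[OF that]] by auto
    have "norm ((p' + C *\<^sub>R x') - (p + C *\<^sub>R x)) \<le> 4 * (C / 2) * norm (x' - x)"
      using C by (intro subgradient_lipschitz_touching[OF s[OF p] s[OF p'] t[OF p]]) auto
    moreover have "norm (p' - p) = norm (((p' + C *\<^sub>R x') - (p + C *\<^sub>R x)) - C *\<^sub>R (x' - x))"
      by (intro arg_cong[where f = norm]) (simp add: algebra_simps)
    moreover have "norm (C *\<^sub>R (x' - x)) = C * norm (x' - x)" using C by simp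
    ultimately show ?thesis
      using norm_triangle_ineq4[of "(p' + C *\<^sub>R x') - (p + C *\<^sub>R x)" "C *\<^sub>R (x' - x)"] by linarith
  qed
  have "\<forall>x\<in>E. \<exists>p. norm p < \<delta> \<and> (\<forall>y. W y \<le> W x + p \<bullet> (y - x))"
    by (simp add: E_def)
  from bchoice[OF this] obtain g where g: "\<forall>x\<in>E. norm (g x) < \<delta> \<and> (\<forall>y. W y \<le> W x + g x \<bullet> (y - x))" ..
  \<comment> \<open>For a given slope p maximise W x - p \<bullet> x. Outside the ball of radius |p|
    / \<eta> the decay of W makes this quantity at most 0, its value at 0.\<close>
  have onto: "ball 0 \<delta> \<subseteq> g ` E"
  proof
    fix p :: 'a assume "p \<in> ball 0 \<delta>"
    then have p: "norm p < \<delta>" by simp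
    have "continuous_on (cball 0 (norm p / \<eta>)) (\<lambda>x. W x - p \<bullet> x)"
      by (intro continuous_intros continuous_on_subset[OF contW]) auto
    moreover have "cball (0::'a) (norm p / \<eta>) \<noteq> {}" using \<eta> by (simp add: not_less)
    ultimately obtain x where x: "x \<in> cball 0 (norm p / \<eta>)"
      "\<And>y. y \<in> cball 0 (norm p / \<eta>) \<Longrightarrow> W y - p \<bullet> y \<le> W x - p \<bullet> x"
      using continuous_attains_sup[OF compact_cball] by blast
    have "W y \<le> W x + p \<bullet> (y - x)" for y
    proof (cases "y \<in> cball 0 (norm p / \<eta>)")
      case True
      then show ?thesis using x(2)[of y] by (simp add: inner_simps)
    next
      case False
      then have "norm p < \<eta> * norm y" using \<eta> by (simp add: field_simps)
      then have "norm p * norm y \<le> \<eta> * norm y * norm y" by (intro mult_right_mono) auto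
      moreover have "- (p \<bullet> y) \<le> norm p * norm y"
        using Cauchy_Schwarz_ineq2[of p y] by linarith
      ultimately have "W y - p \<bullet> y \<le> 0"
        using W[of y] by (simp add: power2_eq_square)
      moreover have "0 \<le> W x - p \<bullet> x"
        using x(2)[of 0] W0 \<eta> by simp
      ultimately show ?thesis by (simp add: inner_simps)
    qed
    \<comment> \<open>With equal contact points the Lipschitz bound says that the slope is unique,
      so p is the value chosen by g.\<close>
    then have xE: "x \<in> E" and "norm (p - g x) \<le> 3 * C * norm (x - x)"
      using p g lips[of x "g x" x p] by (auto simp: E_def)
    then show "p \<in> g ` E" by auto
  qed
  have "\<not> E \<subseteq> N"
  proof
    assume "E \<subseteq> N"
    then have "negligible E" using N negligible_subset by blast
    then have "negligible (g ` E)"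
    proof (rule negligible_locally_Lipschitz_image[OF order_refl])
      fix x assume x: "x \<in> E"
      have "\<forall>y\<in>E \<inter> UNIV. norm (g y - g x) \<le> 3 * C * norm (y - x)"
        using g x lips by blast
      then show "\<exists>T B. open T \<and> x \<in> T \<and> (\<forall>y\<in>E \<inter> T. norm (g y - g x) \<le> B * norm (y - x))"
        by blast
    qed
    then have "negligible (ball (0::'a) \<delta>)" using onto negligible_subset by blast
    then show False using open_not_negligible[of "ball (0::'a) \<delta>"] \<delta> by simp
  qed
  then obtain x p where "x \<notin> N" "norm p < \<delta>" "\<And>y. W y \<le> W x + p \<bullet> (y - x)"
    by (auto simp: E_def)
  then show ?thesis using small by blast
qed

lemma negligible_Times:
  fixes N :: "'a::euclidean_space set" and M :: "'b::euclidean_space set"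
  assumes "negligible N \<or> negligible M"
  shows "negligible (N \<times> M)"
proof -
  have borel_null: "\<exists>B\<in>null_sets lborel. S \<subseteq> B" if "negligible S" for S :: "'c::euclidean_space set"
    using that by (simp add: negligible_iff_null_sets null_sets_completion_iff2)
  have "N \<times> M \<in> null_sets lebesgue"
    using assms
  proof
    assume "negligible N"
    then obtain B where B: "B \<in> null_sets lborel" "N \<subseteq> B" using borel_null by blast
    have "emeasure (lborel \<Otimes>\<^sub>M lborel) (B \<times> (UNIV :: 'b set)) = emeasure lborel B * emeasure lborel (UNIV :: 'b set)"
      using B by (intro lborel.emeasure_pair_measure_Times) auto
    then have "B \<times> UNIV \<in> null_sets (lborel :: ('a \<times> 'b) measure)"
      unfolding lborel_prod using B by (auto simp: null_sets_def borel_Times)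
    moreover have "N \<times> M \<subseteq> B \<times> UNIV" using B(2) by auto
    ultimately show ?thesis by (simp only: null_sets_completion_iff2) (rule bexI)
  next
    assume "negligible M"
    then obtain B where B: "B \<in> null_sets lborel" "M \<subseteq> B" using borel_null by blast
    have "emeasure (lborel \<Otimes>\<^sub>M lborel) ((UNIV :: 'a set) \<times> B) = emeasure lborel (UNIV :: 'a set) * emeasure lborel B"
      using B by (intro lborel.emeasure_pair_measure_Times) auto
    then have "UNIV \<times> B \<in> null_sets (lborel :: ('a \<times> 'b) measure)"
      unfolding lborel_prod using B by (auto simp: null_sets_def borel_Times)
    moreover have "N \<times> M \<subseteq> UNIV \<times> B" using B(2) by auto
    ultimately show ?thesis by (simp only: null_sets_completion_iff2) (rule bexI)
  qed
  then show ?thesis by (simp add: negligible_iff_null_sets)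
qed

text \<open>U is a supremum of equally curved concave paraboloids. The one attained at \<xi> lies
  below U everywhere; its expansion at \<xi> gives semiconvexity with the explicit slope l * (m
  \<xi> - \<xi>).\<close>

lemma sup_convolution:
  fixes u :: "'a::euclidean_space \<Rightarrow> real"
  assumes D: "compact D" "D \<noteq> {}" and u: "usc_on D u"
  obtains m U where "\<And>\<xi>. m \<xi> \<in> D" "\<And>\<xi>. U \<xi> = u (m \<xi>) - l / 2 * (norm (m \<xi> - \<xi>))\<^sup>2"
    "\<And>x \<xi>. x \<in> D \<Longrightarrow> u x - l / 2 * (norm (x - \<xi>))\<^sup>2 \<le> U \<xi>"
    "\<And>\<xi> y. U \<xi> + (l *\<^sub>R (m \<xi> - \<xi>)) \<bullet> (y - \<xi>) - l / 2 * (norm (y - \<xi>))\<^sup>2 \<le> U y"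
proof -
  have "\<exists>x\<in>D. \<forall>y\<in>D. u y - l / 2 * (norm (y - \<xi>))\<^sup>2 \<le> u x - l / 2 * (norm (x - \<xi>))\<^sup>2" for \<xi>
  proof -
    have "usc_on D (\<lambda>x. u x + - (l / 2 * (norm (x - \<xi>))\<^sup>2))"
      by (intro usc_on_add_continuous[OF u] continuous_intros)
    then show ?thesis
      by (rule usc_on_attains_max[OF D]) auto
  qed
  then have "\<forall>\<xi>. \<exists>x. x \<in> D \<and> (\<forall>y\<in>D. u y - l / 2 * (norm (y - \<xi>))\<^sup>2 \<le> u x - l / 2 * (norm (x - \<xi>))\<^sup>2)"
    by blast
  from choice[OF this] obtain m where m:
    "\<forall>\<xi>. m \<xi> \<in> D \<and> (\<forall>y\<in>D. u y - l / 2 * (norm (y - \<xi>))\<^sup>2 \<le> u (m \<xi>) - l / 2 * (norm (m \<xi> - \<xi>))\<^sup>2)" ..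
  define U where "U = (\<lambda>\<xi>. u (m \<xi>) - l / 2 * (norm (m \<xi> - \<xi>))\<^sup>2)"
  show thesis
  proof (rule that[of m U])
    show "U \<xi> + (l *\<^sub>R (m \<xi> - \<xi>)) \<bullet> (y - \<xi>) - l / 2 * (norm (y - \<xi>))\<^sup>2 \<le> U y" for \<xi> y
    proof -
      have "l / 2 * (norm (m \<xi> - y))\<^sup>2 = l / 2 * ((norm (m \<xi> - \<xi>))\<^sup>2 - 2 * ((m \<xi> - \<xi>) \<bullet> (y - \<xi>)) + (norm (y - \<xi>))\<^sup>2)"
        unfolding power2_norm_eq_inner by (simp add: inner_simps inner_commute)
      also have "\<dots> = l / 2 * (norm (m \<xi> - \<xi>))\<^sup>2 - (l *\<^sub>R (m \<xi> - \<xi>)) \<bullet> (y - \<xi>) + l / 2 * (norm (y - \<xi>))\<^sup>2"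
        by (simp add: algebra_simps)
      finally have "l / 2 * (norm (m \<xi> - y))\<^sup>2 = l / 2 * (norm (m \<xi> - \<xi>))\<^sup>2 - (l *\<^sub>R (m \<xi> - \<xi>)) \<bullet> (y - \<xi>) + l / 2 * (norm (y - \<xi>))\<^sup>2" .
      moreover have "u (m \<xi>) - l / 2 * (norm (m \<xi> - y))\<^sup>2 \<le> U y"
        using m by (simp add: U_def)
      ultimately show ?thesis by (simp only: U_def)
    qed
  qed (use m in \<open>auto simp: U_def\<close>)
qed

definition second_order_at :: "('a::real_inner \<Rightarrow> real) \<Rightarrow> 'a \<Rightarrow> 'a \<Rightarrow> ('a \<Rightarrow> 'a) \<Rightarrow> bool" where
  "second_order_at U x q X \<longleftrightarrow> linear X \<and> (\<forall>e>0. \<exists>d>0. \<forall>h. norm h < d \<longrightarrow>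
     \<bar>U (x + h) - U x - q \<bullet> h - X h \<bullet> h / 2\<bar> \<le> e * (norm h)\<^sup>2)"

text \<open>Insert the expansions along s * h and s * k, cancel the first order terms, divide by s^2
  and let s tend to 0. Applied to U and V it compares their Hessians with that of the penalty;
  applied to - U it reads off the semiconvexity bound.\<close>

lemma second_order_compare:
  assumes X: "second_order_at U x q X" and Y: "second_order_at V y p Y"
    and le: "\<And>s. 0 < s \<Longrightarrow> s \<le> 1 \<Longrightarrow> U (x + s *\<^sub>R h) + V (y + s *\<^sub>R k) \<le> U x + V y + s * (q \<bullet> h + p \<bullet> k) + s\<^sup>2 * Q"
  shows "X h \<bullet> h / 2 + Y k \<bullet> k / 2 \<le> Q"
proof -
  have lin: "linear X" "linear Y" using X Y by (auto simp: second_order_at_def)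
  let ?n = "(norm h)\<^sup>2 + (norm k)\<^sup>2"
  have "X h \<bullet> h / 2 + Y k \<bullet> k / 2 \<le> Q + e * ?n" if e: "e > 0" for e
  proof -
    obtain d where d: "d > 0" "\<And>h. norm h < d \<Longrightarrow> \<bar>U (x + h) - U x - q \<bullet> h - X h \<bullet> h / 2\<bar> \<le> e * (norm h)\<^sup>2"
      using X e unfolding second_order_at_def by blast
    obtain d' where d': "d' > 0" "\<And>h. norm h < d' \<Longrightarrow> \<bar>V (y + h) - V y - p \<bullet> h - Y h \<bullet> h / 2\<bar> \<le> e * (norm h)\<^sup>2"
      using Y e unfolding second_order_at_def by blast
    define s where "s = min 1 (min d d' / (norm h + norm k + 1))"
    have nn: "norm h + norm k + 1 > 0" using norm_ge_zero[of h] norm_ge_zero[of k] by linarith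
    have s: "0 < s" "s \<le> 1" using d(1) d'(1) nn by (auto simp: s_def)
    have "s * (norm h + norm k + 1) \<le> min d d'"
      using nn unfolding pos_le_divide_eq[OF nn, symmetric] by (simp add: s_def)
    moreover have "s * norm h < s * (norm h + norm k + 1)" "s * norm k < s * (norm h + norm k + 1)"
      using s norm_ge_zero[of h] norm_ge_zero[of k] by (intro mult_strict_left_mono; linarith)+
    moreover have "norm (s *\<^sub>R h) = s * norm h" "norm (s *\<^sub>R k) = s * norm k"
      using s by auto
    ultimately have "norm (s *\<^sub>R h) < d" "norm (s *\<^sub>R k) < d'"
      unfolding min.bounded_iff by linarith+
    then have "\<bar>U (x + s *\<^sub>R h) - U x - s * (q \<bullet> h) - s\<^sup>2 * (X h \<bullet> h / 2)\<bar> \<le> s\<^sup>2 * (e * (norm h)\<^sup>2)"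
      "\<bar>V (y + s *\<^sub>R k) - V y - s * (p \<bullet> k) - s\<^sup>2 * (Y k \<bullet> k / 2)\<bar> \<le> s\<^sup>2 * (e * (norm k)\<^sup>2)"
      using d(2)[of "s *\<^sub>R h"] d'(2)[of "s *\<^sub>R k"]
      by (simp_all add: linear_scale[OF lin(1)] linear_scale[OF lin(2)] power_mult_distrib power2_eq_square mult_ac)
    then have "s\<^sup>2 * (X h \<bullet> h / 2 + Y k \<bullet> k / 2) \<le> s\<^sup>2 * (Q + e * ?n)"
      using le[OF s] by (simp add: algebra_simps)
    then show ?thesis using s by simp
  qed
  then have "\<forall>\<^sub>F e in at_right 0. X h \<bullet> h / 2 + Y k \<bullet> k / 2 \<le> Q + e * ?n"
    by (auto simp: eventually_at_right_field intro!: exI[of _ 1])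
  moreover have "((\<lambda>e. Q + e * ?n) \<longlongrightarrow> Q) (at_right (0::real))"
    by (auto intro!: tendsto_eq_intros)
  ultimately show ?thesis
    by (intro tendsto_lowerbound[of _ _ "at_right (0::real)"]) auto
qed

text \<open>Adding l / 2 |x|^2 makes U convex, and a touching paraboloid stays a paraboloid. The
  Hessian of U is the convex one minus l times the identity.\<close>

lemma alexandrov_semiconvex:
  fixes U :: "'a::euclidean_space \<Rightarrow> real"
  assumes semi: "\<And>x. \<exists>q. \<forall>y. U x + q \<bullet> (y - x) - l / 2 * (norm (y - x))\<^sup>2 \<le> U y"
  obtains N where "negligible N"
    "\<And>x q C. x \<notin> N \<Longrightarrow> (\<And>y. U y \<le> U x + q \<bullet> (y - x) + C * (norm (y - x))\<^sup>2) \<Longrightarrow>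
       \<exists>X. second_order_at U x q X \<and> (\<forall>h. - l * (norm h)\<^sup>2 \<le> X h \<bullet> h)"
proof -
  let ?f = "\<lambda>x. U x + l / 2 * (norm x)\<^sup>2"
  have sub: "\<exists>q. is_subgradient ?f x q" for x
    using semi[of x] semiconvex_imp_subgradient[of U x _ l] by blast
  obtain N where N: "negligible N"
    "\<And>x q C. x \<notin> N \<Longrightarrow> (\<And>y. ?f y \<le> ?f x + q \<bullet> (y - x) + C * (norm (y - x))\<^sup>2) \<Longrightarrow>
       \<exists>H. linear H \<and> (\<forall>e>0. \<exists>d>0. \<forall>h. norm h < d \<longrightarrow>
         \<bar>?f (x + h) - ?f x - q \<bullet> h - H h \<bullet> h / 2\<bar> \<le> e * (norm h)\<^sup>2)"
    by (rule alexandrov_touching[OF sub]) blast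
  show thesis
  proof (rule that[OF N(1)])
    fix x q C assume x: "x \<notin> N" and t: "\<And>y. U y \<le> U x + q \<bullet> (y - x) + C * (norm (y - x))\<^sup>2"
    have tf: "?f y \<le> ?f x + (q + l *\<^sub>R x) \<bullet> (y - x) + (C + l / 2) * (norm (y - x))\<^sup>2" for y
      by (rule touching_add_square[OF t[of y]])
    obtain H where H: "linear H" "\<And>e. e > 0 \<Longrightarrow> \<exists>d>0. \<forall>h. norm h < d \<longrightarrow>
         \<bar>?f (x + h) - ?f x - (q + l *\<^sub>R x) \<bullet> h - H h \<bullet> h / 2\<bar> \<le> e * (norm h)\<^sup>2"
      using N(2)[OF x tf] by blast
    define X where "X = (\<lambda>h. H h - l *\<^sub>R h)"
    have linX: "linear X"
      unfolding X_def by (intro linear_compose_sub H(1) linear_scale_self)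
    have eq: "?f (x + h) - ?f x - (q + l *\<^sub>R x) \<bullet> h - H h \<bullet> h / 2 = U (x + h) - U x - q \<bullet> h - X h \<bullet> h / 2" for h
    proof -
      have "l / 2 * (norm (x + h))\<^sup>2 = l / 2 * ((norm x)\<^sup>2 + 2 * (x \<bullet> h) + h \<bullet> h)"
        unfolding power2_norm_eq_inner by (simp add: inner_simps inner_commute)
      then show ?thesis by (simp add: X_def inner_simps algebra_simps diff_divide_distrib add_divide_distrib)
    qed
    have so: "second_order_at U x q X"
      using H(2) linX unfolding second_order_at_def eq by blast
    have "is_subgradient ?f x (q + l *\<^sub>R x)"
      using sub[of x] subgradient_unique_touching[OF _ tf] by auto
    then have lower: "0 \<le> U (x + h) - U x - q \<bullet> h + l / 2 * (norm h)\<^sup>2" for h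
    proof -
      have "l / 2 * (norm (x + h))\<^sup>2 = l / 2 * ((norm x)\<^sup>2 + 2 * (x \<bullet> h) + (norm h)\<^sup>2)"
        unfolding power2_norm_eq_inner by (simp add: inner_simps inner_commute)
      moreover have "?f x + (q + l *\<^sub>R x) \<bullet> h \<le> ?f (x + h)"
        using \<open>is_subgradient ?f x (q + l *\<^sub>R x)\<close>[unfolded is_subgradient_def, rule_format, of "x + h"] by simp
      ultimately show ?thesis by (simp add: inner_simps algebra_simps add_divide_distrib)
    qed
    have neg: "second_order_at (\<lambda>y. - U y) x (- q) (\<lambda>h. - X h)"
    proof -
      have "\<bar>- U (x + h) - - U x - - q \<bullet> h - - X h \<bullet> h / 2\<bar> = \<bar>U (x + h) - U x - q \<bullet> h - X h \<bullet> h / 2\<bar>" for h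
        by simp
      then show ?thesis
        using so unfolding second_order_at_def by (simp add: linear_compose_neg)
    qed
    have "- l * (norm h)\<^sup>2 \<le> X h \<bullet> h" for h
    proof -
      \<comment> \<open>The comparison is used with direction 0 for the second function, which then
        contributes nothing.\<close>
      have "- X h \<bullet> h / 2 + (- X 0) \<bullet> 0 / 2 \<le> l / 2 * (norm h)\<^sup>2 / 1"
      proof (rule second_order_compare[OF neg neg])
        fix s :: real
        show "- U (x + s *\<^sub>R h) + - U (x + s *\<^sub>R 0) \<le> - U x + - U x + s * (- q \<bullet> h + - q \<bullet> 0) + s\<^sup>2 * (l / 2 * (norm h)\<^sup>2 / 1)"
          using lower[of "s *\<^sub>R h"] by (simp add: power_mult_distrib mult_ac)
      qed
      then show ?thesis by simp
    qed
    then show "\<exists>X. second_order_at U x q X \<and> (\<forall>h. - l * (norm h)\<^sup>2 \<le> X h \<bullet> h)"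
      using so by blast
  qed
qed

section \<open>The theorem on sums\<close>

text \<open>The superjet of order two with its remainder spelled out. X enters only through its
  quadratic form, so symmetry is not imposed here; a symmetric matrix is chosen by
  \<open>symmetric_matrix_of_form\<close>.\<close>

definition upper_jet :: "('a::real_inner \<Rightarrow> real) \<Rightarrow> 'a \<Rightarrow> 'a \<Rightarrow> ('a \<Rightarrow> 'a) \<Rightarrow> bool" where
  "upper_jet u x q X \<longleftrightarrow> linear X \<and>
     (\<forall>e>0. \<exists>d>0. \<forall>k. norm k < d \<longrightarrow> u (x + k) \<le> u x + q \<bullet> k + X k \<bullet> k / 2 + e * (norm k)\<^sup>2)"

text \<open>Shifting the maximiser x and the point \<xi> by the same k leaves the penalty unchanged,
  so u (x + k) - u x \<le> U (\<xi> + k) - U \<xi>, and the expansion of U at \<xi> bounds u at x.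
  Here x must lie in the open ball, so that small shifts stay admissible.\<close>

lemma upper_jet_sup_convolution:
  fixes u U :: "'a::euclidean_space \<Rightarrow> real"
  assumes U: "U \<xi> = u x - l / 2 * (norm (x - \<xi>))\<^sup>2"
    and le: "\<And>y z. norm y < r \<Longrightarrow> u y - l / 2 * (norm (y - z))\<^sup>2 \<le> U z"
    and x: "norm x < r" and X: "second_order_at U \<xi> q X"
  shows "upper_jet u x q X"
  unfolding upper_jet_def
proof (intro conjI allI impI)
  show "linear X" using X by (simp add: second_order_at_def)
  fix e :: real assume "e > 0"
  then obtain d where d: "d > 0" "\<And>h. norm h < d \<Longrightarrow> \<bar>U (\<xi> + h) - U \<xi> - q \<bullet> h - X h \<bullet> h / 2\<bar> \<le> e * (norm h)\<^sup>2"
    using X unfolding second_order_at_def by blast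
  have "u (x + k) \<le> u x + q \<bullet> k + X k \<bullet> k / 2 + e * (norm k)\<^sup>2" if k: "norm k < min d (r - norm x)" for k
  proof -
    have "norm (x + k) < r" using norm_triangle_ineq[of x k] k by simp
    then have "u (x + k) - l / 2 * (norm (x - \<xi>))\<^sup>2 \<le> U (\<xi> + k)"
      using le[of "x + k" "\<xi> + k"] by simp
    then show ?thesis using d(2)[of k] k U by simp
  qed
  then show "\<exists>d>0. \<forall>k. norm k < d \<longrightarrow> u (x + k) \<le> u x + q \<bullet> k + X k \<bullet> k / 2 + e * (norm k)\<^sup>2"
    using d(1) x by (intro exI[of _ "min d (r - norm x)"]) auto
qed

lemma quadratic_absorb:
  fixes a b :: real
  assumes "\<tau> > 0"
  shows "2 * \<beta> * (a * b) \<le> \<tau> * a\<^sup>2 + \<beta>\<^sup>2 / \<tau> * b\<^sup>2"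
proof -
  have "0 \<le> (\<tau> * a - \<beta> * b)\<^sup>2 / \<tau>" using assms by simp
  also have "\<dots> = \<tau> * a\<^sup>2 + \<beta>\<^sup>2 / \<tau> * b\<^sup>2 - 2 * \<beta> * (a * b)"
    using assms by (simp add: power2_eq_square field_simps)
  finally show ?thesis by simp
qed

lemma norm_diff_square_le: "(norm (a - b))\<^sup>2 \<le> 2 * ((norm a)\<^sup>2 + (norm (b :: 'a::real_inner))\<^sup>2)"
proof -
  have "0 \<le> (norm (a + b))\<^sup>2" by simp
  moreover have "(norm (a + b))\<^sup>2 + (norm (a - b))\<^sup>2 = 2 * ((norm a)\<^sup>2 + (norm b)\<^sup>2)"
    unfolding power2_norm_eq_inner by (simp add: inner_simps)
  ultimately show ?thesis by linarith
qed

text \<open>The curvature l of the penalty is at least twice the growth \<beta> of u, so the penalty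
  wins and ties the maximiser to \<xi>. This gives points and values near those at 0.\<close>

lemma sup_convolution_maximizer_small:
  fixes u :: "'a::real_inner \<Rightarrow> real"
  assumes max: "u 0 - l / 2 * (norm (0 - \<xi>))\<^sup>2 \<le> u x - l / 2 * (norm (x - \<xi>))\<^sup>2"
    and u0: "u 0 = 0" and ux: "u x \<le> \<beta> / 2 * (norm x)\<^sup>2" and l: "2 * \<beta> \<le> l" "0 < l"
  shows "norm x \<le> 4 * norm \<xi>" and "- (l / 2 * (norm \<xi>)\<^sup>2) \<le> u x"
proof -
  have "0 \<le> l / 2 * (norm (x - \<xi>))\<^sup>2" using l by simp
  then show "- (l / 2 * (norm \<xi>)\<^sup>2) \<le> u x" using max u0 by simp
  have e: "l / 2 * (norm (x - \<xi>))\<^sup>2 = l / 2 * ((norm x)\<^sup>2 - 2 * (x \<bullet> \<xi>) + (norm \<xi>)\<^sup>2)"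
    unfolding power2_norm_eq_inner by (simp add: inner_simps inner_commute)
  have "l * (norm x)\<^sup>2 - 2 * l * (x \<bullet> \<xi>) \<le> \<beta> * (norm x)\<^sup>2"
    using max u0 ux unfolding e by (simp add: algebra_simps)
  also have "\<dots> \<le> l / 2 * (norm x)\<^sup>2" using l by (intro mult_right_mono) auto
  finally have "l * (norm x)\<^sup>2 \<le> l * (4 * (x \<bullet> \<xi>))" by (simp add: algebra_simps)
  then have "(norm x)\<^sup>2 \<le> 4 * (x \<bullet> \<xi>)" using l by simp
  also have "\<dots> \<le> 4 * (norm x * norm \<xi>)"
    using norm_cauchy_schwarz[of x \<xi>] by simp
  finally show "norm x \<le> 4 * norm \<xi>"
    by (cases "x = 0") (auto simp: power2_eq_square)
qed

text \<open>An approximate form of the Crandall-Ishii theorem: genuine jets at points near 0. Since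
  \<open>\<Lambda>\<close> precedes \<open>\<epsilon>\<close>, the second order parts stay bounded
  as \<epsilon> tends to 0 and a limit can be extracted. The sup-convolutions of u and v are
  perturbed by \<open>jensen_contact\<close> to a contact point where both have a second order
  expansion, which is then handed back to u and v.\<close>

lemma theorem_on_sums:
  fixes u v :: "'a::euclidean_space \<Rightarrow> real" and B :: "'a \<Rightarrow> 'a"
  assumes r: "r > 0" and u: "usc_on (cball 0 r) u" and v: "usc_on (cball 0 r) v"
    and u0: "u 0 = 0" and v0: "v 0 = 0"
    and le: "\<And>x y. norm x \<le> r \<Longrightarrow> norm y \<le> r \<Longrightarrow> u x + v y \<le> B (x - y) \<bullet> (x - y) / 2"
    and B: "linear B" and sym: "\<And>x y. B x \<bullet> y = x \<bullet> B y" and \<tau>: "\<tau> > 0"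
  shows "\<exists>\<Lambda>. \<forall>\<epsilon>>0. \<exists>x y q p X Y. norm x < \<epsilon> \<and> norm y < \<epsilon> \<and> \<bar>u x\<bar> < \<epsilon> \<and> \<bar>v y\<bar> < \<epsilon> \<and> norm q < \<epsilon> \<and> norm p < \<epsilon> \<and>
    upper_jet u x q X \<and> upper_jet v y p Y \<and>
    (\<forall>h. \<bar>X h \<bullet> h\<bar> \<le> \<Lambda> * (norm h)\<^sup>2) \<and> (\<forall>h. \<bar>Y h \<bullet> h\<bar> \<le> \<Lambda> * (norm h)\<^sup>2) \<and>
    (\<forall>h k. X h \<bullet> h + Y k \<bullet> k \<le> B (h - k) \<bullet> (h - k) + \<tau> * (norm (h - k))\<^sup>2 + \<epsilon> * ((norm h)\<^sup>2 + (norm k)\<^sup>2))"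
    (is "\<exists>\<Lambda>. \<forall>\<epsilon>>0. ?P \<Lambda> \<epsilon>")
proof -
  from linear_bounded_pos[OF B] obtain \<beta> where \<beta>: "\<beta> > 0" "\<And>x. norm (B x) \<le> \<beta> * norm x" by blast
  have Bq: "\<bar>B x \<bullet> y\<bar> \<le> \<beta> * (norm x * norm y)" for x y
  proof -
    have "\<bar>B x \<bullet> y\<bar> \<le> norm (B x) * norm y" by (rule Cauchy_Schwarz_ineq2)
    also have "\<dots> \<le> \<beta> * norm x * norm y" using \<beta>(2) by (intro mult_right_mono) auto
    finally show ?thesis by (simp add: mult.assoc)
  qed
  \<comment> \<open>The sup-convolutions satisfy the quadratic bound only after B is enlarged; the
    extra \<tau> times the identity pays for half of Young's inequality in the cross term.\<close>
  define B' where "B' = (\<lambda>z. B z + \<tau> *\<^sub>R z)"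
  define Q where "Q = (\<lambda>z. B' z \<bullet> z)"
  define \<beta>' where "\<beta>' = \<beta> + \<tau>"
  have \<beta>': "\<beta>' > 0" using \<beta>(1) \<tau> by (simp add: \<beta>'_def)
  have Q_eq: "Q z = B z \<bullet> z + \<tau> * (norm z)\<^sup>2" for z
    by (simp add: Q_def B'_def inner_simps power2_norm_eq_inner)
  have Q_add: "Q (z + s) = Q z + 2 * (B' z \<bullet> s) + Q s" for z s
    using sym[of s z] by (simp add: Q_def B'_def linear_add[OF B] inner_simps inner_commute algebra_simps)
  have Q_le: "\<bar>Q z\<bar> \<le> \<beta>' * (norm z)\<^sup>2" for z
  proof -
    have "0 \<le> \<tau> * (norm z)\<^sup>2" using \<tau> by simp
    then show ?thesis
      using Bq[of z z] by (simp add: Q_eq \<beta>'_def algebra_simps power2_eq_square)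
  qed
  have Q_diff_le: "\<bar>Q (a - b)\<bar> \<le> 2 * \<beta>' * ((norm a)\<^sup>2 + (norm b)\<^sup>2)" for a b
  proof -
    have "\<bar>Q (a - b)\<bar> \<le> \<beta>' * (norm (a - b))\<^sup>2" by (rule Q_le)
    also have "\<dots> \<le> \<beta>' * (2 * ((norm a)\<^sup>2 + (norm b)\<^sup>2))"
      using \<beta>' norm_diff_square_le by (intro mult_left_mono) auto
    also have "\<dots> = 2 * \<beta>' * ((norm a)\<^sup>2 + (norm b)\<^sup>2)" by (simp add: algebra_simps)
    finally show ?thesis .
  qed
  have B'n: "norm (B' z) \<le> \<beta>' * norm z" for z
    using norm_triangle_ineq[of "B z" "\<tau> *\<^sub>R z"] \<beta>(2)[of z] \<tau> by (simp add: B'_def \<beta>'_def algebra_simps)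
  define c where "c = \<beta>\<^sup>2 / \<tau>"
  \<comment> \<open>c is the other half of the Young cost. The choice gives c + \<beta> \<le> l / 2,
    which absorbs the displacement in \<open>UV\<close>, and 2 * \<beta> \<le> l, as
    \<open>sup_convolution_maximizer_small\<close> asks.\<close>
  define l where "l = 2 * \<beta> + 2 * c + 1"
  have "0 \<le> c" using \<tau> by (simp add: c_def)
  then have l: "2 * \<beta> \<le> l" "0 < l" using \<beta>(1) by (auto simp: l_def)
  let ?D = "cball (0::'a) r"
  have D: "compact ?D" "?D \<noteq> {}" using r by (auto simp: not_less)
  obtain m U where m: "\<And>\<xi>. m \<xi> \<in> ?D" "\<And>\<xi>. U \<xi> = u (m \<xi>) - l / 2 * (norm (m \<xi> - \<xi>))\<^sup>2"
    "\<And>x \<xi>. x \<in> ?D \<Longrightarrow> u x - l / 2 * (norm (x - \<xi>))\<^sup>2 \<le> U \<xi>"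
    "\<And>\<xi> y. U \<xi> + (l *\<^sub>R (m \<xi> - \<xi>)) \<bullet> (y - \<xi>) - l / 2 * (norm (y - \<xi>))\<^sup>2 \<le> U y"
    by (rule sup_convolution[OF D u, where l = l]) blast
  obtain n V where n: "\<And>\<xi>. n \<xi> \<in> ?D" "\<And>\<xi>. V \<xi> = v (n \<xi>) - l / 2 * (norm (n \<xi> - \<xi>))\<^sup>2"
    "\<And>x \<xi>. x \<in> ?D \<Longrightarrow> v x - l / 2 * (norm (x - \<xi>))\<^sup>2 \<le> V \<xi>"
    "\<And>\<xi> y. V \<xi> + (l *\<^sub>R (n \<xi> - \<xi>)) \<bullet> (y - \<xi>) - l / 2 * (norm (y - \<xi>))\<^sup>2 \<le> V y"
    by (rule sup_convolution[OF D v, where l = l]) blast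
  have semiU: "\<exists>q. \<forall>y. U x + q \<bullet> (y - x) - l / 2 * (norm (y - x))\<^sup>2 \<le> U y" for x
    using m(4) by blast
  have semiV: "\<exists>q. \<forall>y. V x + q \<bullet> (y - x) - l / 2 * (norm (y - x))\<^sup>2 \<le> V y" for x
    using n(4) by blast
  obtain N1 where N1: "negligible N1"
    "\<And>x q C. x \<notin> N1 \<Longrightarrow> (\<And>y. U y \<le> U x + q \<bullet> (y - x) + C * (norm (y - x))\<^sup>2) \<Longrightarrow>
       \<exists>X. second_order_at U x q X \<and> (\<forall>h. - l * (norm h)\<^sup>2 \<le> X h \<bullet> h)"
    by (rule alexandrov_semiconvex[OF semiU]) blast
  obtain N2 where N2: "negligible N2"
    "\<And>x q C. x \<notin> N2 \<Longrightarrow> (\<And>y. V y \<le> V x + q \<bullet> (y - x) + C * (norm (y - x))\<^sup>2) \<Longrightarrow>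
       \<exists>X. second_order_at V x q X \<and> (\<forall>h. - l * (norm h)\<^sup>2 \<le> X h \<bullet> h)"
    by (rule alexandrov_semiconvex[OF semiV]) blast
  define N where "N = N1 \<times> UNIV \<union> UNIV \<times> N2"
  have N: "negligible N"
    unfolding N_def using N1(1) N2(1) by (intro negligible_Un negligible_Times) auto
  \<comment> \<open>The maximisers differ by z = (x - y) + s. Expand B at z, split the cross term by
    Young's inequality, and let the two penalties, which dominate l / 4 |s|^2, pay for all terms in
    s.\<close>
  have UV: "U x + V y \<le> Q (x - y) / 2" for x y
  proof -
    define z where "z = m x - n y"
    define s where "s = z - (x - y)"
    have "u (m x) + v (n y) \<le> B z \<bullet> z / 2"
      using le[of "m x" "n y"] m(1)[of x] n(1)[of y] by (simp add: z_def)
    moreover have "B z \<bullet> z = B (x - y) \<bullet> (x - y) + 2 * (B (x - y) \<bullet> s) + B s \<bullet> s"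
    proof -
      have "z = (x - y) + s" by (simp add: s_def)
      then show ?thesis
        using linear_add[OF B, of "x - y" s] sym[of s "x - y"] by (simp add: inner_left_distrib inner_right_distrib inner_commute)
    qed
    moreover have "2 * (B (x - y) \<bullet> s) \<le> \<tau> * (norm (x - y))\<^sup>2 + c * (norm s)\<^sup>2"
      using Bq[of "x - y" s] quadratic_absorb[OF \<tau>, of \<beta> "norm (x - y)" "norm s", folded c_def] by linarith
    moreover have "B s \<bullet> s \<le> \<beta> * (norm s)\<^sup>2"
      using Bq[of s s] by (simp add: power2_eq_square)
    moreover define S where "S = l * ((norm (m x - x))\<^sup>2 + (norm (n y - y))\<^sup>2)"
    have "l / 2 * (norm s)\<^sup>2 \<le> S"
    proof -
      have "s = (m x - x) - (n y - y)" by (simp add: s_def z_def)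
      then show ?thesis
        using norm_diff_square_le[of "m x - x" "n y - y"] l(2) by (simp add: S_def)
    qed
    moreover have "c * (norm s)\<^sup>2 + \<beta> * (norm s)\<^sup>2 \<le> l / 2 * (norm s)\<^sup>2"
    proof -
      have "(c + \<beta>) * (norm s)\<^sup>2 \<le> l / 2 * (norm s)\<^sup>2"
      proof (rule mult_right_mono)
        show "c + \<beta> \<le> l / 2" by (simp add: l_def field_simps)
      qed simp
      then show ?thesis by (simp add: distrib_right)
    qed
    moreover have "U x + V y = u (m x) + v (n y) - S / 2"
      using m(2)[of x] n(2)[of y] by (simp add: S_def algebra_simps add_divide_distrib)
    moreover have "2 * R \<le> a + t" if "P \<le> z / 2" "z = a + 2 * w + d" "2 * w \<le> t + e" "d \<le> f" "g \<le> S"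
      "e + f \<le> g" "R = P - S / 2" for P z a w d t e f g S R :: real
      using that by linarith
    ultimately have "2 * (U x + V y) \<le> Q (x - y)" unfolding Q_eq by blast
    then show ?thesis by simp
  qed
  have U0: "0 \<le> U 0" using m(3)[of 0 0] r u0 by simp
  have V0: "0 \<le> V 0" using n(3)[of 0 0] r v0 by simp
  have UV0: "U 0 + V 0 = 0" using UV[of 0 0] U0 V0 by (simp add: Q_def)
  have ub: "u x \<le> \<beta> / 2 * (norm x)\<^sup>2" if "norm x \<le> r" for x
    using le[of x 0] that r v0 Bq[of x x] by (simp add: power2_eq_square)
  have vb: "v x \<le> \<beta> / 2 * (norm x)\<^sup>2" if "norm x \<le> r" for x
    using le[of 0 x] that r u0 Bq[of "- x" "- x"] by (simp add: power2_eq_square)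
  show ?thesis
  \<comment> \<open>l is the lower curvature bound of the sup-convolutions; \<beta>' + 1 bounds the
    upper curvature \<beta>' + 2 * \<eta> of the touching paraboloids.\<close>
  proof (intro exI[of _ "l + \<beta>' + 1"] allI impI)
    fix \<epsilon> :: real assume \<epsilon>: "\<epsilon> > 0"
    define \<eta> where "\<eta> = min \<epsilon> 1 / 2"
    have \<eta>: "\<eta> > 0" "2 * \<eta> \<le> \<epsilon>" "2 * \<eta> \<le> 1" using \<epsilon> by (auto simp: \<eta>_def)
    \<comment> \<open>Subtracting \<eta> |\<xi>|^2 turns the maximum at 0 into a strict one with
      quadratic decay, as needed for \<open>jensen_contact\<close>.\<close>
    define W where "W = (\<lambda>\<xi>. U (fst \<xi>) + V (snd \<xi>) - Q (fst \<xi> - snd \<xi>) / 2 - \<eta> * (norm \<xi>)\<^sup>2)"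
    have W_eq: "W (x, y) = U x + V y - Q (x - y) / 2 - \<eta> * ((norm x)\<^sup>2 + (norm y)\<^sup>2)" for x y
      by (simp add: W_def norm_Pair)
    \<comment> \<open>The semiconvexity constant of W: l from U and V, 2 * \<beta>' from Q (x - y) /
      2, and 2 * \<eta> from the perturbation.\<close>
    define C where "C = 2 * (l / 2 + \<beta>' + \<eta>)"
    have C: "C \<ge> 0" using l \<beta>' \<eta> by (simp add: C_def)
    have exp: "Q ((x + a) - (y + b)) = Q (x - y) + 2 * (B' (x - y) \<bullet> (a - b)) + Q (a - b)" for x y a b
      using Q_add[of "x - y" "a - b"] by (simp add: algebra_simps)
    have sq: "\<eta> * (norm (x + a))\<^sup>2 = \<eta> * (norm x)\<^sup>2 + (2 * \<eta>) *\<^sub>R x \<bullet> a + \<eta> * (norm a)\<^sup>2" for x a :: 'a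
      unfolding power2_norm_eq_inner by (simp add: inner_simps inner_commute algebra_simps)
    have semiW: "\<exists>q. \<forall>\<zeta>. W \<xi> + q \<bullet> (\<zeta> - \<xi>) - C / 2 * (norm (\<zeta> - \<xi>))\<^sup>2 \<le> W \<zeta>" for \<xi>
    proof (cases \<xi>)
      case (Pair x y)
      define q where "q = (l *\<^sub>R (m x - x) - B' (x - y) - (2 * \<eta>) *\<^sub>R x, l *\<^sub>R (n y - y) + B' (x - y) - (2 * \<eta>) *\<^sub>R y)"
      have "W \<xi> + q \<bullet> (\<zeta> - \<xi>) - C / 2 * (norm (\<zeta> - \<xi>))\<^sup>2 \<le> W \<zeta>" for \<zeta>
      proof -
        obtain a b where \<zeta>: "\<zeta> = (x + a, y + b)"
          by (metis add.commute diff_add_cancel surj_pair)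
        have "U x + (l *\<^sub>R (m x - x)) \<bullet> a - l / 2 * (norm a)\<^sup>2 \<le> U (x + a)"
          "V y + (l *\<^sub>R (n y - y)) \<bullet> b - l / 2 * (norm b)\<^sup>2 \<le> V (y + b)"
          using m(4)[of x "x + a"] n(4)[of y "y + b"] by simp_all
        moreover have "q \<bullet> (\<zeta> - \<xi>) = (l *\<^sub>R (m x - x)) \<bullet> a + (l *\<^sub>R (n y - y)) \<bullet> b - B' (x - y) \<bullet> (a - b)
           - (2 * \<eta>) *\<^sub>R x \<bullet> a - (2 * \<eta>) *\<^sub>R y \<bullet> b"
          unfolding q_def \<zeta> Pair by (simp add: inner_diff_left inner_diff_right inner_add_left)
        moreover have "C / 2 * (norm (\<zeta> - \<xi>))\<^sup>2 = (l / 2 * (norm a)\<^sup>2 + l / 2 * (norm b)\<^sup>2) + \<beta>' * ((norm a)\<^sup>2 + (norm b)\<^sup>2) + (\<eta> * (norm a)\<^sup>2 + \<eta> * (norm b)\<^sup>2)"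
          unfolding \<zeta> Pair by (simp add: C_def norm_Pair algebra_simps)
        moreover have "Q (a - b) / 2 \<le> \<beta>' * ((norm a)\<^sup>2 + (norm b)\<^sup>2)"
          using Q_diff_le[of a b] by linarith
        ultimately show ?thesis
          using exp[of x a y b] sq[of x a] sq[of y b] unfolding \<zeta> Pair W_eq distrib_left[of \<eta>] by linarith
      qed
      then show ?thesis by blast
    qed
    have W0: "W 0 = 0"
      using W_eq[of 0 0] UV0 by (simp add: zero_prod_def Q_def)
    have Wle: "W \<xi> \<le> - \<eta> * (norm \<xi>)\<^sup>2" for \<xi>
      using UV[of "fst \<xi>" "snd \<xi>"] by (simp add: W_def)
    \<comment> \<open>M collects the factors of s in all quantities that must be below \<epsilon> or
      r: 4 s for the points, l / 2 s and 8 \<beta> s for the values, and 3 \<eta> s + 2 \<beta>' s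
      for the slopes.\<close>
    define M where "M = 8 + l + 8 * \<beta> + 3 * \<eta> + 2 * \<beta>'"
    have M: "M > 0" "8 \<le> M" using l \<beta>(1) \<beta>' \<eta> by (auto simp: M_def)
    define s where "s = min 1 (min \<epsilon> r / (2 * M))"
    have s: "0 < s" "s \<le> 1" using \<epsilon> r M by (auto simp: s_def)
    have "s \<le> min \<epsilon> r / (2 * M)" by (simp add: s_def)
    then have "s * (2 * M) \<le> min \<epsilon> r" using M by (simp add: pos_le_divide_eq)
    then have sM: "s * M < \<epsilon>" "s * M < r" using s M \<epsilon> r by auto
    have s2: "s\<^sup>2 \<le> s" using s by (simp add: power2_eq_square mult_left_le)
    have "\<eta> * s > 0" using \<eta> s by simp
    \<comment> \<open>Slopes below \<eta> * s keep the contact point within |p| / \<eta> < s of the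
      origin.\<close>
    from jensen_contact[OF semiW C W0 Wle \<eta>(1) N this]
    obtain \<xi> p where \<xi>: "\<xi> \<notin> N" "norm p < \<eta> * s" "norm \<xi> \<le> norm p / \<eta>" "\<And>\<zeta>. W \<zeta> \<le> W \<xi> + p \<bullet> (\<zeta> - \<xi>)"
      by blast
    obtain x1 y1 where xy: "\<xi> = (x1, y1)" by (cases \<xi>)
    obtain p1 p2 where p12: "p = (p1, p2)" by (cases p)
    have "norm \<xi> \<le> norm p / \<eta>" by (rule \<xi>(3))
    also have "\<dots> < \<eta> * s / \<eta>" using \<xi>(2) \<eta>(1) by (rule divide_strict_right_mono)
    finally have "norm \<xi> < s" using \<eta>(1) by simp
    then have nxy: "norm x1 < s" "norm y1 < s"
      using norm_fst_le[of x1 y1] norm_snd_le[of y1 x1] unfolding xy by linarith+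
    have np: "norm p1 < \<eta> * s" "norm p2 < \<eta> * s"
      using \<xi>(2) norm_fst_le[of p1 p2] norm_snd_le[of p2 p1] unfolding p12 by linarith+
    \<comment> \<open>The slopes of U and V at the contact point: the slope of the touching plane
      plus the gradient of the smooth terms subtracted in W.\<close>
    define q1 where "q1 = p1 + B' (x1 - y1) + (2 * \<eta>) *\<^sub>R x1"
    define q2 where "q2 = p2 - B' (x1 - y1) + (2 * \<eta>) *\<^sub>R y1"
    have touch: "U (x1 + a) + V (y1 + b) \<le> U x1 + V y1 + (q1 \<bullet> a + q2 \<bullet> b) + (Q (a - b) / 2 + \<eta> * ((norm a)\<^sup>2 + (norm b)\<^sup>2))" for a b
    proof -
      have "W (x1 + a, y1 + b) \<le> W (x1, y1) + (p1 \<bullet> a + p2 \<bullet> b)"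
        using \<xi>(4)[of "(x1 + a, y1 + b)"] by (simp add: xy p12)
      moreover have "q1 \<bullet> a + q2 \<bullet> b = p1 \<bullet> a + p2 \<bullet> b + B' (x1 - y1) \<bullet> (a - b) + (2 * \<eta>) *\<^sub>R x1 \<bullet> a + (2 * \<eta>) *\<^sub>R y1 \<bullet> b"
        unfolding q1_def q2_def by (simp add: inner_diff_left inner_diff_right inner_add_left)
      ultimately show ?thesis
        using exp[of x1 a y1 b] sq[of x1 a] sq[of y1 b] unfolding W_eq distrib_left[of \<eta>] by linarith
    qed
    have tU: "U y \<le> U x1 + q1 \<bullet> (y - x1) + (\<beta>' / 2 + \<eta>) * (norm (y - x1))\<^sup>2" for y
      using touch[of "y - x1" 0] Q_le[of "y - x1"] by (simp add: algebra_simps)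
    have tV: "V y \<le> V y1 + q2 \<bullet> (y - y1) + (\<beta>' / 2 + \<eta>) * (norm (y - y1))\<^sup>2" for y
      using touch[of 0 "y - y1"] Q_le[of "- (y - y1)"] by (simp add: algebra_simps norm_minus_commute)
    have x1N: "x1 \<notin> N1" and y1N: "y1 \<notin> N2" using \<xi>(1) by (auto simp: N_def xy)
    obtain X where X0: "second_order_at U x1 q1 X \<and> (\<forall>h. - l * (norm h)\<^sup>2 \<le> X h \<bullet> h)"
      using N1(2)[of x1 q1 "\<beta>' / 2 + \<eta>", OF x1N tU] by (rule exE)
    obtain Y where Y0: "second_order_at V y1 q2 Y \<and> (\<forall>h. - l * (norm h)\<^sup>2 \<le> Y h \<bullet> h)"
      using N2(2)[of y1 q2 "\<beta>' / 2 + \<eta>", OF y1N tV] by (rule exE)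
    have X: "second_order_at U x1 q1 X" "\<And>h. - l * (norm h)\<^sup>2 \<le> X h \<bullet> h"
      and Y: "second_order_at V y1 q2 Y" "\<And>h. - l * (norm h)\<^sup>2 \<le> Y h \<bullet> h"
      using X0 Y0 by auto
    have XY: "X h \<bullet> h / 2 + Y k \<bullet> k / 2 \<le> Q (h - k) / 2 + \<eta> * ((norm h)\<^sup>2 + (norm k)\<^sup>2)" for h k
    proof (rule second_order_compare[OF X(1) Y(1)])
      fix t :: real assume "0 < t" "t \<le> 1"
      have "Q (t *\<^sub>R z) = t\<^sup>2 * Q z" for z
        using linear_scale[OF B, of t z]
        by (simp add: Q_def B'_def inner_add_left power2_eq_square algebra_simps)
      from this[of "h - k"] have "Q (t *\<^sub>R h - t *\<^sub>R k) = t\<^sup>2 * Q (h - k)"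
        by (simp only: scaleR_diff_right)
      then show "U (x1 + t *\<^sub>R h) + V (y1 + t *\<^sub>R k) \<le> U x1 + V y1 + t * (q1 \<bullet> h + q2 \<bullet> k) + t\<^sup>2 * (Q (h - k) / 2 + \<eta> * ((norm h)\<^sup>2 + (norm k)\<^sup>2))"
        using touch[of "t *\<^sub>R h" "t *\<^sub>R k"] by (simp add: power_mult_distrib algebra_simps)
    qed
    have lin0: "X 0 = 0" "Y 0 = 0"
      using X(1) Y(1) by (auto simp: second_order_at_def linear_0)
    have max1: "u 0 - l / 2 * (norm (0 - x1))\<^sup>2 \<le> u (m x1) - l / 2 * (norm (m x1 - x1))\<^sup>2"
      using m(3)[of 0 x1] m(2)[of x1] r by simp
    have max2: "v 0 - l / 2 * (norm (0 - y1))\<^sup>2 \<le> v (n y1) - l / 2 * (norm (n y1 - y1))\<^sup>2"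
      using n(3)[of 0 y1] n(2)[of y1] r by simp
    have mD: "norm (m x1) \<le> r" "norm (n y1) \<le> r" using m(1)[of x1] n(1)[of y1] by auto
    note sm1 = sup_convolution_maximizer_small[OF max1 u0 ub[OF mD(1)] l]
    note sm2 = sup_convolution_maximizer_small[OF max2 v0 vb[OF mD(2)] l]
    have Ms: "s * M = 8 * s + l * s + 8 * (\<beta> * s) + 3 * (\<eta> * s) + 2 * (\<beta>' * s)"
      by (simp add: M_def algebra_simps)
    have pos: "0 < l * s" "0 < \<beta> * s" "0 < \<eta> * s" "0 < \<beta>' * s"
      using s l \<beta>(1) \<eta>(1) \<beta>' by auto
    have val: "\<bar>w\<bar> < \<epsilon>" if "- (l / 2 * (norm z)\<^sup>2) \<le> w" "w \<le> \<beta> / 2 * (norm z')\<^sup>2" "norm z < s" "norm z' \<le> 4 * norm z" for w and z z' :: 'a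
    proof -
      have "(norm z)\<^sup>2 \<le> s\<^sup>2" "(norm z')\<^sup>2 \<le> (4 * s)\<^sup>2"
        using that(3,4) by (intro power_mono; simp)+
      then have "(norm z)\<^sup>2 \<le> s" "(norm z')\<^sup>2 \<le> 16 * s" using s2 by (auto simp: power_mult_distrib)
      then have "l / 2 * (norm z)\<^sup>2 \<le> l / 2 * s" "\<beta> / 2 * (norm z')\<^sup>2 \<le> \<beta> / 2 * (16 * s)"
        using l \<beta>(1) by (intro mult_left_mono; simp)+
      then show ?thesis using that(1,2) sM(1) Ms pos s by (simp add: abs_less_iff)
    qed
    have nB: "norm (B' (x1 - y1)) < 2 * (\<beta>' * s)"
    proof -
      have "norm (x1 - y1) < 2 * s" using norm_triangle_ineq4[of x1 y1] nxy by linarith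
      then have "\<beta>' * norm (x1 - y1) < \<beta>' * (2 * s)" using \<beta>' by simp
      then show ?thesis using B'n[of "x1 - y1"] by simp
    qed
    have nq: "norm q1 < \<epsilon>" "norm q2 < \<epsilon>"
    proof -
      have "norm ((2 * \<eta>) *\<^sub>R x1) < 2 * (\<eta> * s)" "norm ((2 * \<eta>) *\<^sub>R y1) < 2 * (\<eta> * s)"
        using nxy \<eta>(1) by auto
      moreover have "norm q1 \<le> norm p1 + norm (B' (x1 - y1)) + norm ((2 * \<eta>) *\<^sub>R x1)"
        unfolding q1_def by (meson add_right_mono norm_triangle_ineq order_trans)
      moreover have "norm q2 \<le> norm p2 + norm (B' (x1 - y1)) + norm ((2 * \<eta>) *\<^sub>R y1)"
        unfolding q2_def by (meson add_right_mono norm_triangle_ineq norm_triangle_ineq4 order_trans)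
      ultimately show "norm q1 < \<epsilon>" "norm q2 < \<epsilon>"
        using np nB sM(1) Ms pos s by linarith+
    qed
    have nmx: "norm (m x1) < 4 * s" "norm (n y1) < 4 * s" using sm1(1) sm2(1) nxy by linarith+
    have rs: "4 * s < r" "4 * s < \<epsilon>" using sM Ms pos s by linarith+
    have jU: "upper_jet u (m x1) q1 X"
      using m(2)[of x1] by (rule upper_jet_sup_convolution[where r = r, OF _ _ _ X(1)]) (use m(3) nmx rs in auto)
    have jV: "upper_jet v (n y1) q2 Y"
      using n(2)[of y1] by (rule upper_jet_sup_convolution[where r = r, OF _ _ _ Y(1)]) (use n(3) nmx rs in auto)
    have bX: "\<bar>X h \<bullet> h\<bar> \<le> (l + \<beta>' + 1) * (norm h)\<^sup>2" for h
    proof -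
      have "X h \<bullet> h \<le> \<beta>' * (norm h)\<^sup>2 + (2 * \<eta>) * (norm h)\<^sup>2"
        using XY[of h 0] Q_le[of h] by (simp add: lin0)
      moreover have "(2 * \<eta>) * (norm h)\<^sup>2 \<le> 1 * (norm h)\<^sup>2" using \<eta> by (intro mult_right_mono) auto
      moreover have "0 \<le> l * (norm h)\<^sup>2" "0 \<le> \<beta>' * (norm h)\<^sup>2" "0 \<le> (norm h)\<^sup>2" using l \<beta>' by auto
      ultimately show ?thesis using X(2)[of h] unfolding abs_le_iff distrib_right by linarith
    qed
    have bY: "\<bar>Y h \<bullet> h\<bar> \<le> (l + \<beta>' + 1) * (norm h)\<^sup>2" for h
    proof -
      have "Y h \<bullet> h \<le> \<beta>' * (norm h)\<^sup>2 + (2 * \<eta>) * (norm h)\<^sup>2"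
        using XY[of 0 h] Q_le[of "- h"] by (simp add: lin0)
      moreover have "(2 * \<eta>) * (norm h)\<^sup>2 \<le> 1 * (norm h)\<^sup>2" using \<eta> by (intro mult_right_mono) auto
      moreover have "0 \<le> l * (norm h)\<^sup>2" "0 \<le> \<beta>' * (norm h)\<^sup>2" "0 \<le> (norm h)\<^sup>2" using l \<beta>' by auto
      ultimately show ?thesis using Y(2)[of h] unfolding abs_le_iff distrib_right by linarith
    qed
    have bXY: "X h \<bullet> h + Y k \<bullet> k \<le> B (h - k) \<bullet> (h - k) + \<tau> * (norm (h - k))\<^sup>2 + \<epsilon> * ((norm h)\<^sup>2 + (norm k)\<^sup>2)" for h k
    proof -
      have "2 * \<eta> * ((norm h)\<^sup>2 + (norm k)\<^sup>2) \<le> \<epsilon> * ((norm h)\<^sup>2 + (norm k)\<^sup>2)"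
        using \<eta> by (intro mult_right_mono) auto
      moreover have "X h \<bullet> h + Y k \<bullet> k \<le> Q (h - k) + 2 * \<eta> * ((norm h)\<^sup>2 + (norm k)\<^sup>2)"
        using XY[of h k] by simp
      ultimately show ?thesis unfolding Q_eq by (rule order_trans[rotated, OF add_left_mono])
    qed
    show "?P (l + \<beta>' + 1) \<epsilon>"
      using nmx rs nq jU jV bX bY bXY val[OF sm1(2) ub[OF mD(1)] nxy(1) sm1(1)] val[OF sm2(2) vb[OF mD(2)] nxy(2) sm2(1)]
      by (intro exI[of _ "m x1"] exI[of _ "n y1"] exI[of _ q1] exI[of _ q2] exI[of _ X] exI[of _ Y] conjI allI) linarith+
  qed
qed

section \<open>Matrices, jets and ellipticity\<close>

lemma symmetric_mat_inner: "symmetric_mat M \<Longrightarrow> (M *v x) \<bullet> y = x \<bullet> (M *v y)"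
  by (metis symmetric_mat_def dot_lmul_matrix vector_transpose_matrix)

lemma symmetric_mat_add: "symmetric_mat M \<Longrightarrow> symmetric_mat N \<Longrightarrow> symmetric_mat (M + N)"
  by (simp add: symmetric_mat_def transpose_def vec_eq_iff)

lemma symmetric_mat_uminus: "symmetric_mat M \<Longrightarrow> symmetric_mat (- M)"
  by (simp add: symmetric_mat_def transpose_def vec_eq_iff)

lemma symmetric_mat_diff: "symmetric_mat M \<Longrightarrow> symmetric_mat N \<Longrightarrow> symmetric_mat (M - N)"
  by (simp add: symmetric_mat_def transpose_def vec_eq_iff)

lemma symmetric_mat_mat: "symmetric_mat (mat c)"
  by (simp add: symmetric_mat_def)

lemma mat_vector_mult: "mat c *v x = c *\<^sub>R (x :: real^'n)"
  by (simp add: vec_eq_iff matrix_vector_mult_def mat_def if_distrib[where f = "\<lambda>y. y * _"] cong: if_cong)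

lemma trace_mat: "trace (mat c :: real^'n^'n) = real CARD('n) * c"
  by (simp add: trace_def mat_def)

lemma C2_on_quadratic:
  fixes M :: "real^'n^'n"
  assumes M: "symmetric_mat M"
  shows "C2_on S (\<lambda>x. q \<bullet> (x - z) + (x - z) \<bullet> (M *v (x - z)) / 2) (\<lambda>x. q + M *v (x - z)) (\<lambda>_. M)"
  unfolding C2_on_def
proof (intro conjI ballI)
  fix x
  have lin: "((\<lambda>x. M *v (x - z)) has_derivative (\<lambda>h. M *v h)) (at x)"
    by (intro bounded_linear.has_derivative[OF matrix_vector_mul_bounded_linear]) (auto intro!: derivative_eq_intros)
  show "((\<lambda>x. q \<bullet> (x - z) + (x - z) \<bullet> (M *v (x - z)) / 2) has_derivative (\<lambda>h. (q + M *v (x - z)) \<bullet> h)) (at x)"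
  proof -
    have sq: "((\<lambda>x. (x - z) \<bullet> (M *v (x - z))) has_derivative (\<lambda>h. (x - z) \<bullet> (M *v h) + h \<bullet> (M *v (x - z)))) (at x)"
      by (rule has_derivative_inner[OF _ lin]) (auto intro!: derivative_eq_intros)
    have "((\<lambda>x. q \<bullet> (x - z) + (1 / 2) *\<^sub>R ((x - z) \<bullet> (M *v (x - z)))) has_derivative
        (\<lambda>h. q \<bullet> h + (1 / 2) *\<^sub>R ((x - z) \<bullet> (M *v h) + h \<bullet> (M *v (x - z))))) (at x)"
      by (intro has_derivative_add has_derivative_scaleR_right sq) (auto intro!: derivative_eq_intros)
    moreover have "q \<bullet> h + (1 / 2) *\<^sub>R ((x - z) \<bullet> (M *v h) + h \<bullet> (M *v (x - z))) = (q + M *v (x - z)) \<bullet> h" for h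
      using symmetric_mat_inner[OF M, of "x - z" h] by (simp add: inner_add_left inner_commute[of h])
    ultimately show ?thesis by simp
  qed
  show "((\<lambda>x. q + M *v (x - z)) has_derivative (\<lambda>h. M *v h)) (at x)"
    using has_derivative_add[OF has_derivative_const lin] by simp
qed simp

text \<open>The quadratic polynomial with Hessian M + e I is an admissible test function: the extra
  e / 2 |k|^2 dominates the remainder of the jet, so u minus the polynomial has a maximum at x on a
  small ball.\<close>

lemma visc_sub_jet:
  fixes u :: "real^'n \<Rightarrow> real"
  assumes sub: "visc_sub F \<alpha> \<beta> b \<gamma> g \<Omega> u" and \<Omega>: "open \<Omega>" "x \<in> \<Omega>"
    and jet: "upper_jet u x q X" and M: "symmetric_mat M" "\<And>k. k \<bullet> (M *v k) = X k \<bullet> k" and e: "e > 0"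
  shows "- Fp F \<alpha> q (M + mat e) + b x * norm q powr \<beta> + \<gamma> (u x) \<le> g x"
proof -
  obtain d where d: "d > 0" "\<And>k. norm k < d \<Longrightarrow> u (x + k) \<le> u x + q \<bullet> k + X k \<bullet> k / 2 + e / 2 * (norm k)\<^sup>2"
    using jet e unfolding upper_jet_def by (metis half_gt_zero)
  obtain d' where d': "d' > 0" "ball x d' \<subseteq> \<Omega>" using \<Omega> open_contains_ball by blast
  let ?r = "min d d'"
  let ?M = "M + mat e"
  have symM: "symmetric_mat ?M" using M(1) symmetric_mat_mat by (rule symmetric_mat_add)
  let ?\<phi> = "\<lambda>y. q \<bullet> (y - x) + (y - x) \<bullet> (?M *v (y - x)) / 2"
  have "\<forall>y\<in>ball x ?r. u y - ?\<phi> y \<le> u x - ?\<phi> x"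
  proof
    fix y assume "y \<in> ball x ?r"
    then have "norm (y - x) < d" by (simp add: dist_norm norm_minus_commute)
    then have "u (x + (y - x)) \<le> u x + q \<bullet> (y - x) + X (y - x) \<bullet> (y - x) / 2 + e / 2 * (norm (y - x))\<^sup>2"
      by (rule d(2))
    moreover have "(y - x) \<bullet> (?M *v (y - x)) = X (y - x) \<bullet> (y - x) + e * (norm (y - x))\<^sup>2"
      by (simp only: matrix_vector_mult_add_rdistrib mat_vector_mult inner_add_right M(2) inner_scaleR_right power2_norm_eq_inner)
    ultimately show "u y - ?\<phi> y \<le> u x - ?\<phi> x" by (simp add: add_divide_distrib)
  qed
  moreover have "ball x ?r \<subseteq> \<Omega>" "?r > 0" using d(1) d' by auto
  ultimately have "- Fp F \<alpha> (q + ?M *v (x - x)) ?M + b x * norm (q + ?M *v (x - x)) powr \<beta> + \<gamma> (u x) \<le> g x"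
    using sub[unfolded visc_sub_def, THEN conjunct2, rule_format, OF \<Omega>(2) _ _ C2_on_quadratic[OF symM]] by blast
  then show ?thesis by simp
qed

section \<open>Reduction of supersolutions to subsolutions by reflection\<close>

lemma Theta_uminus: "Theta \<alpha> (- p) = Theta \<alpha> p"
  by (simp add: Theta_def vec_eq_iff)

lemma Theta_conj_nth:
  fixes M :: "real^'n^'n"
  shows "(Theta \<alpha> p ** M ** Theta \<alpha> p) $ i $ j = \<bar>p $ i\<bar> powr (\<alpha> / 2) * M $ i $ j * \<bar>p $ j\<bar> powr (\<alpha> / 2)"
  by (simp add: matrix_matrix_mult_def Theta_def if_distrib[where f = "\<lambda>y. _ * y"] if_distrib[where f = "\<lambda>y. y * _"] cong: if_cong)

lemma Theta_conj_uminus: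
  fixes M :: "real^'n^'n"
  shows "Theta \<alpha> p ** (- M) ** Theta \<alpha> p = - (Theta \<alpha> p ** M ** Theta \<alpha> p)"
  by (simp add: vec_eq_iff Theta_conj_nth)

lemma Fp_dual: "Fp (\<lambda>M. - F (- M)) \<alpha> p M = - Fp F \<alpha> (- p) (- M)"
  by (simp add: Fp_def Theta_uminus Theta_conj_uminus)

lemma C2_on_uminus:
  assumes "C2_on S \<phi> D\<phi> H\<phi>"
  shows "C2_on S (\<lambda>x. - \<phi> x) (\<lambda>x. - D\<phi> x) (\<lambda>x. - H\<phi> x)"
proof -
  have "- (M :: real^'n^'n) *v h = - (M *v h)" for M h
    by (simp add: vec_eq_iff matrix_vector_mult_def sum_negf)
  then have e: "(\<lambda>h. - D\<phi> x \<bullet> h) = (\<lambda>h. - (D\<phi> x \<bullet> h))" "(\<lambda>h. - H\<phi> x *v h) = (\<lambda>h. - (H\<phi> x *v h))" for x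
    by auto
  show ?thesis
    using assms unfolding C2_on_def e by (intro conjI ballI has_derivative_minus continuous_on_minus) auto
qed

text \<open>Changing the sign of the whole inequality and of the unknown stays within the same
  family of equations, with F M replaced by - F (- M), \<gamma> t by - \<gamma> (- t), and b and f
  by their negatives. So \<open>visc_sub_jet\<close> also covers supersolutions.\<close>

lemma visc_super_imp_sub_dual:
  fixes v :: "real^'n \<Rightarrow> real"
  assumes "visc_super F \<alpha> \<beta> b \<gamma> f \<Omega> v"
  shows "visc_sub (\<lambda>M. - F (- M)) \<alpha> \<beta> (\<lambda>x. - b x) (\<lambda>t. - \<gamma> (- t)) (\<lambda>x. - f x) \<Omega> (\<lambda>x. - v x)"
  unfolding visc_sub_def
proof (intro conjI ballI allI impI)
  have lsc: "lsc_on \<Omega> v" using assms by (simp add: visc_super_def)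
  show "usc_on \<Omega> (\<lambda>x. - v x)"
    unfolding usc_on_def
  proof (intro ballI allI impI)
    fix x :: "real^'n" and e :: real assume "x \<in> \<Omega>" "e > 0"
    then obtain d where "d > 0" "\<And>y. y \<in> \<Omega> \<Longrightarrow> dist y x < d \<Longrightarrow> v x - e < v y"
      using lsc unfolding lsc_on_def by blast
    then show "\<exists>d>0. \<forall>y\<in>\<Omega>. dist y x < d \<longrightarrow> - v y < - v x + e"
      by (intro exI[of _ d]) force
  qed
  fix x r \<phi> D\<phi> H\<phi>
  assume x: "x \<in> \<Omega>" and r: "0 < r" "ball x r \<subseteq> \<Omega>" and \<phi>: "C2_on (ball x r) \<phi> D\<phi> H\<phi>"
    and max: "\<forall>y\<in>ball x r. - v y - \<phi> y \<le> - v x - \<phi> x"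
  have "\<forall>y\<in>ball x r. v y - - \<phi> y \<ge> v x - - \<phi> x" using max by force
  then have "- Fp F \<alpha> (- D\<phi> x) (- H\<phi> x) + b x * norm (- D\<phi> x) powr \<beta> + \<gamma> (v x) \<ge> f x"
    using assms[unfolded visc_super_def, THEN conjunct2, rule_format, OF x r C2_on_uminus[OF \<phi>]] by blast
  then show "- Fp (\<lambda>M. - F (- M)) \<alpha> (D\<phi> x) (H\<phi> x) + - b x * norm (D\<phi> x) powr \<beta> + - \<gamma> (- (- v x)) \<le> - f x"
    by (simp add: Fp_dual)
qed

lemma visc_super_jet:
  fixes v :: "real^'n \<Rightarrow> real"
  assumes super: "visc_super F \<alpha> \<beta> b \<gamma> f \<Omega> v" and \<Omega>: "open \<Omega>" "x \<in> \<Omega>"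
    and jet: "upper_jet (\<lambda>x. - v x) x q X" and M: "symmetric_mat M" "\<And>k. k \<bullet> (M *v k) = X k \<bullet> k" and e: "e > 0"
  shows "f x \<le> - Fp F \<alpha> (- q) (- (M + mat e)) + b x * norm q powr \<beta> + \<gamma> (v x)"
  using visc_sub_jet[OF visc_super_imp_sub_dual[OF super] \<Omega> jet M e] by (simp add: Fp_dual)

section \<open>Continuity and ellipticity of F\<close>

lemma norm_matrix_vector_mult_le:
  fixes M :: "real^'n^'m"
  shows "norm (M *v x) \<le> norm M * norm x"
proof -
  have "norm (M *v x) = L2_set (\<lambda>i. \<bar>M $ i \<bullet> x\<bar>) UNIV"
    by (simp add: norm_vec_def matrix_vector_mult_def inner_vec_def)
  also have "\<dots> \<le> L2_set (\<lambda>i. norm (M $ i) * norm x) UNIV"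
    by (intro L2_set_mono Cauchy_Schwarz_ineq2) auto
  also have "\<dots> = norm M * norm x"
    by (simp add: L2_set_left_distrib[symmetric] norm_vec_def)
  finally show ?thesis .
qed

text \<open>With c = norm (M - N), lower N to N - c I, which does not increase F, and climb to M by
  the positive semidefinite matrix M - N + c I. Its trace is at most 2 n c, with one n c from each
  of the two parts.\<close>

lemma structural_F_lipschitz:
  fixes F :: "real^'n^'n \<Rightarrow> real"
  assumes F: "structural_F F a A" and M: "symmetric_mat M" and N: "symmetric_mat N"
  shows "\<bar>F M - F N\<bar> \<le> 2 * A * CARD('n) * norm (M - N)"
proof -
  have aA: "0 < a" "0 < A" using F by (auto simp: structural_F_def)
  have ell: "a * trace P \<le> F (M + P) - F M" "F (M + P) - F M \<le> A * trace P"
    if "symmetric_mat M" "symmetric_mat P" "psd_mat P" for M P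
    using F that unfolding structural_F_def by blast+
  have le: "F M - F N \<le> 2 * A * CARD('n) * norm (M - N)" if M: "symmetric_mat M" and N: "symmetric_mat N" for M N
  proof -
    let ?c = "norm (M - N)"
    let ?P = "M - N + mat ?c"
    have symP: "symmetric_mat ?P" and symN: "symmetric_mat (N - mat ?c)"
      using M N symmetric_mat_mat by (auto intro!: symmetric_mat_add symmetric_mat_diff)
    have psdP: "psd_mat ?P"
      unfolding psd_mat_def
    proof
      fix x :: "real^'n"
      have "\<bar>x \<bullet> ((M - N) *v x)\<bar> \<le> norm x * norm ((M - N) *v x)" by (rule Cauchy_Schwarz_ineq2)
      also have "\<dots> \<le> norm x * (?c * norm x)" by (intro mult_left_mono norm_matrix_vector_mult_le) auto
      finally have "- (?c * (x \<bullet> x)) \<le> x \<bullet> ((M - N) *v x)"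
        by (simp add: dot_square_norm power2_eq_square abs_le_iff mult_ac)
      moreover have "x \<bullet> (?P *v x) = x \<bullet> ((M - N) *v x) + ?c * (x \<bullet> x)"
        by (simp only: matrix_vector_mult_add_rdistrib mat_vector_mult inner_add_right inner_scaleR_right)
      ultimately show "0 \<le> x \<bullet> (?P *v x)" by simp
    qed
    have "psd_mat (mat ?c :: real^'n^'n)" by (simp add: psd_mat_def mat_vector_mult)
    then have "a * trace (mat ?c :: real^'n^'n) \<le> F ((N - mat ?c) + mat ?c) - F (N - mat ?c)"
      by (rule ell(1)[OF symN symmetric_mat_mat])
    moreover have "0 \<le> a * trace (mat ?c :: real^'n^'n)" using aA by (simp add: trace_mat)
    moreover have "(N - mat ?c) + mat ?c = N" by simp
    ultimately have 1: "F (N - mat ?c) \<le> F N" by simp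
    have "F ((N - mat ?c) + ?P) - F (N - mat ?c) \<le> A * trace ?P"
      by (rule ell(2)[OF symN symP psdP])
    moreover have "(N - mat ?c) + ?P = M" by simp
    ultimately have 2: "F M - F (N - mat ?c) \<le> A * trace ?P" by simp
    have "trace (M - N) \<le> (\<Sum>i\<in>(UNIV::'n set). ?c)"
      unfolding trace_def
    proof (rule sum_mono)
      fix i :: 'n
      have "\<bar>(M - N) $ i $ i\<bar> \<le> norm ((M - N) $ i)" by (rule component_le_norm_cart)
      also have "\<dots> \<le> ?c" by (rule Finite_Cartesian_Product.norm_nth_le)
      finally show "(M - N) $ i $ i \<le> ?c" by linarith
    qed
    then have "trace ?P \<le> 2 * CARD('n) * ?c"
      by (simp only: trace_add trace_mat sum_constant)
    then have "A * trace ?P \<le> A * (2 * CARD('n) * ?c)" using aA by simp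
    then show ?thesis using 1 2 by (simp add: algebra_simps)
  qed
  show ?thesis
    using le[OF M N] le[OF N M] by (simp add: abs_le_iff norm_minus_commute)
qed

lemma Fp_tendsto:
  fixes F :: "real^'n^'n \<Rightarrow> real"
  assumes F: "structural_F F a A" and \<alpha>: "\<alpha> > 0"
    and M: "\<And>n. symmetric_mat (M n)" "symmetric_mat M0" "M \<longlonglongrightarrow> M0" and p: "p \<longlonglongrightarrow> p0"
  shows "(\<lambda>n::nat. Fp F \<alpha> (p n) (M n)) \<longlonglongrightarrow> Fp F \<alpha> p0 M0"
proof -
  let ?T = "\<lambda>p M. Theta \<alpha> p ** M ** Theta \<alpha> p"
  have sym: "symmetric_mat (?T p M)" if "symmetric_mat M" for p M
    using that by (simp add: symmetric_mat_def transpose_def vec_eq_iff Theta_conj_nth)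
  have lim: "(\<lambda>n. ?T (p n) (M n)) \<longlonglongrightarrow> ?T p0 M0"
  proof (intro vec_tendstoI)
    fix i j
    have pow: "(\<lambda>n. \<bar>p n $ i\<bar> powr (\<alpha> / 2)) \<longlonglongrightarrow> \<bar>p0 $ i\<bar> powr (\<alpha> / 2)" for i
      using \<alpha> by (intro tendsto_powr' tendsto_intros p) auto
    show "(\<lambda>n. ?T (p n) (M n) $ i $ j) \<longlonglongrightarrow> ?T p0 M0 $ i $ j"
      unfolding Theta_conj_nth by (intro tendsto_intros pow M)
  qed
  have "(\<lambda>n. norm (?T (p n) (M n) - ?T p0 M0)) \<longlonglongrightarrow> 0"
    by (rule tendsto_norm_zero[OF LIM_zero[OF lim]])
  then have "(\<lambda>n. 2 * A * CARD('n) * norm (?T (p n) (M n) - ?T p0 M0)) \<longlonglongrightarrow> 0"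
    by (rule tendsto_mult_right_zero)
  moreover have "\<forall>\<^sub>F n in sequentially. norm (F (?T (p n) (M n)) - F (?T p0 M0)) \<le> 2 * A * CARD('n) * norm (?T (p n) (M n) - ?T p0 M0)"
    unfolding real_norm_def
    by (intro always_eventually allI structural_F_lipschitz[OF F] sym M(1,2))
  ultimately have "(\<lambda>n. F (?T (p n) (M n)) - F (?T p0 M0)) \<longlonglongrightarrow> 0"
    by (rule Lim_null_comparison[rotated])
  then show ?thesis
    unfolding Fp_def by (rule LIM_zero_cancel)
qed

text \<open>Conjugation by the diagonal matrix keeps X + Y nonpositive, so passing from X to - Y
  adds a positive semidefinite matrix inside F. Its trace weights the diagonal of X + Y by
  |p_i|^\<alpha>; this is all the ellipticity that remains.\<close>

lemma Fp_ellipticity: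
  fixes F :: "real^'n^'n \<Rightarrow> real"
  assumes F: "structural_F F a A" and X: "symmetric_mat X" and Y: "symmetric_mat Y"
    and le: "\<And>w. w \<bullet> ((X + Y) *v w) \<le> 0"
  shows "Fp F \<alpha> p X - Fp F \<alpha> p (- Y) \<le> a * (\<Sum>i\<in>UNIV. \<bar>p $ i\<bar> powr \<alpha> * (X + Y) $ i $ i)"
proof -
  let ?T = "\<lambda>M. Theta \<alpha> p ** M ** Theta \<alpha> p"
  have sym: "symmetric_mat (?T M)" if "symmetric_mat M" for M
    using that by (simp add: symmetric_mat_def transpose_def vec_eq_iff Theta_conj_nth)
  let ?N = "- ?T (X + Y)"
  have symN: "symmetric_mat ?N" using X Y by (intro symmetric_mat_uminus sym symmetric_mat_add)
  have "psd_mat ?N"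
    unfolding psd_mat_def
  proof
    fix x :: "real^'n"
    define w where "w = (\<chi> i. \<bar>p $ i\<bar> powr (\<alpha> / 2) * x $ i)"
    have "x \<bullet> (?N *v x) = - (w \<bullet> ((X + Y) *v w))"
      by (simp add: inner_vec_def matrix_vector_mult_def w_def Theta_conj_nth sum_distrib_left sum_negf mult_ac)
    then show "0 \<le> x \<bullet> (?N *v x)" using le[of w] by simp
  qed
  then have "a * trace ?N \<le> F (?T X + ?N) - F (?T X)"
    using F sym[OF X] symN unfolding structural_F_def by blast
  moreover have "?T X + ?N = ?T (- Y)"
    by (simp add: vec_eq_iff Theta_conj_nth algebra_simps)
  moreover have "trace ?N = - (\<Sum>i\<in>UNIV. \<bar>p $ i\<bar> powr \<alpha> * (X + Y) $ i $ i)"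
    by (simp add: trace_def Theta_conj_nth sum_negf mult_ac powr_add[symmetric] flip: mult.assoc)
  ultimately show ?thesis by (simp add: Fp_def)
qed

text \<open>Polarisation at pairs of basis vectors bounds each entry by \<Lambda>, and the norm is
  at most the sum of the absolute entries.\<close>

lemma symmetric_mat_norm_le:
  fixes M :: "real^'n^'n" and \<Lambda> :: real
  assumes M: "symmetric_mat M" and le: "\<And>k. \<bar>k \<bullet> (M *v k)\<bar> \<le> \<Lambda> * (norm k)\<^sup>2"
  shows "norm M \<le> CARD('n) * (CARD('n) * \<Lambda>)"
proof -
  have entry: "\<bar>M $ i $ j\<bar> \<le> \<Lambda>" for i j
  proof -
    let ?a = "axis i 1 :: real^'n" and ?b = "axis j 1 :: real^'n"
    have Mij: "?a \<bullet> (M *v ?b) = M $ i $ j"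
      by (simp add: inner_axis_axis inner_axis' matrix_vector_mult_basis column_def)
    have e: "4 * (?a \<bullet> (M *v ?b)) = (?a + ?b) \<bullet> (M *v (?a + ?b)) - (?a - ?b) \<bullet> (M *v (?a - ?b))"
      using symmetric_mat_inner[OF M, of ?b ?a]
      by (simp add: matrix_vector_right_distrib matrix_vector_mult_diff_distrib inner_simps inner_commute)
    have "(norm (?a + ?b))\<^sup>2 + (norm (?a - ?b))\<^sup>2 = 2 * (?a \<bullet> ?a + ?b \<bullet> ?b)"
      unfolding power2_norm_eq_inner by (simp add: inner_simps)
    also have "\<dots> = 4" by (simp add: inner_axis_axis)
    finally have n: "\<Lambda> * (norm (?a + ?b))\<^sup>2 + \<Lambda> * (norm (?a - ?b))\<^sup>2 = 4 * \<Lambda>"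
      by (simp flip: distrib_left)
    have "\<bar>4 * M $ i $ j\<bar> \<le> 4 * \<Lambda>"
      using e le[of "?a + ?b"] le[of "?a - ?b"] n unfolding Mij by linarith
    then show ?thesis by (simp add: abs_mult)
  qed
  have "norm M \<le> (\<Sum>i\<in>UNIV. norm (M $ i))"
    unfolding norm_vec_def by (rule L2_set_le_sum) simp
  also have "\<dots> \<le> (\<Sum>i\<in>(UNIV::'n set). \<Sum>j\<in>(UNIV::'n set). \<bar>M $ i $ j\<bar>)"
    by (intro sum_mono norm_le_l1_cart)
  also have "\<dots> \<le> (\<Sum>i\<in>(UNIV::'n set). \<Sum>j\<in>(UNIV::'n set). \<Lambda>)"
    by (intro sum_mono entry)
  finally show ?thesis by simp
qed

lemma symmetric_matrix_of_form:
  fixes X :: "real^'n \<Rightarrow> real^'n"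
  assumes "linear X"
  obtains M where "symmetric_mat M" "\<And>k. k \<bullet> (M *v k) = X k \<bullet> k"
proof
  let ?M = "(1 / 2) *\<^sub>R (matrix X + transpose (matrix X))"
  show "symmetric_mat ?M"
    by (simp add: symmetric_mat_def transpose_def vec_eq_iff)
  fix k
  have "k \<bullet> (transpose (matrix X) *v k) = (matrix X *v k) \<bullet> k"
    by (metis dot_lmul_matrix inner_commute vector_transpose_matrix)
  moreover have "matrix X *v k = X k" using assms by (simp add: matrix_works)
  ultimately show "k \<bullet> (?M *v k) = X k \<bullet> k"
    by (simp add: scaleR_matrix_vector_assoc[symmetric] matrix_vector_mult_add_rdistrib inner_add_right inner_commute)
qed

lemma tendsto_holder:
  assumes b: "holder_on \<Omega> b" and x: "x \<in> \<Omega>" "\<And>n. xs n \<in> \<Omega>" "xs \<longlonglongrightarrow> x"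
  shows "(\<lambda>n. b (xs n)) \<longlonglongrightarrow> b x"
proof -
  obtain C \<theta> where \<theta>: "0 < \<theta>" and C: "\<forall>x\<in>\<Omega>. \<forall>y\<in>\<Omega>. \<bar>b x - b y\<bar> \<le> C * dist x y powr \<theta>"
    using b unfolding holder_on_def by blast
  have "(\<lambda>n. dist (xs n) x powr \<theta>) \<longlonglongrightarrow> 0 powr \<theta>"
    using \<theta> x(3) by (intro tendsto_powr' tendsto_const) (auto simp: tendsto_dist_iff[symmetric])
  then have "(\<lambda>n. C * dist (xs n) x powr \<theta>) \<longlonglongrightarrow> 0"
    by (intro tendsto_mult_right_zero) simp
  moreover have "\<forall>\<^sub>F n in sequentially. norm (b (xs n) - b x) \<le> C * dist (xs n) x powr \<theta>"
    using C x by (intro always_eventually) auto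
  ultimately have "(\<lambda>n. b (xs n) - b x) \<longlonglongrightarrow> 0"
    by (rule Lim_null_comparison[rotated])
  then show ?thesis by (rule LIM_zero_cancel)
qed

section \<open>Doubling of variables for viscosity solutions\<close>

lemma upper_jet_shift:
  assumes "upper_jet (\<lambda>h. w (z + h) - c - p \<bullet> h) x q X"
  shows "upper_jet w (z + x) (q + p) X"
  using assms unfolding upper_jet_def by (simp add: inner_simps algebra_simps)

lemma usc_on_shift:
  fixes w :: "'a::real_inner \<Rightarrow> real"
  assumes w: "usc_on \<Omega> w" and D: "\<And>h. h \<in> D \<Longrightarrow> z + h \<in> \<Omega>"
  shows "usc_on D (\<lambda>h. w (z + h) - c - p \<bullet> h)"
proof -
  have "usc_on D (\<lambda>h. w (z + h))"
    unfolding usc_on_def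
  proof (intro ballI allI impI)
    fix x e assume "x \<in> D" "(e::real) > 0"
    then obtain d where d: "d > 0" "\<And>y. y \<in> \<Omega> \<Longrightarrow> dist y (z + x) < d \<Longrightarrow> w y < w (z + x) + e"
      using w D unfolding usc_on_def by blast
    have "w (z + y) < w (z + x) + e" if "y \<in> D" "dist y x < d" for y
      using d(2)[of "z + y"] D that by simp
    then show "\<exists>d>0. \<forall>y\<in>D. dist y x < d \<longrightarrow> w (z + y) < w (z + x) + e"
      using d(1) by blast
  qed
  then have "usc_on D (\<lambda>h. w (z + h) + (- c - p \<bullet> h))"
    by (rule usc_on_add_continuous) (intro continuous_intros)
  then show ?thesis by (simp add: algebra_simps)
qed

lemma visc_super_usc: "visc_super F \<alpha> \<beta> b \<gamma> f \<Omega> v \<Longrightarrow> usc_on \<Omega> (\<lambda>x. - v x)"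
  using visc_super_imp_sub_dual[of F \<alpha> \<beta> b \<gamma> f \<Omega> v] unfolding visc_sub_def by blast

text \<open>Translation to xh and yh and removal of the affine part of slope p bring u and - v into
  the situation of \<open>theorem_on_sums\<close>. The jets become test functions for the two
  equations at the perturbed points, and the two inequalities are subtracted.\<close>

lemma viscosity_doubling_approx:
  fixes u v :: "real^'n \<Rightarrow> real" and B :: "real^'n^'n"
  assumes \<Omega>: "open \<Omega>" "xh \<in> \<Omega>" "yh \<in> \<Omega>"
    and sub: "visc_sub F \<alpha> \<beta> b \<gamma> g \<Omega> u" and super: "visc_super F \<alpha> \<beta> b \<gamma> f \<Omega> v"
    and r0: "r0 > 0"
    and le: "\<And>x y. x \<in> ball xh r0 \<Longrightarrow> y \<in> ball yh r0 \<Longrightarrow> u x - v y \<le> u xh - v yh + p \<bullet> ((x - y) - (xh - yh))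
      + ((x - y) - (xh - yh)) \<bullet> (B *v ((x - y) - (xh - yh))) / 2"
    and B: "symmetric_mat B" and \<tau>: "\<tau> > 0"
  shows "\<exists>\<Lambda>. \<forall>\<epsilon>>0. \<exists>x y q s M N. norm x < \<epsilon> \<and> norm y < \<epsilon> \<and> xh + x \<in> \<Omega> \<and> yh + y \<in> \<Omega> \<and>
    \<bar>u (xh + x) - u xh - p \<bullet> x\<bar> < \<epsilon> \<and> \<bar>v (yh + y) - v yh - p \<bullet> y\<bar> < \<epsilon> \<and> norm q < \<epsilon> \<and> norm s < \<epsilon> \<and>
    symmetric_mat M \<and> symmetric_mat N \<and> norm M \<le> \<Lambda> \<and> norm N \<le> \<Lambda> \<and>
    (\<forall>h k. h \<bullet> (M *v h) + k \<bullet> (N *v k) \<le> (h - k) \<bullet> (B *v (h - k)) + \<tau> * (norm (h - k))\<^sup>2 + \<epsilon> * ((norm h)\<^sup>2 + (norm k)\<^sup>2)) \<and>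
    f (yh + y) - g (xh + x) + \<gamma> (u (xh + x)) - \<gamma> (v (yh + y)) \<le>
      Fp F \<alpha> (p + q) (M + mat \<epsilon>) - Fp F \<alpha> (p + s) (- (N + mat \<epsilon>)) + b (yh + y) * norm (p + s) powr \<beta> - b (xh + x) * norm (p + q) powr \<beta>"
    (is "\<exists>\<Lambda>. \<forall>\<epsilon>>0. ?P \<Lambda> \<epsilon>")
proof -
  obtain r1 where r1: "r1 > 0" "ball xh r1 \<subseteq> \<Omega>" using \<Omega> open_contains_ball by blast
  obtain r2 where r2: "r2 > 0" "ball yh r2 \<subseteq> \<Omega>" using \<Omega> open_contains_ball by blast
  define r where "r = min r0 (min r1 r2) / 2"
  have r: "r > 0" "r < r0" "r < r1" "r < r2" using r0 r1(1) r2(1) by (auto simp: r_def)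
  have inx: "xh + h \<in> ball xh r0" "xh + h \<in> \<Omega>" if "norm h \<le> r" for h
    using that r r1(2) by (auto simp: dist_norm)
  have iny: "yh + h \<in> ball yh r0" "yh + h \<in> \<Omega>" if "norm h \<le> r" for h
    using that r r2(2) by (auto simp: dist_norm)
  define U where "U = (\<lambda>h. u (xh + h) - u xh - p \<bullet> h)"
  define V where "V = (\<lambda>h. - v (yh + h) - - v yh - (- p) \<bullet> h)"
  have uscU: "usc_on (cball 0 r) U"
    unfolding U_def using sub inx by (intro usc_on_shift[of \<Omega>]) (auto simp: visc_sub_def)
  have uscV: "usc_on (cball 0 r) V"
    unfolding V_def using visc_super_usc[OF super] iny by (intro usc_on_shift[of \<Omega> "\<lambda>x. - v x"]) auto
  have leUV: "U x + V y \<le> (B *v (x - y)) \<bullet> (x - y) / 2" if "norm x \<le> r" "norm y \<le> r" for x y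
  proof -
    have e: "(xh + x) - (yh + y) - (xh - yh) = x - y" by simp
    show ?thesis
      using le[OF inx(1)[OF that(1)] iny(1)[OF that(2)]] unfolding e
        inner_diff_right[of p x y] inner_commute[of "x - y"]
      unfolding U_def V_def inner_minus_left by linarith
  qed
  have "\<exists>\<Lambda>. \<forall>\<epsilon>>0. \<exists>x y q p X Y. norm x < \<epsilon> \<and> norm y < \<epsilon> \<and> \<bar>U x\<bar> < \<epsilon> \<and> \<bar>V y\<bar> < \<epsilon> \<and> norm q < \<epsilon> \<and> norm p < \<epsilon> \<and>
    upper_jet U x q X \<and> upper_jet V y p Y \<and>
    (\<forall>h. \<bar>X h \<bullet> h\<bar> \<le> \<Lambda> * (norm h)\<^sup>2) \<and> (\<forall>h. \<bar>Y h \<bullet> h\<bar> \<le> \<Lambda> * (norm h)\<^sup>2) \<and>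
    (\<forall>h k. X h \<bullet> h + Y k \<bullet> k \<le> (B *v (h - k)) \<bullet> (h - k) + \<tau> * (norm (h - k))\<^sup>2 + \<epsilon> * ((norm h)\<^sup>2 + (norm k)\<^sup>2))"
    (is "\<exists>\<Lambda>. ?R \<Lambda>")
    by (rule theorem_on_sums[OF r(1) uscU uscV _ _ leUV])
      (auto simp: U_def V_def symmetric_mat_inner[OF B] \<tau>)
  then obtain \<Lambda> where \<Lambda>: "?R \<Lambda>"
    by (rule exE)
  show ?thesis
  proof (intro exI[of _ "CARD('n) * (CARD('n) * \<Lambda>)"] allI impI)
    fix \<epsilon> :: real assume \<epsilon>: "\<epsilon> > 0"
    define \<epsilon>' where "\<epsilon>' = min \<epsilon> r"
    have \<epsilon>': "\<epsilon>' > 0" "\<epsilon>' \<le> \<epsilon>" "\<epsilon>' \<le> r" using \<epsilon> r by (auto simp: \<epsilon>'_def)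
    obtain x y q s X Y where *: "norm x < \<epsilon>'" "norm y < \<epsilon>'" "\<bar>U x\<bar> < \<epsilon>'" "\<bar>V y\<bar> < \<epsilon>'" "norm q < \<epsilon>'" "norm s < \<epsilon>'"
      and jets: "upper_jet U x q X" "upper_jet V y s Y"
      and bX: "\<forall>h. \<bar>X h \<bullet> h\<bar> \<le> \<Lambda> * (norm h)\<^sup>2" and bY: "\<forall>h. \<bar>Y h \<bullet> h\<bar> \<le> \<Lambda> * (norm h)\<^sup>2"
      and XY: "\<forall>h k. X h \<bullet> h + Y k \<bullet> k \<le> (B *v (h - k)) \<bullet> (h - k) + \<tau> * (norm (h - k))\<^sup>2 + \<epsilon>' * ((norm h)\<^sup>2 + (norm k)\<^sup>2)"
      using \<Lambda>[rule_format, OF \<epsilon>'(1)] by (elim exE conjE)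
    have jetu: "upper_jet u (xh + x) (p + q) X"
      using upper_jet_shift[OF jets(1)[unfolded U_def]] by (simp add: add.commute)
    have jetv: "upper_jet (\<lambda>x. - v x) (yh + y) (- (p - s)) Y"
      using upper_jet_shift[OF jets(2)[unfolded V_def]] by simp
    obtain M where M: "symmetric_mat M" "\<And>k. k \<bullet> (M *v k) = X k \<bullet> k"
      by (rule symmetric_matrix_of_form[of X]) (use jets(1) in \<open>auto simp: upper_jet_def\<close>)
    obtain N where N: "symmetric_mat N" "\<And>k. k \<bullet> (N *v k) = Y k \<bullet> k"
      by (rule symmetric_matrix_of_form[of Y]) (use jets(2) in \<open>auto simp: upper_jet_def\<close>)
    have xO: "xh + x \<in> \<Omega>" and yO: "yh + y \<in> \<Omega>"
      using inx(2)[of x] iny(2)[of y] *(1,2) \<epsilon>'(3) by auto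
    have i1: "- Fp F \<alpha> (p + q) (M + mat \<epsilon>) + b (xh + x) * norm (p + q) powr \<beta> + \<gamma> (u (xh + x)) \<le> g (xh + x)"
      by (rule visc_sub_jet[OF sub \<Omega>(1) xO jetu M \<epsilon>])
    have i2: "f (yh + y) \<le> - Fp F \<alpha> (p + - s) (- (N + mat \<epsilon>)) + b (yh + y) * norm (p + - s) powr \<beta> + \<gamma> (v (yh + y))"
      using visc_super_jet[OF super \<Omega>(1) yO jetv N \<epsilon>] by (simp add: norm_minus_commute)
    have nM: "norm M \<le> CARD('n) * (CARD('n) * \<Lambda>)" "norm N \<le> CARD('n) * (CARD('n) * \<Lambda>)"
      using bX bY by (auto intro!: symmetric_mat_norm_le M N simp: M(2) N(2))
    have form: "h \<bullet> (M *v h) + k \<bullet> (N *v k) \<le> (h - k) \<bullet> (B *v (h - k)) + \<tau> * (norm (h - k))\<^sup>2 + \<epsilon> * ((norm h)\<^sup>2 + (norm k)\<^sup>2)" for h k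
    proof -
      have "\<epsilon>' * ((norm h)\<^sup>2 + (norm k)\<^sup>2) \<le> \<epsilon> * ((norm h)\<^sup>2 + (norm k)\<^sup>2)"
        using \<epsilon>'(2) by (intro mult_right_mono) auto
      then show ?thesis
        using XY[rule_format, of h k] unfolding M(2) N(2) inner_commute[of "h - k"] by linarith
    qed
    have uv: "\<bar>u (xh + x) - u xh - p \<bullet> x\<bar> < \<epsilon>" "\<bar>v (yh + y) - v yh - p \<bullet> y\<bar> < \<epsilon>"
      using *(3,4) \<epsilon>'(2) by (auto simp: U_def V_def)
    have nn: "norm x < \<epsilon>" "norm y < \<epsilon>" "norm q < \<epsilon>" "norm (- s) < \<epsilon>"
      using * \<epsilon>'(2) by auto
    show "?P (CARD('n) * (CARD('n) * \<Lambda>)) \<epsilon>"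
      using i1 i2
      by (intro exI[of _ x] exI[of _ y] exI[of _ q] exI[of _ "- s"] exI[of _ M] exI[of _ N] conjI allI nn xO yO uv M(1) N(1) nM form) linarith
  qed
qed

text \<open>Let \<epsilon> tend to 0 in \<open>viscosity_doubling_approx\<close>; the matrices are
  bounded uniformly, so a subsequence converges. The two conclusions on X + Y are the limiting
  matrix inequality on the diagonal and on the antidiagonal, the latter carrying any negative
  direction of B.\<close>

lemma viscosity_doubling:
  fixes u v :: "real^'n \<Rightarrow> real" and B :: "real^'n^'n"
  assumes \<Omega>: "open \<Omega>" "xh \<in> \<Omega>" "yh \<in> \<Omega>" and F: "structural_F F a A" and \<alpha>: "0 < \<alpha>" and \<beta>: "0 < \<beta>"
    and b: "holder_on \<Omega> b" and \<gamma>: "continuous_on UNIV \<gamma>" and fg: "continuous_on \<Omega> f" "continuous_on \<Omega> g"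
    and sub: "visc_sub F \<alpha> \<beta> b \<gamma> g \<Omega> u" and super: "visc_super F \<alpha> \<beta> b \<gamma> f \<Omega> v"
    and r0: "r0 > 0"
    and le: "\<And>x y. x \<in> ball xh r0 \<Longrightarrow> y \<in> ball yh r0 \<Longrightarrow> u x - v y \<le> u xh - v yh + p \<bullet> ((x - y) - (xh - yh))
      + ((x - y) - (xh - yh)) \<bullet> (B *v ((x - y) - (xh - yh))) / 2"
    and B: "symmetric_mat B" and \<tau>: "\<tau> > 0"
  obtains X Y where "symmetric_mat X" "symmetric_mat Y" "\<And>w. w \<bullet> ((X + Y) *v w) \<le> 0"
    "\<And>w. w \<bullet> ((X + Y) *v w) \<le> 4 * (w \<bullet> (B *v w)) + 4 * \<tau> * (norm w)\<^sup>2"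
    "f yh - g xh + \<gamma> (u xh) - \<gamma> (v yh) \<le> Fp F \<alpha> p X - Fp F \<alpha> p (- Y) + (b yh - b xh) * norm p powr \<beta>"
proof -
  define G where "G = (\<lambda>\<Lambda> \<epsilon> x y q s M N. norm x < \<epsilon> \<and> norm y < \<epsilon> \<and> xh + x \<in> \<Omega> \<and> yh + y \<in> \<Omega> \<and>
    \<bar>u (xh + x) - u xh - p \<bullet> x\<bar> < \<epsilon> \<and> \<bar>v (yh + y) - v yh - p \<bullet> y\<bar> < \<epsilon> \<and> norm q < \<epsilon> \<and> norm s < \<epsilon> \<and>
    symmetric_mat M \<and> symmetric_mat N \<and> norm M \<le> \<Lambda> \<and> norm N \<le> \<Lambda> \<and>
    (\<forall>h k. h \<bullet> (M *v h) + k \<bullet> (N *v k) \<le> (h - k) \<bullet> (B *v (h - k)) + \<tau> * (norm (h - k))\<^sup>2 + \<epsilon> * ((norm h)\<^sup>2 + (norm k)\<^sup>2)) \<and>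
    f (yh + y) - g (xh + x) + \<gamma> (u (xh + x)) - \<gamma> (v (yh + y)) \<le>
      Fp F \<alpha> (p + q) (M + mat \<epsilon>) - Fp F \<alpha> (p + s) (- (N + mat \<epsilon>)) + b (yh + y) * norm (p + s) powr \<beta> - b (xh + x) * norm (p + q) powr \<beta>)"
  have "\<exists>\<Lambda>. \<forall>\<epsilon>>0. \<exists>x y q s M N. G \<Lambda> \<epsilon> x y q s M N"
    unfolding G_def by (rule viscosity_doubling_approx[OF \<Omega> sub super r0 le B \<tau>])
  then obtain \<Lambda> where \<Lambda>: "\<forall>\<epsilon>>0. \<exists>x y q s M N. G \<Lambda> \<epsilon> x y q s M N" by (rule exE)
  define \<epsilon> where "\<epsilon> = (\<lambda>n::nat. inverse (real (Suc n)))"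
  have \<epsilon>0: "\<epsilon> n > 0" for n by (simp add: \<epsilon>_def)
  have \<epsilon>lim: "\<epsilon> \<longlonglongrightarrow> 0" unfolding \<epsilon>_def by (rule LIMSEQ_inverse_real_of_nat)
  have "\<forall>n. \<exists>x y q s M N. G \<Lambda> (\<epsilon> n) x y q s M N" using \<Lambda> \<epsilon>0 by blast
  from choice[OF this] obtain x where "\<forall>n. \<exists>y q s M N. G \<Lambda> (\<epsilon> n) (x n) y q s M N" ..
  from choice[OF this] obtain y where "\<forall>n. \<exists>q s M N. G \<Lambda> (\<epsilon> n) (x n) (y n) q s M N" ..
  from choice[OF this] obtain q where "\<forall>n. \<exists>s M N. G \<Lambda> (\<epsilon> n) (x n) (y n) (q n) s M N" ..
  from choice[OF this] obtain s where "\<forall>n. \<exists>M N. G \<Lambda> (\<epsilon> n) (x n) (y n) (q n) (s n) M N" ..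
  from choice[OF this] obtain M where "\<forall>n. \<exists>N. G \<Lambda> (\<epsilon> n) (x n) (y n) (q n) (s n) (M n) N" ..
  from choice[OF this] obtain N where G: "\<forall>n. G \<Lambda> (\<epsilon> n) (x n) (y n) (q n) (s n) (M n) (N n)" ..
  have g1: "norm (x n) < \<epsilon> n" "norm (y n) < \<epsilon> n" "xh + x n \<in> \<Omega>" "yh + y n \<in> \<Omega>"
    "\<bar>u (xh + x n) - u xh - p \<bullet> x n\<bar> < \<epsilon> n" "\<bar>v (yh + y n) - v yh - p \<bullet> y n\<bar> < \<epsilon> n" "norm (q n) < \<epsilon> n" "norm (s n) < \<epsilon> n"
    "symmetric_mat (M n)" "symmetric_mat (N n)" "norm (M n) \<le> \<Lambda>" "norm (N n) \<le> \<Lambda>" for n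
    using G[rule_format, of n] unfolding G_def by simp_all
  have g2: "h \<bullet> (M n *v h) + k \<bullet> (N n *v k) \<le> (h - k) \<bullet> (B *v (h - k)) + \<tau> * (norm (h - k))\<^sup>2 + \<epsilon> n * ((norm h)\<^sup>2 + (norm k)\<^sup>2)" for n h k
    using G[rule_format, of n] unfolding G_def by (elim conjE) (rule allE, assumption, rule allE, assumption, assumption)
  have g3: "f (yh + y n) - g (xh + x n) + \<gamma> (u (xh + x n)) - \<gamma> (v (yh + y n)) \<le>
      Fp F \<alpha> (p + q n) (M n + mat (\<epsilon> n)) - Fp F \<alpha> (p + s n) (- (N n + mat (\<epsilon> n))) + b (yh + y n) * norm (p + s n) powr \<beta> - b (xh + x n) * norm (p + q n) powr \<beta>" for n
    using G[rule_format, of n] unfolding G_def by (elim conjE)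
  have bdd: "bounded (range (\<lambda>n. (M n, N n)))"
  proof (rule boundedI)
    fix z assume "z \<in> range (\<lambda>n. (M n, N n))"
    then obtain n where "z = (M n, N n)" by blast
    then show "norm z \<le> \<Lambda> + \<Lambda>"
      using norm_Pair_le[of "M n" "N n"] g1(11,12)[of n] by simp
  qed
  obtain Z \<rho> where \<rho>: "strict_mono \<rho>" "((\<lambda>n. (M n, N n)) \<circ> \<rho>) \<longlonglongrightarrow> Z"
    using bounded_imp_convergent_subsequence[OF bdd] by blast
  obtain X Y where Z: "Z = (X, Y)" by (cases Z)
  have MX: "(\<lambda>n. M (\<rho> n)) \<longlonglongrightarrow> X" and NY: "(\<lambda>n. N (\<rho> n)) \<longlonglongrightarrow> Y"
    using tendsto_fst[OF \<rho>(2)] tendsto_snd[OF \<rho>(2)] by (simp_all add: Z o_def)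
  have \<epsilon>\<rho>: "(\<lambda>n. \<epsilon> (\<rho> n)) \<longlonglongrightarrow> 0"
    using LIMSEQ_subseq_LIMSEQ[OF \<epsilon>lim \<rho>(1)] by (simp add: o_def)
  have null: "(\<lambda>n. w (\<rho> n)) \<longlonglongrightarrow> 0" if "\<And>n. norm (w n) < \<epsilon> n" for w :: "nat \<Rightarrow> 'z::real_normed_vector"
    by (rule Lim_null_comparison[OF _ \<epsilon>\<rho>]) (use that less_imp_le in \<open>auto intro!: always_eventually\<close>)
  have x0: "(\<lambda>n. x (\<rho> n)) \<longlonglongrightarrow> 0" and y0: "(\<lambda>n. y (\<rho> n)) \<longlonglongrightarrow> 0"
    and q0: "(\<lambda>n. q (\<rho> n)) \<longlonglongrightarrow> 0" and s0: "(\<lambda>n. s (\<rho> n)) \<longlonglongrightarrow> 0"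
    using g1 by (auto intro!: null)
  have xl: "(\<lambda>n. xh + x (\<rho> n)) \<longlonglongrightarrow> xh" and yl: "(\<lambda>n. yh + y (\<rho> n)) \<longlonglongrightarrow> yh"
    and ql: "(\<lambda>n. p + q (\<rho> n)) \<longlonglongrightarrow> p" and sl: "(\<lambda>n. p + s (\<rho> n)) \<longlonglongrightarrow> p"
    using tendsto_add[OF tendsto_const x0] tendsto_add[OF tendsto_const y0]
      tendsto_add[OF tendsto_const q0] tendsto_add[OF tendsto_const s0] by auto
  \<comment> \<open>Semicontinuity alone would not give convergence of the values; it comes from
    their distance to the affine function of slope p, which is below \<epsilon> n.\<close>
  have "(\<lambda>n. u (xh + x (\<rho> n)) - u xh - p \<bullet> x (\<rho> n)) \<longlonglongrightarrow> 0"
    by (rule null) (use g1(5) in auto)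
  from tendsto_add[OF this tendsto_inner[OF tendsto_const[of p] x0]]
  have "(\<lambda>n. u (xh + x (\<rho> n)) - u xh) \<longlonglongrightarrow> 0" by simp
  then have ul: "(\<lambda>n. u (xh + x (\<rho> n))) \<longlonglongrightarrow> u xh" by (rule LIM_zero_cancel)
  have "(\<lambda>n. v (yh + y (\<rho> n)) - v yh - p \<bullet> y (\<rho> n)) \<longlonglongrightarrow> 0"
    by (rule null) (use g1(6) in auto)
  from tendsto_add[OF this tendsto_inner[OF tendsto_const[of p] y0]]
  have "(\<lambda>n. v (yh + y (\<rho> n)) - v yh) \<longlonglongrightarrow> 0" by simp
  then have vl: "(\<lambda>n. v (yh + y (\<rho> n))) \<longlonglongrightarrow> v yh" by (rule LIM_zero_cancel)
  have symlim: "symmetric_mat L" if "\<And>n. symmetric_mat (K n)" "K \<longlonglongrightarrow> L" for K :: "nat \<Rightarrow> real^'n^'n" and L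
  proof -
    have "L $ i $ j = L $ j $ i" for i j
    proof (rule LIMSEQ_unique)
      show "(\<lambda>n. K n $ i $ j) \<longlonglongrightarrow> L $ i $ j" by (intro tendsto_vec_nth that)
      have "K n $ i $ j = K n $ j $ i" for n
        using that(1)[of n] by (simp add: symmetric_mat_def transpose_def vec_eq_iff)
      moreover have "(\<lambda>n. K n $ j $ i) \<longlonglongrightarrow> L $ j $ i" by (intro tendsto_vec_nth that)
      ultimately show "(\<lambda>n. K n $ i $ j) \<longlonglongrightarrow> L $ j $ i" by simp
    qed
    then show ?thesis by (simp add: symmetric_mat_def transpose_def vec_eq_iff)
  qed
  have symX: "symmetric_mat X" by (rule symlim[OF _ MX]) (rule g1(9))
  have symY: "symmetric_mat Y" by (rule symlim[OF _ NY]) (rule g1(10))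
  have formlim: "(\<lambda>n. h \<bullet> (K n *v h)) \<longlonglongrightarrow> h \<bullet> (L *v h)" if "K \<longlonglongrightarrow> L" for K :: "nat \<Rightarrow> real^'n^'n" and L h
    unfolding matrix_vector_mult_def inner_vec_def by (simp, intro tendsto_intros that)
  have form: "h \<bullet> (X *v h) + k \<bullet> (Y *v k) \<le> (h - k) \<bullet> (B *v (h - k)) + \<tau> * (norm (h - k))\<^sup>2" for h k
  proof (rule LIMSEQ_le)
    show "(\<lambda>n. h \<bullet> (M (\<rho> n) *v h) + k \<bullet> (N (\<rho> n) *v k)) \<longlonglongrightarrow> h \<bullet> (X *v h) + k \<bullet> (Y *v k)"
      by (intro tendsto_add formlim MX NY)
    have "(\<lambda>n. (h - k) \<bullet> (B *v (h - k)) + \<tau> * (norm (h - k))\<^sup>2 + \<epsilon> (\<rho> n) * ((norm h)\<^sup>2 + (norm k)\<^sup>2))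
      \<longlonglongrightarrow> (h - k) \<bullet> (B *v (h - k)) + \<tau> * (norm (h - k))\<^sup>2 + 0 * ((norm h)\<^sup>2 + (norm k)\<^sup>2)"
      by (intro tendsto_intros \<epsilon>\<rho>)
    then show "(\<lambda>n. (h - k) \<bullet> (B *v (h - k)) + \<tau> * (norm (h - k))\<^sup>2 + \<epsilon> (\<rho> n) * ((norm h)\<^sup>2 + (norm k)\<^sup>2))
      \<longlonglongrightarrow> (h - k) \<bullet> (B *v (h - k)) + \<tau> * (norm (h - k))\<^sup>2" by simp
    show "\<exists>m. \<forall>n\<ge>m. h \<bullet> (M (\<rho> n) *v h) + k \<bullet> (N (\<rho> n) *v k) \<le> (h - k) \<bullet> (B *v (h - k)) + \<tau> * (norm (h - k))\<^sup>2 + \<epsilon> (\<rho> n) * ((norm h)\<^sup>2 + (norm k)\<^sup>2)"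
      using g2 by blast
  qed
  have sum: "w \<bullet> ((X + Y) *v w) = w \<bullet> (X *v w) + w \<bullet> (Y *v w)" for w
    by (simp add: matrix_vector_mult_add_rdistrib inner_add_right)
  \<comment> \<open>h = k = w makes the right side vanish.\<close>
  have s1: "w \<bullet> ((X + Y) *v w) \<le> 0" for w
    using form[of w w] by (simp add: sum)
  \<comment> \<open>h = w and k = - w give h - k = 2 * w, whence the factors 4.\<close>
  have s2: "w \<bullet> ((X + Y) *v w) \<le> 4 * (w \<bullet> (B *v w)) + 4 * \<tau> * (norm w)\<^sup>2" for w
  proof -
    have neg: "K *v (- w) = - (K *v w)" for K :: "real^'n^'n"
      by (simp add: vec_eq_iff matrix_vector_mult_def sum_negf)
    have e: "w - - w = 2 *\<^sub>R w" by (simp add: scaleR_2)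
    have "w \<bullet> (X *v w) + (- w) \<bullet> (Y *v (- w)) \<le> (2 *\<^sub>R w) \<bullet> (B *v (2 *\<^sub>R w)) + \<tau> * (norm (2 *\<^sub>R w))\<^sup>2"
      using form[of w "- w"] unfolding e .
    then show ?thesis
      by (simp add: sum neg matrix_vector_mult_scaleR power_mult_distrib)
  qed
  have meps: "(\<lambda>n. mat (\<epsilon> (\<rho> n)) :: real^'n^'n) \<longlonglongrightarrow> 0"
  proof (intro vec_tendstoI)
    fix i j :: 'n
    show "(\<lambda>n. (mat (\<epsilon> (\<rho> n)) :: real^'n^'n) $ i $ j) \<longlonglongrightarrow> 0 $ i $ j"
      using \<epsilon>\<rho> by (cases "i = j") (simp_all add: mat_def)
  qed
  have "(\<lambda>n. M (\<rho> n) + mat (\<epsilon> (\<rho> n))) \<longlonglongrightarrow> X"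
    using tendsto_add[OF MX meps] by simp
  then have F1: "(\<lambda>n. Fp F \<alpha> (p + q (\<rho> n)) (M (\<rho> n) + mat (\<epsilon> (\<rho> n)))) \<longlonglongrightarrow> Fp F \<alpha> p X"
    by (intro Fp_tendsto[OF F \<alpha>] symX ql symmetric_mat_add symmetric_mat_mat g1)
  have "(\<lambda>n. - (N (\<rho> n) + mat (\<epsilon> (\<rho> n)))) \<longlonglongrightarrow> - Y"
    using tendsto_minus[OF tendsto_add[OF NY meps]] by simp
  then have F2: "(\<lambda>n. Fp F \<alpha> (p + s (\<rho> n)) (- (N (\<rho> n) + mat (\<epsilon> (\<rho> n))))) \<longlonglongrightarrow> Fp F \<alpha> p (- Y)"
    by (intro Fp_tendsto[OF F \<alpha>] symY sl symmetric_mat_uminus symmetric_mat_add symmetric_mat_mat g1)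
  have powl: "(\<lambda>n. norm (w n) powr \<beta>) \<longlonglongrightarrow> norm p powr \<beta>" if "w \<longlonglongrightarrow> p" for w :: "nat \<Rightarrow> real^'n"
    using \<beta> by (intro tendsto_powr' tendsto_intros that) auto
  have bx: "(\<lambda>n. b (xh + x (\<rho> n))) \<longlonglongrightarrow> b xh" and byl: "(\<lambda>n. b (yh + y (\<rho> n))) \<longlonglongrightarrow> b yh"
    using tendsto_holder[OF b \<Omega>(2) g1(3) xl] tendsto_holder[OF b \<Omega>(3) g1(4) yl] by auto
  have fl: "(\<lambda>n. f (yh + y (\<rho> n))) \<longlonglongrightarrow> f yh"
    using continuous_on_tendsto_compose[OF fg(1) yl \<Omega>(3)] g1(4) by simp
  have gl: "(\<lambda>n. g (xh + x (\<rho> n))) \<longlonglongrightarrow> g xh"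
    using continuous_on_tendsto_compose[OF fg(2) xl \<Omega>(2)] g1(3) by simp
  have \<gamma>l: "(\<lambda>n. \<gamma> (w n)) \<longlonglongrightarrow> \<gamma> c" if "w \<longlonglongrightarrow> c" for w :: "nat \<Rightarrow> real" and c
    using continuous_on_tendsto_compose[OF \<gamma> that] by simp
  have "f yh - g xh + \<gamma> (u xh) - \<gamma> (v yh) \<le> Fp F \<alpha> p X - Fp F \<alpha> p (- Y) + b yh * norm p powr \<beta> - b xh * norm p powr \<beta>"
  proof (rule LIMSEQ_le)
    show "(\<lambda>n. f (yh + y (\<rho> n)) - g (xh + x (\<rho> n)) + \<gamma> (u (xh + x (\<rho> n))) - \<gamma> (v (yh + y (\<rho> n)))) \<longlonglongrightarrow> f yh - g xh + \<gamma> (u xh) - \<gamma> (v yh)"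
      by (intro tendsto_add tendsto_diff fl gl \<gamma>l ul vl)
    show "(\<lambda>n. Fp F \<alpha> (p + q (\<rho> n)) (M (\<rho> n) + mat (\<epsilon> (\<rho> n))) - Fp F \<alpha> (p + s (\<rho> n)) (- (N (\<rho> n) + mat (\<epsilon> (\<rho> n))))
        + b (yh + y (\<rho> n)) * norm (p + s (\<rho> n)) powr \<beta> - b (xh + x (\<rho> n)) * norm (p + q (\<rho> n)) powr \<beta>)
      \<longlonglongrightarrow> Fp F \<alpha> p X - Fp F \<alpha> p (- Y) + b yh * norm p powr \<beta> - b xh * norm p powr \<beta>"
      by (intro tendsto_add tendsto_diff tendsto_mult F1 F2 bx byl powl ql sl)
    show "\<exists>m. \<forall>n\<ge>m. f (yh + y (\<rho> n)) - g (xh + x (\<rho> n)) + \<gamma> (u (xh + x (\<rho> n))) - \<gamma> (v (yh + y (\<rho> n))) \<le>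
      Fp F \<alpha> (p + q (\<rho> n)) (M (\<rho> n) + mat (\<epsilon> (\<rho> n))) - Fp F \<alpha> (p + s (\<rho> n)) (- (N (\<rho> n) + mat (\<epsilon> (\<rho> n))))
        + b (yh + y (\<rho> n)) * norm (p + s (\<rho> n)) powr \<beta> - b (xh + x (\<rho> n)) * norm (p + q (\<rho> n)) powr \<beta>"
      using g3 by blast
  qed
  then have "f yh - g xh + \<gamma> (u xh) - \<gamma> (v yh) \<le> Fp F \<alpha> p X - Fp F \<alpha> p (- Y) + (b yh - b xh) * norm p powr \<beta>"
    by (simp add: left_diff_distrib)
  with symX symY s1 s2 show thesis by (rule that)
qed

section \<open>Calculus for the doubling penalty\<close>

text \<open>The mean value theorem on the segment is applied to \<phi> minus its quadratic model.
  The derivative of this difference is the first order remainder of the gradient map D at z, hence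
  at most \<sigma> |h|^2.\<close>

lemma taylor_second_order_upper:
  fixes \<phi> :: "'a::euclidean_space \<Rightarrow> real"
  assumes r: "r > 0" and d1: "\<And>x. x \<in> ball z r \<Longrightarrow> (\<phi> has_derivative (\<lambda>h. D x \<bullet> h)) (at x)"
    and d2: "(D has_derivative T) (at z)" and \<sigma>: "\<sigma> > 0"
  shows "\<exists>d>0. \<forall>h. norm h < d \<longrightarrow> \<phi> (z + h) \<le> \<phi> z + D z \<bullet> h + T h \<bullet> h / 2 + \<sigma> * (norm h)\<^sup>2"
proof -
  have linT: "linear T" using d2 has_derivative_linear by blast
  obtain d0 where d0: "d0 > 0" "\<And>y. norm (y - z) < d0 \<Longrightarrow> norm (D y - D z - T (y - z)) \<le> \<sigma> * norm (y - z)"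
    using d2[unfolded has_derivative_at_alt] \<sigma> by blast
  have "\<phi> (z + h) \<le> \<phi> z + D z \<bullet> h + T h \<bullet> h / 2 + \<sigma> * (norm h)\<^sup>2" if h: "norm h < min d0 r" for h
  proof -
    define \<psi> where "\<psi> = (\<lambda>t. \<phi> (z + t *\<^sub>R h) - t * (D z \<bullet> h) - t\<^sup>2 * (T h \<bullet> h / 2))"
    have th: "norm (t *\<^sub>R h) \<le> norm h" if "0 \<le> t" "t \<le> 1" for t
      using that by (simp add: mult_left_le_one_le)
    have der: "(\<psi> has_real_derivative (D (z + t *\<^sub>R h) - D z - t *\<^sub>R T h) \<bullet> h) (at t)" if t: "0 \<le> t" "t \<le> 1" for t
    proof -
      have "z + t *\<^sub>R h \<in> ball z r" using th[OF t] h by (simp add: dist_norm)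
      then have "(\<phi> has_derivative (\<lambda>k. D (z + t *\<^sub>R h) \<bullet> k)) (at (z + t *\<^sub>R h))" by (rule d1)
      moreover have "((\<lambda>t. z + t *\<^sub>R h) has_derivative (\<lambda>s. s *\<^sub>R h)) (at t)"
        by (auto intro!: derivative_eq_intros)
      ultimately have "((\<lambda>t. \<phi> (z + t *\<^sub>R h)) has_derivative (\<lambda>s. D (z + t *\<^sub>R h) \<bullet> (s *\<^sub>R h))) (at t)"
        by (rule has_derivative_compose[rotated])
      moreover have "(\<lambda>s. D (z + t *\<^sub>R h) \<bullet> (s *\<^sub>R h)) = (*) (D (z + t *\<^sub>R h) \<bullet> h)"
        by (auto simp: mult.commute)
      ultimately have a: "((\<lambda>t. \<phi> (z + t *\<^sub>R h)) has_real_derivative D (z + t *\<^sub>R h) \<bullet> h) (at t)"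
        by (simp add: has_field_derivative_def)
      show ?thesis
        unfolding \<psi>_def by (rule derivative_eq_intros a refl)+ (simp add: inner_diff_left)
    qed
    have "\<exists>t. 0 < t \<and> t < 1 \<and> \<psi> 1 - \<psi> 0 = (1 - 0) * ((D (z + t *\<^sub>R h) - D z - t *\<^sub>R T h) \<bullet> h)"
      using der by (intro MVT2) auto
    then obtain t where t: "0 < t" "t < 1" and eq: "\<psi> 1 - \<psi> 0 = (D (z + t *\<^sub>R h) - D z - t *\<^sub>R T h) \<bullet> h"
      by auto
    have "norm (t *\<^sub>R h) < d0" using th[of t] t h by simp
    then have "norm (D (z + t *\<^sub>R h) - D z - t *\<^sub>R T h) \<le> \<sigma> * norm (t *\<^sub>R h)"
      using d0(2)[of "z + t *\<^sub>R h"] by (simp add: linear_scale[OF linT])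
    also have "\<dots> \<le> \<sigma> * norm h" using th[of t] t \<sigma> by (intro mult_left_mono) auto
    finally have "norm (D (z + t *\<^sub>R h) - D z - t *\<^sub>R T h) * norm h \<le> \<sigma> * norm h * norm h"
      by (intro mult_right_mono) auto
    then have "\<psi> 1 - \<psi> 0 \<le> \<sigma> * (norm h)\<^sup>2"
      unfolding eq using norm_cauchy_schwarz[of "D (z + t *\<^sub>R h) - D z - t *\<^sub>R T h" h]
      by (simp add: power2_eq_square mult.assoc)
    then show ?thesis by (simp add: \<psi>_def)
  qed
  then show ?thesis using d0(1) r by (intro exI[of _ "min d0 r"]) auto
qed

section \<open>Second order expansion of the power penalty\<close>

lemma norm_powr_eq: "norm (x :: 'a::real_inner) powr \<kappa> = (x \<bullet> x) powr (\<kappa> / 2)" if "x \<noteq> 0"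
  using that by (simp add: norm_eq_sqrt_inner powr_half_sqrt[symmetric] powr_powr)

lemma has_derivative_inner_self_powr:
  fixes x :: "'a::real_inner"
  assumes "x \<noteq> 0"
  shows "((\<lambda>x. (x \<bullet> x) powr s) has_derivative (\<lambda>h. (2 * s * (x \<bullet> x) powr (s - 1)) * (x \<bullet> h))) (at x)"
proof -
  have pos: "x \<bullet> x > 0" using assms by simp
  have "((\<lambda>y. y powr s) has_derivative (*) (s * (x \<bullet> x) powr (s - 1))) (at (x \<bullet> x))"
    using has_real_derivative_powr[OF pos, of s] by (simp add: has_field_derivative_def)
  moreover have "((\<lambda>x. x \<bullet> x) has_derivative (\<lambda>h. x \<bullet> h + h \<bullet> x)) (at x)"
    by (rule has_derivative_inner) (auto intro!: derivative_eq_intros)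
  ultimately have "((\<lambda>x. (x \<bullet> x) powr s) has_derivative (\<lambda>h. s * (x \<bullet> x) powr (s - 1) * (x \<bullet> h + h \<bullet> x))) (at x)"
    by (rule has_derivative_compose[rotated])
  moreover have "(\<lambda>h. s * (x \<bullet> x) powr (s - 1) * (x \<bullet> h + h \<bullet> x)) = (\<lambda>h. (2 * s * (x \<bullet> x) powr (s - 1)) * (x \<bullet> h))"
    by (auto simp: inner_commute algebra_simps)
  ultimately show ?thesis by simp
qed

text \<open>The gradient at z is c z and the Hessian is c times the identity minus 2 - \<kappa>
  times the projection onto z. Along z the coefficient is c (\<kappa> - 1), negative when c > 0 and
  \<kappa> < 1: this is the concavity that drives the estimate.\<close>

lemma norm_powr_second_order_upper:
  fixes z :: "'a::euclidean_space" and L \<kappa> \<sigma> :: real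
  assumes z: "z \<noteq> 0" and \<sigma>: "\<sigma> > 0"
  defines "c \<equiv> L * \<kappa> * norm z powr (\<kappa> - 2)"
  shows "\<exists>d>0. \<forall>h. norm h < d \<longrightarrow> L * norm (z + h) powr \<kappa> \<le> L * norm z powr \<kappa> + (c *\<^sub>R z) \<bullet> h
    + c * ((norm h)\<^sup>2 - (2 - \<kappa>) * ((z \<bullet> h) / norm z)\<^sup>2) / 2 + \<sigma> * (norm h)\<^sup>2"
proof -
  define D where "D = (\<lambda>x :: 'a. (L * \<kappa> * (x \<bullet> x) powr (\<kappa> / 2 - 1)) *\<^sub>R x)"
  define T where "T = (\<lambda>h. (L * \<kappa> * (z \<bullet> z) powr (\<kappa> / 2 - 1)) *\<^sub>R h
    + (L * \<kappa> * ((\<kappa> - 2) * (z \<bullet> z) powr (\<kappa> / 2 - 2) * (z \<bullet> h))) *\<^sub>R z)"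
  have nz: "norm z > 0" using z by simp
  have "\<exists>d>0. \<forall>h. norm h < d \<longrightarrow> L * norm (z + h) powr \<kappa> \<le> L * norm z powr \<kappa> + D z \<bullet> h + T h \<bullet> h / 2 + \<sigma> * (norm h)\<^sup>2"
  proof (rule taylor_second_order_upper[where D = D and T = T, OF nz _ _ \<sigma>])
    fix x assume "x \<in> ball z (norm z)"
    then have x: "x \<noteq> 0" by auto
    have "((\<lambda>x. L * (x \<bullet> x) powr (\<kappa> / 2)) has_derivative (\<lambda>h. L * ((2 * (\<kappa> / 2) * (x \<bullet> x) powr (\<kappa> / 2 - 1)) * (x \<bullet> h)))) (at x)"
      by (intro has_derivative_mult_right has_derivative_inner_self_powr x)
    moreover have "(\<lambda>h. L * ((2 * (\<kappa> / 2) * (x \<bullet> x) powr (\<kappa> / 2 - 1)) * (x \<bullet> h))) = (\<lambda>h. D x \<bullet> h)"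
      by (auto simp: D_def)
    ultimately have "((\<lambda>x. L * (x \<bullet> x) powr (\<kappa> / 2)) has_derivative (\<lambda>h. D x \<bullet> h)) (at x)" by simp
    then show "((\<lambda>x. L * norm x powr \<kappa>) has_derivative (\<lambda>h. D x \<bullet> h)) (at x)"
    proof (rule has_derivative_transform_within_open[of _ _ _ _ "- {0}"])
      show "\<And>y. y \<in> - {0} \<Longrightarrow> L * (y \<bullet> y) powr (\<kappa> / 2) = L * norm y powr \<kappa>"
        by (simp add: norm_powr_eq)
    qed (use x in auto)
  next
    have c: "((\<lambda>x. L * \<kappa> * (x \<bullet> x) powr (\<kappa> / 2 - 1)) has_derivative
        (\<lambda>h. L * \<kappa> * ((2 * (\<kappa> / 2 - 1) * (z \<bullet> z) powr (\<kappa> / 2 - 1 - 1)) * (z \<bullet> h)))) (at z)"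
      by (intro has_derivative_mult_right has_derivative_inner_self_powr z)
    have "(D has_derivative (\<lambda>h. (L * \<kappa> * (z \<bullet> z) powr (\<kappa> / 2 - 1)) *\<^sub>R h
       + (L * \<kappa> * ((2 * (\<kappa> / 2 - 1) * (z \<bullet> z) powr (\<kappa> / 2 - 1 - 1)) * (z \<bullet> h))) *\<^sub>R z)) (at z)"
      unfolding D_def by (rule has_derivative_scaleR[OF c has_derivative_ident])
    moreover have "2 * (\<kappa> / 2 - 1) = \<kappa> - 2" "\<kappa> / 2 - 1 - 1 = \<kappa> / 2 - 2" by auto
    ultimately show "(D has_derivative T) (at z)" unfolding T_def by metis
  qed
  moreover have "D z = c *\<^sub>R z"
    using z by (simp add: D_def c_def norm_powr_eq diff_divide_distrib)
  moreover have "T h \<bullet> h = c * ((norm h)\<^sup>2 - (2 - \<kappa>) * ((z \<bullet> h) / norm z)\<^sup>2)" for h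
  proof -
    have "(z \<bullet> z) powr (\<kappa> / 2 - 2) = (z \<bullet> z) powr (\<kappa> / 2 - 1) / (z \<bullet> z)"
      using z powr_diff[of "z \<bullet> z" "\<kappa> / 2 - 1" 1] by simp
    moreover have "(norm z)\<^sup>2 = z \<bullet> z" "(norm h)\<^sup>2 = h \<bullet> h" by (simp_all add: power2_norm_eq_inner)
    moreover have "c = L * \<kappa> * (z \<bullet> z) powr (\<kappa> / 2 - 1)"
      using z by (simp add: c_def norm_powr_eq diff_divide_distrib)
    ultimately show ?thesis
      using z by (simp add: T_def inner_simps power_divide power2_eq_square field_simps)
  qed
  ultimately show ?thesis by simp
qed

text \<open>Testing nonpositivity at w_i e_i - w_j e_j bounds two diagonal terms by twice the mixed
  term; summing over all pairs gives the factor n. It converts strict negativity in one direction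
  into negativity of a weighted trace.\<close>

lemma neg_form_diag_le:
  fixes Z :: "real^'n^'n"
  assumes Z: "symmetric_mat Z" "\<And>w. w \<bullet> (Z *v w) \<le> 0"
  shows "CARD('n) * (\<Sum>i\<in>UNIV. (w $ i)\<^sup>2 * Z $ i $ i) \<le> w \<bullet> (Z *v w)"
proof -
  have ent: "axis i 1 \<bullet> (Z *v axis j 1) = Z $ i $ j" for i j
    by (simp add: inner_axis' matrix_vector_mult_basis column_def)
  have le: "(w $ i)\<^sup>2 * Z $ i $ i + (w $ j)\<^sup>2 * Z $ j $ j \<le> 2 * (w $ i * Z $ i $ j * w $ j)" for i j
  proof -
    let ?k = "w $ i *\<^sub>R axis i 1 - w $ j *\<^sub>R axis j (1::real)"
    have sym: "Z $ j $ i = Z $ i $ j"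
      using Z(1) by (simp add: symmetric_mat_def transpose_def vec_eq_iff)
    have "?k \<bullet> (Z *v ?k) = (w $ i)\<^sup>2 * Z $ i $ i + (w $ j)\<^sup>2 * Z $ j $ j - 2 * (w $ i * Z $ i $ j * w $ j)"
      by (simp add: matrix_vector_mult_diff_distrib matrix_vector_mult_scaleR inner_diff_left inner_diff_right ent sym power2_eq_square algebra_simps)
    then show ?thesis using Z(2)[of ?k] by linarith
  qed
  have "2 * (w \<bullet> (Z *v w)) = (\<Sum>i\<in>UNIV. \<Sum>j\<in>UNIV. 2 * (w $ i * Z $ i $ j * w $ j))"
    by (simp add: inner_vec_def matrix_vector_mult_def sum_distrib_left mult.assoc)
  moreover have "(\<Sum>i\<in>UNIV. \<Sum>j\<in>UNIV. (w $ i)\<^sup>2 * Z $ i $ i + (w $ j)\<^sup>2 * Z $ j $ j) \<le> (\<Sum>i\<in>UNIV. \<Sum>j\<in>UNIV. 2 * (w $ i * Z $ i $ j * w $ j))"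
    by (intro sum_mono le)
  moreover have "(\<Sum>i\<in>UNIV. \<Sum>j\<in>UNIV. (w $ i)\<^sup>2 * Z $ i $ i + (w $ j)\<^sup>2 * Z $ j $ j) = 2 * (CARD('n) * (\<Sum>i\<in>UNIV. (w $ i)\<^sup>2 * Z $ i $ i))"
    by (simp add: sum.distrib sum_distrib_left)
  ultimately show ?thesis by linarith
qed

text \<open>Discarding the small components of the direction \<open>e\<close> makes the weight \<open>\<bar>e\<^sub>i\<bar>\<^sup>\<alpha>\<close> comparable to
  \<open>w\<^sub>i\<^sup>2\<close> also when \<open>\<alpha> > 2\<close>.\<close>
definition truncate :: "real \<Rightarrow> real^'n \<Rightarrow> real^'n" where
  "truncate \<eta> e = (\<chi> i. if \<eta> \<le> \<bar>e $ i\<bar> then e $ i else 0)"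

lemma inner_truncate: "e \<bullet> truncate \<eta> e = (norm (truncate \<eta> e))\<^sup>2"
  unfolding power2_norm_eq_inner by (simp add: inner_vec_def truncate_def if_distrib cong: if_cong)

lemma norm_truncate_le: "norm (truncate \<eta> e) \<le> norm e"
  by (rule norm_le_componentwise_cart) (simp add: truncate_def)

lemma norm_truncate_ge:
  fixes e :: "real^'n" and \<eta> :: real
  assumes "\<eta> \<ge> 0"
  shows "(norm e)\<^sup>2 - CARD('n) * \<eta>\<^sup>2 \<le> (norm (truncate \<eta> e))\<^sup>2"
proof -
  have "(norm e)\<^sup>2 = (\<Sum>i\<in>UNIV. (e $ i)\<^sup>2)"
    unfolding power2_norm_eq_inner inner_vec_def by (simp add: power2_eq_square)
  also have "\<dots> \<le> (\<Sum>i\<in>UNIV. (truncate \<eta> e $ i)\<^sup>2 + \<eta>\<^sup>2)"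
  proof (rule sum_mono)
    fix i
    show "(e $ i)\<^sup>2 \<le> (truncate \<eta> e $ i)\<^sup>2 + \<eta>\<^sup>2"
      using assms abs_le_square_iff[of "e $ i" \<eta>] by (auto simp: truncate_def)
  qed
  also have "\<dots> = (norm (truncate \<eta> e))\<^sup>2 + CARD('n) * \<eta>\<^sup>2"
    unfolding power2_norm_eq_inner inner_vec_def by (simp add: sum.distrib power2_eq_square)
  finally show ?thesis by simp
qed

text \<open>For components kept by the truncation |e_i|^\<alpha> \<ge> \<eta>^\<alpha> \<ge>
  \<eta>^\<alpha> w_i^2, as |e_i| \<le> 1; for the others w_i = 0. Since the diagonal of Z is
  nonpositive, the weights may be lowered to \<eta>^\<alpha> w_i^2, and
  \<open>neg_form_diag_le\<close> finishes.\<close>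

lemma degenerate_trace_bound:
  fixes Z :: "real^'n^'n"
  assumes Z: "symmetric_mat Z" "\<And>w. w \<bullet> (Z *v w) \<le> 0" and e: "norm e \<le> 1" and \<eta>: "\<eta> > 0" and \<alpha>: "\<alpha> > 0"
    and m: "truncate \<eta> e \<bullet> (Z *v truncate \<eta> e) \<le> - m"
  shows "(\<Sum>i\<in>UNIV. \<bar>e $ i\<bar> powr \<alpha> * Z $ i $ i) \<le> - (\<eta> powr \<alpha> / CARD('n) * m)"
proof -
  let ?w = "truncate \<eta> e"
  have diag: "Z $ i $ i \<le> 0" for i
    using Z(2)[of "axis i 1"] by (simp add: inner_axis' matrix_vector_mult_basis column_def)
  have w: "\<eta> powr \<alpha> * (?w $ i)\<^sup>2 \<le> \<bar>e $ i\<bar> powr \<alpha>" for i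
  proof (cases "\<eta> \<le> \<bar>e $ i\<bar>")
    case True
    have "\<bar>e $ i\<bar> \<le> 1" using component_le_norm_cart[of e i] e by linarith
    then have "(e $ i)\<^sup>2 \<le> 1" by (simp add: abs_square_le_1)
    then have "\<eta> powr \<alpha> * (e $ i)\<^sup>2 \<le> \<eta> powr \<alpha> * 1" by (intro mult_left_mono) auto
    also have "\<dots> \<le> \<bar>e $ i\<bar> powr \<alpha>" using True \<eta> \<alpha> by (simp add: powr_mono2)
    finally show ?thesis using True by (simp add: truncate_def)
  qed (simp add: truncate_def)
  have "(\<Sum>i\<in>UNIV. \<bar>e $ i\<bar> powr \<alpha> * Z $ i $ i) \<le> (\<Sum>i\<in>UNIV. (\<eta> powr \<alpha> * (?w $ i)\<^sup>2) * Z $ i $ i)"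
    by (intro sum_mono mult_right_mono_neg w diag)
  also have "\<dots> = \<eta> powr \<alpha> / CARD('n) * (CARD('n) * (\<Sum>i\<in>UNIV. (?w $ i)\<^sup>2 * Z $ i $ i))"
    by (simp add: sum_distrib_left mult.assoc)
  also have "\<dots> \<le> \<eta> powr \<alpha> / CARD('n) * (?w \<bullet> (Z *v ?w))"
    by (intro mult_left_mono neg_form_diag_le Z) auto
  also have "\<dots> \<le> \<eta> powr \<alpha> / CARD('n) * (- m)"
    using m by (intro mult_left_mono) auto
  finally show ?thesis by simp
qed

section \<open>Comparison\<close>

text \<open>Here \<omega> is the squared length of the truncated direction and 1 + 4 * t stands for
  2 - \<kappa>, so the left side is the normalised Hessian of the penalty at that vector. The full
  unit vector gives - 4 * t; losing at most t of its squared length still leaves - t.\<close>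

lemma direction_gain:
  fixes \<omega> t :: real
  assumes "0 \<le> t" "t \<le> 1 / 4" "1 - t \<le> \<omega>" "\<omega> \<le> 1"
  shows "\<omega> - (1 + 4 * t) * \<omega>\<^sup>2 \<le> - t"
proof -
  have "(1 + 4 * t) * (1 - t) \<le> (1 + 4 * t) * \<omega>" using assms by (intro mult_left_mono) auto
  moreover have "t * t \<le> t * (1 / 4)" using assms by (intro mult_left_mono) auto
  ultimately have "2 * t \<le> (1 + 4 * t) * \<omega> - 1" by (simp add: algebra_simps)
  moreover have "1 / 2 \<le> \<omega>" using assms by linarith
  ultimately have "1 / 2 * (2 * t) \<le> \<omega> * ((1 + 4 * t) * \<omega> - 1)"
    using assms(1) by (intro mult_mono) auto
  then show ?thesis by (simp add: power2_eq_square algebra_simps)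
qed

lemma usc_on_diff:
  assumes u: "usc_on S u" and v: "lsc_on S v"
  shows "usc_on S (\<lambda>x. u x - v x)"
  unfolding usc_on_def
proof (intro ballI allI impI)
  fix x :: 'a and e :: real assume x: "x \<in> S" and e: "e > 0"
  obtain d1 where d1: "d1 > 0" "\<And>y. y \<in> S \<Longrightarrow> dist y x < d1 \<Longrightarrow> u y < u x + e / 2"
    using u[unfolded usc_on_def, rule_format, OF x, of "e / 2"] e by auto
  obtain d2 where d2: "d2 > 0" "\<And>y. y \<in> S \<Longrightarrow> dist y x < d2 \<Longrightarrow> v x - e / 2 < v y"
    using v[unfolded lsc_on_def, rule_format, OF x, of "e / 2"] e by auto
  have "u y - v y < u x - v x + e" if y: "y \<in> S" "dist y x < min d1 d2" for y
  proof -
    have "u y < u x + e / 2" "v x - e / 2 < v y" using d1(2) d2(2) y by auto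
    then show ?thesis by linarith
  qed
  then show "\<exists>d>0. \<forall>y\<in>S. dist y x < d \<longrightarrow> u y - v y < u x - v x + e"
    using d1(1) d2(1) by (intro exI[of _ "min d1 d2"]) auto
qed

text \<open>M stands for the positive maximum of u - v. The locale fixes it only as an upper bound;
  that it is attained is a hypothesis of \<open>comparison_point\<close>.\<close>

locale viscosity_pair =
  fixes \<Omega> :: "(real^'n) set" and F :: "real^'n^'n \<Rightarrow> real" and a A \<alpha> \<beta> :: real
    and b f g u v :: "real^'n \<Rightarrow> real" and \<gamma> :: "real \<Rightarrow> real" and M :: real
  assumes \<Omega>: "open \<Omega>" "bounded \<Omega>" "\<Omega> \<noteq> {}"
    and \<alpha>: "0 < \<alpha>" and \<beta>: "0 < \<beta>" "\<beta> \<le> \<alpha> + 2"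
    and F: "structural_F F a A"
    and b: "holder_on \<Omega> b"
    and \<gamma>: "mono \<gamma>" "continuous_on UNIV \<gamma>"
    and fg: "continuous_on \<Omega> f" "continuous_on \<Omega> g" "bounded (f ` \<Omega>)" "bounded (g ` \<Omega>)"
    and usc: "usc_on (closure \<Omega>) u" and lsc: "lsc_on (closure \<Omega>) v"
    and sub: "visc_sub F \<alpha> \<beta> b \<gamma> g \<Omega> u" and super: "visc_super F \<alpha> \<beta> b \<gamma> f \<Omega> v"
    and bdry: "\<And>x. x \<in> frontier \<Omega> \<Longrightarrow> u x \<le> v x"
    and M: "0 < M" "\<And>x. x \<in> closure \<Omega> \<Longrightarrow> u x - v x \<le> M"
begin

section \<open>Maxima of the doubled function and their position inside the domain\<close>

lemma doubling_max:
  fixes \<phi> :: "real^'n \<Rightarrow> real"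
  assumes \<phi>: "continuous_on UNIV \<phi>"
  obtains x y where "x \<in> closure \<Omega>" "y \<in> closure \<Omega>"
    "\<And>x' y'. x' \<in> closure \<Omega> \<Longrightarrow> y' \<in> closure \<Omega> \<Longrightarrow> u x' - v y' - \<phi> (x' - y') \<le> u x - v y - \<phi> (x - y)"
proof -
  let ?K = "closure \<Omega>"
  have K: "compact (?K \<times> ?K)" "?K \<times> ?K \<noteq> {}" using \<Omega> by (auto simp: compact_closure intro!: compact_Times)
  have "usc_on (?K \<times> ?K) (\<lambda>z. u (fst z))"
    unfolding usc_on_def
  proof (intro ballI allI impI)
    fix z :: "(real^'n) \<times> (real^'n)" and e :: real assume "z \<in> ?K \<times> ?K" "e > 0"
    then obtain d where d: "d > 0" "\<forall>y\<in>?K. dist y (fst z) < d \<longrightarrow> u y < u (fst z) + e"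
      using usc[unfolded usc_on_def, rule_format, of "fst z" e] by auto
    have "u (fst y) < u (fst z) + e" if "y \<in> ?K \<times> ?K" "dist y z < d" for y
      using d(2)[rule_format, of "fst y"] that dist_fst_le[of y z] by auto
    then show "\<exists>d>0. \<forall>y\<in>?K \<times> ?K. dist y z < d \<longrightarrow> u (fst y) < u (fst z) + e"
      using d(1) by blast
  qed
  moreover have "lsc_on (?K \<times> ?K) (\<lambda>z. v (snd z))"
    unfolding lsc_on_def
  proof (intro ballI allI impI)
    fix z :: "(real^'n) \<times> (real^'n)" and e :: real assume "z \<in> ?K \<times> ?K" "e > 0"
    then obtain d where d: "d > 0" "\<forall>y\<in>?K. dist y (snd z) < d \<longrightarrow> v (snd z) - e < v y"
      using lsc[unfolded lsc_on_def, rule_format, of "snd z" e] by auto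
    have "v (snd z) - e < v (snd y)" if "y \<in> ?K \<times> ?K" "dist y z < d" for y
      using d(2)[rule_format, of "snd y"] that dist_snd_le[of y z] by auto
    then show "\<exists>d>0. \<forall>y\<in>?K \<times> ?K. dist y z < d \<longrightarrow> v (snd z) - e < v (snd y)"
      using d(1) by blast
  qed
  ultimately have "usc_on (?K \<times> ?K) (\<lambda>z. u (fst z) - v (snd z))"
    by (rule usc_on_diff)
  then have "usc_on (?K \<times> ?K) (\<lambda>z. (u (fst z) - v (snd z)) + - \<phi> (fst z - snd z))"
    by (rule usc_on_add_continuous) (intro continuous_intros continuous_on_compose2[OF \<phi>], auto)
  then obtain z where "z \<in> ?K \<times> ?K"
    "\<And>y. y \<in> ?K \<times> ?K \<Longrightarrow> (u (fst y) - v (snd y)) + - \<phi> (fst y - snd y) \<le> (u (fst z) - v (snd z)) + - \<phi> (fst z - snd z)"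
    by (rule usc_on_attains_max[OF K]) blast
  then show thesis
    by (intro that[of "fst z" "snd z"]) force+
qed

lemma upper_limit:
  assumes "z \<in> closure \<Omega>" "\<And>n::nat. xs n \<in> closure \<Omega>" "\<And>n. ys n \<in> closure \<Omega>"
    "xs \<longlonglongrightarrow> z" "ys \<longlonglongrightarrow> z" "e > 0"
  shows "\<forall>\<^sub>F n in sequentially. u (xs n) < u z + e \<and> v z - e < v (ys n)"
proof -
  obtain d1 where d1: "d1 > 0" "\<And>y. y \<in> closure \<Omega> \<Longrightarrow> dist y z < d1 \<Longrightarrow> u y < u z + e"
    using usc[unfolded usc_on_def, rule_format, OF assms(1,6)] by auto
  obtain d2 where d2: "d2 > 0" "\<And>y. y \<in> closure \<Omega> \<Longrightarrow> dist y z < d2 \<Longrightarrow> v z - e < v y"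
    using lsc[unfolded lsc_on_def, rule_format, OF assms(1,6)] by auto
  have "\<forall>\<^sub>F n in sequentially. dist (xs n) z < d1" "\<forall>\<^sub>F n in sequentially. dist (ys n) z < d2"
    using tendstoD[OF assms(4) d1(1)] tendstoD[OF assms(5) d2(1)] by auto
  then show ?thesis
    by eventually_elim (use d1(2) d2(2) assms(2,3) in auto)
qed

text \<open>At a boundary limit the boundary condition gives u \<le> v, while semicontinuity would
  preserve the gap M > 0.\<close>

lemma interior_limit:
  assumes z: "\<And>n::nat. xs n \<in> closure \<Omega>" "\<And>n. ys n \<in> closure \<Omega>" "xs \<longlonglongrightarrow> z" "ys \<longlonglongrightarrow> z"
    and ge: "\<And>n. M \<le> u (xs n) - v (ys n)"
  shows "z \<in> \<Omega>"
proof (rule ccontr)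
  assume "z \<notin> \<Omega>"
  have zK: "z \<in> closure \<Omega>" using closed_sequentially[OF closed_closure] z by blast
  then have "z \<in> frontier \<Omega>" using \<open>z \<notin> \<Omega>\<close> \<Omega>(1) by (simp add: frontier_def interior_open)
  then have "u z \<le> v z" by (rule bdry)
  moreover have "\<forall>\<^sub>F n in sequentially. u (xs n) < u z + M / 2 \<and> v z - M / 2 < v (ys n)"
    using M(1) by (intro upper_limit zK z) auto
  then obtain n where "u (xs n) < u z + M / 2" "v z - M / 2 < v (ys n)"
    using eventually_happens'[OF sequentially_bot] by blast
  ultimately show False using ge[of n] by linarith
qed

text \<open>The compactness form of \<open>interior_limit\<close>. Maximum points of the doubled
  function satisfy u x - v y \<ge> M, so once they are close both lie where the equations
  hold.\<close>

lemma interior_gap: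
  obtains \<rho> where "\<rho> > 0"
    "\<And>x y. x \<in> closure \<Omega> \<Longrightarrow> y \<in> closure \<Omega> \<Longrightarrow> norm (x - y) < \<rho> \<Longrightarrow> M \<le> u x - v y \<Longrightarrow> x \<in> \<Omega> \<and> y \<in> \<Omega>"
proof -
  have "\<exists>\<rho>>0. \<forall>x\<in>closure \<Omega>. \<forall>y\<in>closure \<Omega>. norm (x - y) < \<rho> \<and> M \<le> u x - v y \<longrightarrow> x \<in> \<Omega> \<and> y \<in> \<Omega>"
  proof (rule ccontr)
    assume neg: "\<not> ?thesis"
    have "\<forall>n::nat. \<exists>z. fst z \<in> closure \<Omega> \<and> snd z \<in> closure \<Omega> \<and> norm (fst z - snd z) < inverse (real (Suc n)) \<and> M \<le> u (fst z) - v (snd z) \<and> \<not> (fst z \<in> \<Omega> \<and> snd z \<in> \<Omega>)"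
    proof
      fix n :: nat
      have "inverse (real (Suc n)) > 0" by simp
      then have "\<not> (\<forall>x\<in>closure \<Omega>. \<forall>y\<in>closure \<Omega>. norm (x - y) < inverse (real (Suc n)) \<and> M \<le> u x - v y \<longrightarrow> x \<in> \<Omega> \<and> y \<in> \<Omega>)"
        using neg by blast
      then obtain x y where "x \<in> closure \<Omega>" "y \<in> closure \<Omega>" "norm (x - y) < inverse (real (Suc n))" "M \<le> u x - v y" "\<not> (x \<in> \<Omega> \<and> y \<in> \<Omega>)"
        by auto
      then show "\<exists>z. fst z \<in> closure \<Omega> \<and> snd z \<in> closure \<Omega> \<and> norm (fst z - snd z) < inverse (real (Suc n)) \<and> M \<le> u (fst z) - v (snd z) \<and> \<not> (fst z \<in> \<Omega> \<and> snd z \<in> \<Omega>)"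
        by (intro exI[of _ "(x, y)"]) simp
    qed
    from choice[OF this] obtain w where w: "\<forall>n. fst (w n) \<in> closure \<Omega> \<and> snd (w n) \<in> closure \<Omega> \<and> norm (fst (w n) - snd (w n)) < inverse (real (Suc n)) \<and> M \<le> u (fst (w n)) - v (snd (w n)) \<and> \<not> (fst (w n) \<in> \<Omega> \<and> snd (w n) \<in> \<Omega>)" ..
    have "bounded (range (\<lambda>n. fst (w n)))"
      by (rule bounded_subset[OF bounded_closure[OF \<Omega>(2)]]) (use w in auto)
    from bounded_imp_convergent_subsequence[OF this]
    obtain z \<rho> where \<rho>: "strict_mono \<rho>" "((\<lambda>n. fst (w n)) \<circ> \<rho>) \<longlonglongrightarrow> z"
      by (elim exE conjE)
    let ?xs = "\<lambda>n. fst (w (\<rho> n))" and ?ys = "\<lambda>n. snd (w (\<rho> n))"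
    have xl: "?xs \<longlonglongrightarrow> z" using \<rho>(2) by (simp add: o_def)
    have "(\<lambda>n. inverse (real (Suc (\<rho> n)))) \<longlonglongrightarrow> 0"
      using LIMSEQ_subseq_LIMSEQ[OF LIMSEQ_inverse_real_of_nat \<rho>(1)] by (simp add: o_def)
    then have "(\<lambda>n. ?xs n - ?ys n) \<longlonglongrightarrow> 0"
      by (rule Lim_null_comparison[rotated]) (use w less_imp_le in \<open>auto intro!: always_eventually\<close>)
    from tendsto_diff[OF xl this] have yl: "?ys \<longlonglongrightarrow> z" by simp
    have "z \<in> \<Omega>"
      by (rule interior_limit[OF _ _ xl yl]) (use w in auto)
    then have "\<forall>\<^sub>F n in sequentially. ?xs n \<in> \<Omega>" "\<forall>\<^sub>F n in sequentially. ?ys n \<in> \<Omega>"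
      using topological_tendstoD[OF xl \<Omega>(1)] topological_tendstoD[OF yl \<Omega>(1)] by auto
    then have "\<forall>\<^sub>F n in sequentially. ?xs n \<in> \<Omega> \<and> ?ys n \<in> \<Omega>" by eventually_elim simp
    then obtain n where "?xs n \<in> \<Omega> \<and> ?ys n \<in> \<Omega>"
      using eventually_happens'[OF sequentially_bot] by blast
    then show False using w by blast
  qed
  then obtain \<rho> where "\<rho> > 0" "\<forall>x\<in>closure \<Omega>. \<forall>y\<in>closure \<Omega>. norm (x - y) < \<rho> \<and> M \<le> u x - v y \<longrightarrow> x \<in> \<Omega> \<and> y \<in> \<Omega>"
    by (elim exE conjE)
  then show thesis by (intro that[of \<rho>]) auto
qed

text \<open>At a maximum of the doubled function, p and B majorise the penalty near x - y to second
  order; maximality then is the touching condition of \<open>viscosity_doubling\<close>.\<close>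

lemma doubling_inequality:
  assumes xy: "x \<in> \<Omega>" "y \<in> \<Omega>" and \<phi>: "continuous_on UNIV \<phi>"
    and max: "\<And>x' y'. x' \<in> closure \<Omega> \<Longrightarrow> y' \<in> closure \<Omega> \<Longrightarrow> u x' - v y' - \<phi> (x' - y') \<le> u x - v y - \<phi> (x - y)"
    and d: "d > 0" and up: "\<And>h. norm h < d \<Longrightarrow> \<phi> (x - y + h) \<le> \<phi> (x - y) + p \<bullet> h + h \<bullet> (B *v h) / 2"
    and B: "symmetric_mat B" and \<tau>: "\<tau> > 0"
  obtains X Y where "symmetric_mat X" "symmetric_mat Y" "\<And>w. w \<bullet> ((X + Y) *v w) \<le> 0"
    "\<And>w. w \<bullet> ((X + Y) *v w) \<le> 4 * (w \<bullet> (B *v w)) + 4 * \<tau> * (norm w)\<^sup>2"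
    "f y - g x + \<gamma> (u x) - \<gamma> (v y) \<le> Fp F \<alpha> p X - Fp F \<alpha> p (- Y) + (b y - b x) * norm p powr \<beta>"
proof -
  obtain r1 where r1: "r1 > 0" "ball x r1 \<subseteq> \<Omega>" using \<Omega>(1) xy open_contains_ball by blast
  obtain r2 where r2: "r2 > 0" "ball y r2 \<subseteq> \<Omega>" using \<Omega>(1) xy open_contains_ball by blast
  \<comment> \<open>The argument of the penalty changes by the difference of two displacements, each
    shorter than r0, so d / 2 suffices.\<close>
  define r0 where "r0 = min (d / 2) (min r1 r2)"
  have r0: "r0 > 0" "r0 \<le> d / 2" "r0 \<le> r1" "r0 \<le> r2" using d r1 r2 by (auto simp: r0_def)
  have le: "u x' - v y' \<le> u x - v y + p \<bullet> ((x' - y') - (x - y)) + ((x' - y') - (x - y)) \<bullet> (B *v ((x' - y') - (x - y))) / 2"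
    if x': "x' \<in> ball x r0" and y': "y' \<in> ball y r0" for x' y'
  proof -
    let ?h = "(x' - y') - (x - y)"
    have K: "x' \<in> closure \<Omega>" "y' \<in> closure \<Omega>"
      using x' y' r0(3,4) r1(2) r2(2) subset_ball[of r0 r1 x] subset_ball[of r0 r2 y] closure_subset[of \<Omega>] by blast+
    have "norm ?h = norm ((x' - x) - (y' - y))" by (simp add: algebra_simps)
    also have "\<dots> \<le> norm (x' - x) + norm (y' - y)" by (rule norm_triangle_ineq4)
    also have "\<dots> < d" using x' y' r0(2) by (simp add: dist_norm norm_minus_commute)
    finally have "\<phi> (x - y + ?h) \<le> \<phi> (x - y) + p \<bullet> ?h + ?h \<bullet> (B *v ?h) / 2" by (rule up)
    moreover have "x - y + ?h = x' - y'" by simp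
    ultimately show ?thesis using max[OF K] by simp
  qed
  show thesis
  proof (rule viscosity_doubling[OF \<Omega>(1) xy F \<alpha> \<beta>(1) b \<gamma>(2) fg(1,2) sub super r0(1) le B \<tau>])
    fix X Y :: "real^'n^'n"
    assume "symmetric_mat X" "symmetric_mat Y" "\<And>w. w \<bullet> ((X + Y) *v w) \<le> 0"
      "\<And>w. w \<bullet> ((X + Y) *v w) \<le> 4 * (w \<bullet> (B *v w)) + 4 * \<tau> * (norm w)\<^sup>2"
      "f y - g x + \<gamma> (u x) - \<gamma> (v y) \<le> Fp F \<alpha> p X - Fp F \<alpha> p (- Y) + (b y - b x) * norm p powr \<beta>"
    then show thesis by (rule that)
  qed assumption+
qed

text \<open>If the estimate fails, the doubled function with a large L has a maximum exceeding M at
  distinct points, and L forces them to be close. The elliptic gain from the concavity of the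
  penalty then outweighs the term with b and the bounded right sides.\<close>

lemma hoelder_estimate:
  assumes \<kappa>: "0 < \<kappa>" "\<kappa> < 1"
  shows "\<exists>L\<ge>0. \<forall>x\<in>closure \<Omega>. \<forall>y\<in>closure \<Omega>. u x - v y \<le> M + L * norm (x - y) powr \<kappa>"
proof -
  obtain x0 y0 where S0: "\<And>x y. x \<in> closure \<Omega> \<Longrightarrow> y \<in> closure \<Omega> \<Longrightarrow> u x - v y - 0 \<le> u x0 - v y0 - 0"
    by (rule doubling_max[of "\<lambda>_. 0"]) auto
  define S where "S = \<bar>u x0 - v y0\<bar> + 1"
  have S: "S > 0" "\<And>x y. x \<in> closure \<Omega> \<Longrightarrow> y \<in> closure \<Omega> \<Longrightarrow> u x - v y \<le> S"
    using S0 by (auto simp: S_def) fastforce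
  obtain \<rho> where \<rho>: "\<rho> > 0"
    "\<And>x y. x \<in> closure \<Omega> \<Longrightarrow> y \<in> closure \<Omega> \<Longrightarrow> norm (x - y) < \<rho> \<Longrightarrow> M \<le> u x - v y \<Longrightarrow> x \<in> \<Omega> \<and> y \<in> \<Omega>"
    by (rule interior_gap) blast
  obtain C \<theta> where \<theta>: "0 < \<theta>" and C0: "\<forall>x\<in>\<Omega>. \<forall>y\<in>\<Omega>. \<bar>b x - b y\<bar> \<le> C * dist x y powr \<theta>"
    using b unfolding holder_on_def by blast
  define C' where "C' = \<bar>C\<bar> + 1"
  have C': "C' > 0" by (simp add: C'_def)
  have C: "b y - b x \<le> C' * norm (x - y) powr \<theta>" if "x \<in> \<Omega>" "y \<in> \<Omega>" for x y
  proof -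
    have "C * dist x y powr \<theta> \<le> C' * dist x y powr \<theta>" by (intro mult_right_mono) (auto simp: C'_def)
    moreover have "\<bar>b x - b y\<bar> \<le> C * dist x y powr \<theta>" using C0 that by blast
    ultimately show ?thesis unfolding dist_norm by linarith
  qed
  obtain Gf where Gf: "\<And>x. x \<in> \<Omega> \<Longrightarrow> \<bar>f x\<bar> \<le> Gf" using fg(3) unfolding bounded_iff by auto
  obtain Gg where Gg: "\<And>x. x \<in> \<Omega> \<Longrightarrow> \<bar>g x\<bar> \<le> Gg" using fg(4) unfolding bounded_iff by auto
  define G where "G = \<bar>Gf\<bar> + \<bar>Gg\<bar> + 1"
  have G: "G > 0" by (simp add: G_def)
  have fgG: "- G \<le> f y - g x" if "x \<in> \<Omega>" "y \<in> \<Omega>" for x y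
    using Gf[OF that(2)] Gg[OF that(1)] unfolding G_def by linarith
  have a: "a > 0" using F by (simp add: structural_F_def)
  let ?n = "real CARD('n)"
  have n: "?n > 0" by simp
  \<comment> \<open>t measures the concavity of the penalty, through 2 - \<kappa> = 1 + 4 * t. The
    threshold \<eta> below is fixed by n * \<eta>^2 = t, the squared length that truncation may
    discard.\<close>
  define t where "t = (1 - \<kappa>) / 4"
  have t: "0 < t" "t \<le> 1 / 4" "2 - \<kappa> = 1 + 4 * t" using \<kappa> by (auto simp: t_def)
  define \<eta> where "\<eta> = sqrt (t / ?n)"
  have \<eta>: "\<eta> > 0" "?n * \<eta>\<^sup>2 = t" using t n by (auto simp: \<eta>_def)
  \<comment> \<open>c is the coefficient of the elliptic gain c * P^\<alpha> * D: ellipticity a, the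
    factor of \<open>degenerate_trace_bound\<close>, and the negativity 2 * t * D of X + Y.\<close>
  define c where "c = a * (\<eta> powr \<alpha> / ?n * (2 * t))"
  have c: "c > 0" using a \<eta> n t by (simp add: c_def)
  \<comment> \<open>Four demands on \<delta> = |x - y|: \<delta> < 1 for P \<ge> 1, \<delta> <
    \<rho> for interior points, \<delta> < c / (2 * G) so that half the gain beats the right sides,
    and the last entry so that the other half beats the term with b.\<close>
  define \<delta>0 where "\<delta>0 = min (min 1 \<rho>) (min (c / (2 * G)) ((c / (2 * C' * S)) powr (1 / \<theta>)))"
  have "(c / (2 * C' * S)) powr (1 / \<theta>) > 0" using c C' S(1) by simp
  then have \<delta>0: "\<delta>0 > 0" "\<delta>0 \<le> 1" "\<delta>0 \<le> \<rho>" "\<delta>0 \<le> c / (2 * G)" "\<delta>0 \<le> (c / (2 * C' * S)) powr (1 / \<theta>)"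
    using \<rho>(1) c G unfolding \<delta>0_def by auto
  \<comment> \<open>The first entry gives L * \<kappa> \<ge> 1, hence P \<ge> 1; the second forces
    \<delta> < \<delta>0, because L * \<delta>^\<kappa> < S at the maximum.\<close>
  define L where "L = max (1 / \<kappa>) (S / \<delta>0 powr \<kappa>)"
  have L: "L > 0" "L * \<kappa> \<ge> 1" "S \<le> L * \<delta>0 powr \<kappa>"
  proof -
    have "1 / \<kappa> \<le> L" "S / \<delta>0 powr \<kappa> \<le> L" by (auto simp: L_def)
    then show "L * \<kappa> \<ge> 1" "S \<le> L * \<delta>0 powr \<kappa>" using \<kappa> \<delta>0(1) by (auto simp: divide_le_eq)
    show "L > 0" using \<kappa> \<open>1 / \<kappa> \<le> L\<close> by (meson less_le_trans zero_less_divide_1_iff)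
  qed
  have "u x - v y \<le> M + L * norm (x - y) powr \<kappa>" if xy: "x \<in> closure \<Omega>" "y \<in> closure \<Omega>" for x y
  proof (rule ccontr)
    assume "\<not> u x - v y \<le> M + L * norm (x - y) powr \<kappa>"
    then have gt: "M < u x - v y - L * norm (x - y) powr \<kappa>" by simp
    have cont: "continuous_on UNIV (\<lambda>z :: real^'n. L * norm z powr \<kappa>)"
      using \<kappa> by (intro continuous_intros continuous_on_powr') auto
    obtain x1 y1 where K: "x1 \<in> closure \<Omega>" "y1 \<in> closure \<Omega>"
      and max: "\<And>x' y'. x' \<in> closure \<Omega> \<Longrightarrow> y' \<in> closure \<Omega> \<Longrightarrow>
        u x' - v y' - L * norm (x' - y') powr \<kappa> \<le> u x1 - v y1 - L * norm (x1 - y1) powr \<kappa>"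
      by (rule doubling_max[OF cont]) blast
    define z where "z = x1 - y1"
    define \<delta> where "\<delta> = norm z"
    have gt1: "M + L * \<delta> powr \<kappa> < u x1 - v y1"
      using max[OF xy] gt by (simp add: z_def \<delta>_def)
    \<comment> \<open>The power penalty is singular at 0. A maximum on the diagonal would contradict
      u - v \<le> M.\<close>
    have z: "z \<noteq> 0"
    proof
      assume "z = 0"
      then have "x1 = y1" by (simp add: z_def)
      then show False using gt1 M(2)[OF K(2)] \<open>z = 0\<close> by (simp add: \<delta>_def)
    qed
    then have \<delta>: "\<delta> > 0" by (simp add: \<delta>_def)
    have L\<delta>: "L * \<delta> powr \<kappa> < S" using gt1 S(2)[OF K] M(1) by linarith
    then have "L * \<delta> powr \<kappa> < L * \<delta>0 powr \<kappa>" using L(3) by linarith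
    then have "\<delta> powr \<kappa> < \<delta>0 powr \<kappa>" using L(1) by simp
    then have \<delta>\<delta>0: "\<delta> < \<delta>0" using \<delta> \<delta>0(1) \<kappa>(1) by (meson linorder_not_less less_imp_le powr_mono2)
    have "0 \<le> L * \<delta> powr \<kappa>" using L(1) by simp
    then have ge: "M \<le> u x1 - v y1" using gt1 by linarith
    have in\<Omega>: "x1 \<in> \<Omega>" "y1 \<in> \<Omega>"
      using \<rho>(2)[OF K _ ge] \<delta>\<delta>0 \<delta>0(3) by (auto simp: \<delta>_def z_def)
    define D where "D = L * \<kappa> * \<delta> powr (\<kappa> - 2)"
    have D: "D > 0" using L(1) \<kappa> \<delta> by (simp add: D_def)
    define P where "P = D * \<delta>"
    have P0: "P > 0" using D \<delta> by (simp add: P_def)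
    have P_eq: "P = L * \<kappa> * \<delta> powr (\<kappa> - 1)"
    proof -
      have "\<delta> powr (\<kappa> - 2) * \<delta> = \<delta> powr (\<kappa> - 1)"
        using \<delta> powr_add[of \<delta> "\<kappa> - 2" 1] by simp
      then show ?thesis by (simp add: P_def D_def mult.assoc)
    qed
    have P1: "P \<ge> 1"
    proof -
      have "1 \<le> \<delta> powr (\<kappa> - 1)"
        using \<delta> \<delta>\<delta>0 \<delta>0(2) \<kappa> powr_mono2'[of "1 - \<kappa>" \<delta> 1] powr_mono'[of "\<kappa> - 1" 0 \<delta>] by simp
      then have "1 * 1 \<le> (L * \<kappa>) * \<delta> powr (\<kappa> - 1)" using L(2) by (intro mult_mono) auto
      then show ?thesis by (simp add: P_eq)
    qed
    have P\<delta>: "\<delta> * P \<le> S"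
    proof -
      have "\<delta> powr (\<kappa> - 1) * \<delta> = \<delta> powr \<kappa>"
        using \<delta> powr_add[of \<delta> "\<kappa> - 1" 1] by simp
      then have "\<delta> * P = \<kappa> * (L * \<delta> powr \<kappa>)" by (simp add: P_eq mult_ac)
      also have "\<dots> \<le> 1 * (L * \<delta> powr \<kappa>)" using \<kappa> L(1) by (intro mult_right_mono) auto
      finally show ?thesis using L\<delta> by simp
    qed
    define e where "e = (1 / \<delta>) *\<^sub>R z"
    have ne: "norm e = 1" using \<delta> by (simp add: e_def \<delta>_def)
    define p where "p = D *\<^sub>R z"
    have np: "norm p = P" using D by (simp add: p_def P_def \<delta>_def)
    \<comment> \<open>The concavity contributes - 4 * t * D to X + Y. The Taylor slack costs 8 *
      \<sigma> = t * D and the parameter t * D / 4 of the theorem on sums another t * D, leaving - 2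
      * t * D.\<close>
    define \<sigma> where "\<sigma> = t * D / 8"
    have \<sigma>: "\<sigma> > 0" using t D by (simp add: \<sigma>_def)
    define E :: "real^'n^'n" where "E = (\<chi> i j. e $ i * e $ j)"
    \<comment> \<open>The Hessian of the penalty at z, with E the projection onto the unit vector e,
      plus 2 * \<sigma> times the identity for the Taylor remainder.\<close>
    define B where "B = mat (D + 2 * \<sigma>) - (D * (2 - \<kappa>)) *\<^sub>R E"
    have symB: "symmetric_mat B"
      unfolding B_def by (intro symmetric_mat_diff symmetric_mat_mat)
        (simp add: symmetric_mat_def transpose_def E_def vec_eq_iff mult.commute)
    have Bh: "h \<bullet> (B *v h) = D * ((norm h)\<^sup>2 - (2 - \<kappa>) * (e \<bullet> h)\<^sup>2) + 2 * \<sigma> * (norm h)\<^sup>2" for h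
    proof -
      have "E *v h = (e \<bullet> h) *\<^sub>R e"
        by (simp add: vec_eq_iff E_def matrix_vector_mult_def inner_vec_def sum_distrib_left mult_ac)
      then have "B *v h = (D + 2 * \<sigma>) *\<^sub>R h - (D * (2 - \<kappa>)) *\<^sub>R (e \<bullet> h) *\<^sub>R e"
        unfolding B_def matrix_vector_mult_diff_rdistrib mat_vector_mult by (simp add: scaleR_matrix_vector_assoc[symmetric])
      then have "h \<bullet> (B *v h) = (D + 2 * \<sigma>) * (h \<bullet> h) - D * (2 - \<kappa>) * ((e \<bullet> h) * (h \<bullet> e))"
        by (simp add: inner_diff_right)
      then show ?thesis
        unfolding power2_norm_eq_inner power2_eq_square[of "e \<bullet> h"] inner_commute[of h e]
        by (simp add: algebra_simps)
    qed
    obtain d where d: "d > 0" "\<And>h. norm h < d \<Longrightarrow> L * norm (z + h) powr \<kappa> \<le> L * norm z powr \<kappa> + (D *\<^sub>R z) \<bullet> h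
        + D * ((norm h)\<^sup>2 - (2 - \<kappa>) * ((z \<bullet> h) / norm z)\<^sup>2) / 2 + \<sigma> * (norm h)\<^sup>2"
      using norm_powr_second_order_upper[OF z \<sigma>, of L \<kappa>] unfolding D_def \<delta>_def by blast
    have up: "L * norm (x1 - y1 + h) powr \<kappa> \<le> L * norm (x1 - y1) powr \<kappa> + p \<bullet> h + h \<bullet> (B *v h) / 2"
      if "norm h < d" for h
    proof -
      have "(z \<bullet> h) / norm z = e \<bullet> h" by (simp add: e_def \<delta>_def)
      then have "h \<bullet> (B *v h) / 2 = D * ((norm h)\<^sup>2 - (2 - \<kappa>) * ((z \<bullet> h) / norm z)\<^sup>2) / 2 + \<sigma> * (norm h)\<^sup>2"
        unfolding Bh by (simp add: add_divide_distrib)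
      then show ?thesis
        using d(2)[OF that] unfolding p_def z_def[symmetric] by linarith
    qed
    have \<tau>: "t * D / 4 > 0" using t D by simp
    have "\<exists>X Y. symmetric_mat X \<and> symmetric_mat Y \<and> (\<forall>w. w \<bullet> ((X + Y) *v w) \<le> 0) \<and>
      (\<forall>w. w \<bullet> ((X + Y) *v w) \<le> 4 * (w \<bullet> (B *v w)) + 4 * (t * D / 4) * (norm w)\<^sup>2) \<and>
      f y1 - g x1 + \<gamma> (u x1) - \<gamma> (v y1) \<le> Fp F \<alpha> p X - Fp F \<alpha> p (- Y) + (b y1 - b x1) * norm p powr \<beta>"
      by (rule doubling_inequality[OF in\<Omega> cont max d(1) up symB \<tau>]) (assumption+, intro exI conjI allI)
    then obtain X Y where XY0: "symmetric_mat X" "symmetric_mat Y" "\<forall>w. w \<bullet> ((X + Y) *v w) \<le> 0"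
      "\<forall>w. w \<bullet> ((X + Y) *v w) \<le> 4 * (w \<bullet> (B *v w)) + 4 * (t * D / 4) * (norm w)\<^sup>2"
      "f y1 - g x1 + \<gamma> (u x1) - \<gamma> (v y1) \<le> Fp F \<alpha> p X - Fp F \<alpha> p (- Y) + (b y1 - b x1) * norm p powr \<beta>"
      by (elim exE conjE)
    note XY = XY0(1,2) XY0(3,4)[rule_format] XY0(5)
    define w where "w = truncate \<eta> e"
    define \<omega> where "\<omega> = (norm w)\<^sup>2"
    have \<omega>: "1 - t \<le> \<omega>" "\<omega> \<le> 1"
      using norm_truncate_ge[of \<eta> e] norm_truncate_le[of \<eta> e] \<eta> by (auto simp: \<omega>_def w_def ne abs_square_le_1)
    have ew: "e \<bullet> w = \<omega>" by (simp add: w_def \<omega>_def inner_truncate)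
    have "w \<bullet> ((X + Y) *v w) \<le> - (2 * t * D)"
    proof -
      have "D * (\<omega> - (2 - \<kappa>) * \<omega>\<^sup>2) \<le> D * (- t)"
        unfolding t(3) using D t \<omega> by (intro mult_left_mono direction_gain) auto
      then have 1: "D * (\<omega> - (2 - \<kappa>) * \<omega>\<^sup>2) \<le> - (t * D)" by (simp add: mult.commute)
      have 2: "2 * \<sigma> * \<omega> \<le> 2 * \<sigma>" "t * D / 4 * \<omega> \<le> t * D / 4"
        using mult_left_mono[OF \<omega>(2), of "2 * \<sigma>"] mult_left_mono[OF \<omega>(2), of "t * D / 4"] \<sigma> \<tau> by auto
      have 3: "w \<bullet> ((X + Y) *v w) \<le> 4 * (D * (\<omega> - (2 - \<kappa>) * \<omega>\<^sup>2) + 2 * \<sigma> * \<omega>) + 4 * (t * D / 4 * \<omega>)"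
        using XY(4)[of w] unfolding Bh ew \<omega>_def[symmetric] by (simp only: mult.assoc)
      have 4: "8 * \<sigma> = t * D" by (simp add: \<sigma>_def)
      have "R \<le> - (2 * k)" if "q \<le> - k" "y \<le> 2 * \<sigma>" "s \<le> k / 4" "R \<le> 4 * (q + y) + 4 * s" "8 * \<sigma> = k" for R q y s k
        using that by (simp add: distrib_left)
      from this[OF 1 2 3 4] show ?thesis by (simp only: mult.assoc)
    qed
    then have "(\<Sum>i\<in>UNIV. \<bar>e $ i\<bar> powr \<alpha> * (X + Y) $ i $ i) \<le> - (\<eta> powr \<alpha> / CARD('n) * (2 * t * D))"
      unfolding w_def using XY(1-3) ne \<eta>(1) \<alpha> by (intro degenerate_trace_bound symmetric_mat_add) auto
    then have "(a * P powr \<alpha>) * (\<Sum>i\<in>UNIV. \<bar>e $ i\<bar> powr \<alpha> * (X + Y) $ i $ i) \<le> (a * P powr \<alpha>) * - (\<eta> powr \<alpha> / CARD('n) * (2 * t * D))"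
      using a by (intro mult_left_mono) auto
    moreover have "a * (\<Sum>i\<in>UNIV. \<bar>p $ i\<bar> powr \<alpha> * (X + Y) $ i $ i) = (a * P powr \<alpha>) * (\<Sum>i\<in>UNIV. \<bar>e $ i\<bar> powr \<alpha> * (X + Y) $ i $ i)"
    proof -
      have "p $ i = P * e $ i" for i using \<delta> by (simp add: p_def P_def e_def)
      then have "\<bar>p $ i\<bar> powr \<alpha> = P powr \<alpha> * \<bar>e $ i\<bar> powr \<alpha>" for i
        using P0 by (simp add: abs_mult powr_mult)
      then show ?thesis by (simp add: sum_distrib_left mult.assoc)
    qed
    moreover have "(a * P powr \<alpha>) * - (\<eta> powr \<alpha> / CARD('n) * (2 * t * D)) = - (c * (P powr \<alpha> * D))"
      by (simp add: c_def)
    ultimately have ell: "Fp F \<alpha> p X - Fp F \<alpha> p (- Y) \<le> - (c * (P powr \<alpha> * D))"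
      using Fp_ellipticity[OF F XY(1-3), of \<alpha> p] by linarith
    have "\<gamma> (v y1) \<le> \<gamma> (u x1)" using ge M(1) by (intro monoD[OF \<gamma>(1)]) linarith
    then have main: "- G \<le> - (c * (P powr \<alpha> * D)) + (b y1 - b x1) * P powr \<beta>"
      using XY(5) ell fgG[OF in\<Omega>] unfolding np by linarith
    have PD: "0 < P powr \<alpha> * D" using P0 D by simp
    have "(b y1 - b x1) * P powr \<beta> \<le> (C' * \<delta> powr \<theta>) * P powr \<beta>"
      using C[OF in\<Omega>] by (intro mult_right_mono) (auto simp: \<delta>_def z_def)
    also have "\<dots> \<le> (C' * \<delta> powr \<theta>) * (P powr \<alpha> * D * S)"
    proof (rule mult_left_mono)
      \<comment> \<open>P^2 = D * (\<delta> * P) \<le> D * S brings the power of P into the form of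
        the elliptic gain; this is where \<beta> \<le> \<alpha> + 2 enters.\<close>
      have "P powr \<beta> \<le> P powr (\<alpha> + 2)" using P1 \<beta>(2) by (intro powr_mono) auto
      also have "\<dots> = P powr \<alpha> * (P * P)" using P0 by (simp add: powr_add power2_eq_square)
      also have "P * P = D * (\<delta> * P)" by (simp add: P_def)
      also have "P powr \<alpha> * (D * (\<delta> * P)) \<le> P powr \<alpha> * (D * S)"
        using P\<delta> D by (intro mult_left_mono) auto
      finally show "P powr \<beta> \<le> P powr \<alpha> * D * S" by (simp add: mult.assoc)
    qed (use C' in auto)
    also have "\<dots> = (C' * S * \<delta> powr \<theta>) * (P powr \<alpha> * D)" by (simp add: mult_ac)
    also have "\<dots> \<le> (c / 2) * (P powr \<alpha> * D)"
    proof (rule mult_right_mono)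
      have "\<delta> powr \<theta> \<le> ((c / (2 * C' * S)) powr (1 / \<theta>)) powr \<theta>"
        using \<delta> \<delta>\<delta>0 \<delta>0(5) \<theta> by (intro powr_mono2) auto
      also have "\<dots> = c / (2 * C' * S)" using \<theta> c C' S(1) by (simp add: powr_powr)
      finally have "C' * S * \<delta> powr \<theta> \<le> C' * S * (c / (2 * C' * S))"
        using C' S(1) by (intro mult_left_mono) auto
      also have "\<dots> = c / 2" using C' S(1) by simp
      finally show "C' * S * \<delta> powr \<theta> \<le> c / 2" .
    qed (use PD in simp)
    finally have "c / 2 * (P powr \<alpha> * D) \<le> G" using main by simp
    moreover have "1 * D \<le> P powr \<alpha> * D"
      using P1 \<alpha> D ge_one_powr_ge_zero[of P \<alpha>] by (intro mult_right_mono) auto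
    then have "c / 2 * D \<le> c / 2 * (P powr \<alpha> * D)" using c by (intro mult_left_mono) auto
    \<comment> \<open>P \<ge> 1 gives D = P / \<delta> \<ge> 1 / \<delta>, which exceeds 2 * G / c
      by the choice of \<delta>0.\<close>
    moreover have "2 * G / c < D"
    proof -
      have "\<delta> < c / (2 * G)" using \<delta>\<delta>0 \<delta>0(4) by linarith
      then have "2 * G * \<delta> < c * 1" using G by (simp add: field_simps)
      also have "\<dots> \<le> c * P" using P1 c by (intro mult_left_mono) auto
      also have "\<dots> = c * D * \<delta>" by (simp add: P_def)
      finally have "2 * G < c * D" using \<delta> by simp
      then show ?thesis using c by (simp add: divide_less_eq mult.commute)
    qed
    then have "G < c / 2 * D" using c by (simp add: divide_less_eq mult.commute)
    ultimately show False by linarith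
  qed
  then show ?thesis using L(1) by (intro exI[of _ L]) auto
qed

end

context viscosity_pair
begin

text \<open>Limit of the maximum points for the penalties j / 2 |x - y|^2. The quadratic penalty has
  no concave direction, so the term with b has to vanish in the limit by itself;
  \<open>hoelder_estimate\<close> provides this through a bound on the gradients.\<close>

lemma comparison_point:
  assumes x0: "x0 \<in> closure \<Omega>" "u x0 - v x0 = M"
  shows "\<exists>z\<in>\<Omega>. v z < u z \<and> f z - g z + \<gamma> (u z) - \<gamma> (v z) \<le> 0"
proof -
  obtain C0 \<theta> where \<theta>: "0 < \<theta>" and C0: "\<forall>x\<in>\<Omega>. \<forall>y\<in>\<Omega>. \<bar>b x - b y\<bar> \<le> C0 * dist x y powr \<theta>"
    using b unfolding holder_on_def by blast
  define C where "C = \<bar>C0\<bar>"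
  have C: "b y - b x \<le> C * norm (x - y) powr \<theta>" if "x \<in> \<Omega>" "y \<in> \<Omega>" for x y
  proof -
    have "C0 * dist x y powr \<theta> \<le> C * dist x y powr \<theta>" by (intro mult_right_mono) (auto simp: C_def)
    moreover have "\<bar>b x - b y\<bar> \<le> C0 * dist x y powr \<theta>" using C0 that by blast
    ultimately show ?thesis unfolding dist_norm by linarith
  qed
  \<comment> \<open>s = 1 - \<kappa>. The second entry makes s * \<beta> \<le> \<theta> / 2, so
    \<delta>^\<theta> beats |p|^\<beta>, which is of order \<delta>^(- s \<beta>); the first keeps
    \<kappa> positive.\<close>
  define s where "s = min (1 / 2) (\<theta> / (2 * \<beta>))"
  define \<kappa> where "\<kappa> = 1 - s"
  have s: "0 < s" "s < 1" "s * \<beta> < \<theta>"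
  proof -
    show "0 < s" "s < 1" using \<theta> \<beta>(1) by (auto simp: s_def)
    have "s \<le> \<theta> / (2 * \<beta>)" by (simp add: s_def)
    then have "s * \<beta> \<le> \<theta> / 2" using \<beta>(1) by (simp add: field_simps)
    then show "s * \<beta> < \<theta>" using \<theta> by linarith
  qed
  define \<epsilon> where "\<epsilon> = \<theta> - s * \<beta>"
  have \<epsilon>: "\<epsilon> > 0" using s by (simp add: \<epsilon>_def)
  obtain L where L: "L \<ge> 0" "\<And>x y. x \<in> closure \<Omega> \<Longrightarrow> y \<in> closure \<Omega> \<Longrightarrow> u x - v y \<le> M + L * norm (x - y) powr \<kappa>"
    using hoelder_estimate[of \<kappa>] s by (auto simp: \<kappa>_def)
  obtain \<rho> where \<rho>: "\<rho> > 0"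
    "\<And>x y. x \<in> closure \<Omega> \<Longrightarrow> y \<in> closure \<Omega> \<Longrightarrow> norm (x - y) < \<rho> \<Longrightarrow> M \<le> u x - v y \<Longrightarrow> x \<in> \<Omega> \<and> y \<in> \<Omega>"
    by (rule interior_gap) blast
  define \<phi> where "\<phi> = (\<lambda>n (z :: real^'n). real (Suc n) / 2 * (norm z)\<^sup>2)"
  have cont: "continuous_on UNIV (\<phi> n)" for n
    unfolding \<phi>_def by (intro continuous_intros)
  have "\<exists>w. fst w \<in> closure \<Omega> \<and> snd w \<in> closure \<Omega> \<and> (\<forall>x'\<in>closure \<Omega>. \<forall>y'\<in>closure \<Omega>.
      u x' - v y' - \<phi> n (x' - y') \<le> u (fst w) - v (snd w) - \<phi> n (fst w - snd w))" for n
  proof (rule doubling_max[OF cont[of n]])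
    fix x y assume "x \<in> closure \<Omega>" "y \<in> closure \<Omega>"
      "\<And>x' y'. x' \<in> closure \<Omega> \<Longrightarrow> y' \<in> closure \<Omega> \<Longrightarrow> u x' - v y' - \<phi> n (x' - y') \<le> u x - v y - \<phi> n (x - y)"
    then show ?thesis by (intro exI[of _ "(x, y)"]) simp
  qed
  from choice[OF allI[OF this]] obtain w where w: "\<forall>n. fst (w n) \<in> closure \<Omega> \<and> snd (w n) \<in> closure \<Omega> \<and> (\<forall>x'\<in>closure \<Omega>. \<forall>y'\<in>closure \<Omega>.
      u x' - v y' - \<phi> n (x' - y') \<le> u (fst (w n)) - v (snd (w n)) - \<phi> n (fst (w n) - snd (w n)))" ..
  define xs where "xs = (\<lambda>n. fst (w n))"
  define ys where "ys = (\<lambda>n. snd (w n))"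
  define \<delta> where "\<delta> = (\<lambda>n. norm (xs n - ys n))"
  have K: "xs n \<in> closure \<Omega>" "ys n \<in> closure \<Omega>" for n
    using w by (auto simp: xs_def ys_def)
  have max: "u x' - v y' - \<phi> n (x' - y') \<le> u (xs n) - v (ys n) - \<phi> n (xs n - ys n)"
    if "x' \<in> closure \<Omega>" "y' \<in> closure \<Omega>" for x' y' n
    using w that by (auto simp: xs_def ys_def)
  have val: "M + real (Suc n) / 2 * (\<delta> n)\<^sup>2 \<le> u (xs n) - v (ys n)" for n
    using max[OF x0(1) x0(1), of n] x0(2) by (simp add: \<phi>_def \<delta>_def)
  have ge: "M \<le> u (xs n) - v (ys n)" for n
    using val[of n] by (smt (verit) divide_nonneg_nonneg mult_nonneg_nonneg of_nat_0_le_iff zero_le_power2)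
  \<comment> \<open>Comparison with the diagonal point x0 bounds u - v below by M plus the penalty,
    and the Hoelder estimate bounds it above by M + L * \<delta>^\<kappa>.\<close>
  have pen: "real (Suc n) * (\<delta> n)\<^sup>2 \<le> 2 * L * \<delta> n powr \<kappa>" for n
    using val[of n] L(2)[OF K] unfolding \<delta>_def by (smt (verit) field_sum_of_halves mult.assoc mult_2 times_divide_eq_left)
  have b0: "bounded (range xs)"
    by (rule bounded_subset[OF bounded_closure[OF \<Omega>(2)]]) (use K in auto)
  from bounded_imp_convergent_subsequence[OF this]
  obtain z r where r: "strict_mono r" "(xs \<circ> r) \<longlonglongrightarrow> z"
    by (elim exE conjE)
  obtain R where R: "R > 0" "\<And>x. x \<in> closure \<Omega> \<Longrightarrow> norm x \<le> R"
    using bounded_closure[OF \<Omega>(2)] bounded_pos by blast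
  have \<delta>R: "\<delta> n \<le> 2 * R" for n
    using norm_triangle_ineq4[of "xs n" "ys n"] R(2)[OF K(1)[of n]] R(2)[OF K(2)[of n]] by (simp add: \<delta>_def)
  have "(\<lambda>n. (\<delta> n)\<^sup>2) \<longlonglongrightarrow> 0"
  proof (rule Lim_null_comparison)
    have "(\<delta> n)\<^sup>2 \<le> (2 * L * (2 * R) powr \<kappa>) * inverse (real (Suc n))" for n
    proof -
      have "\<delta> n powr \<kappa> \<le> (2 * R) powr \<kappa>"
        using \<delta>R s by (intro powr_mono2) (auto simp: \<delta>_def \<kappa>_def)
      then have "2 * L * \<delta> n powr \<kappa> \<le> 2 * L * (2 * R) powr \<kappa>" using L(1) by (intro mult_left_mono) auto
      then have "real (Suc n) * (\<delta> n)\<^sup>2 \<le> 2 * L * (2 * R) powr \<kappa>" using pen[of n] by linarith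
      then have "(\<delta> n)\<^sup>2 \<le> (2 * L * (2 * R) powr \<kappa>) / real (Suc n)"
        by (subst pos_le_divide_eq) (auto simp: mult.commute)
      then show ?thesis by (simp only: divide_inverse)
    qed
    then show "\<forall>\<^sub>F n in sequentially. norm ((\<delta> n)\<^sup>2) \<le> (2 * L * (2 * R) powr \<kappa>) * inverse (real (Suc n))"
      by (intro always_eventually) simp
    show "(\<lambda>n. (2 * L * (2 * R) powr \<kappa>) * inverse (real (Suc n))) \<longlonglongrightarrow> 0"
      by (rule tendsto_mult_right_zero[OF LIMSEQ_inverse_real_of_nat])
  qed
  then have "(\<lambda>n. sqrt ((\<delta> n)\<^sup>2)) \<longlonglongrightarrow> sqrt 0" by (rule tendsto_real_sqrt)
  then have \<delta>0: "\<delta> \<longlonglongrightarrow> 0" by (simp add: \<delta>_def)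
  have \<delta>r: "(\<lambda>n. \<delta> (r n)) \<longlonglongrightarrow> 0"
    using LIMSEQ_subseq_LIMSEQ[OF \<delta>0 r(1)] by (simp add: o_def)
  have xl: "(\<lambda>n. xs (r n)) \<longlonglongrightarrow> z" using r(2) by (simp add: o_def)
  have "(\<lambda>n. xs (r n) - ys (r n)) \<longlonglongrightarrow> 0"
    using \<delta>r unfolding \<delta>_def by (rule tendsto_norm_zero_cancel)
  from tendsto_diff[OF xl this] have yl: "(\<lambda>n. ys (r n)) \<longlonglongrightarrow> z" by simp
  have z: "z \<in> \<Omega>" by (rule interior_limit[OF K(1) K(2) xl yl ge])
  then have zK: "z \<in> closure \<Omega>" using closure_subset by blast
  have lims: "\<forall>\<^sub>F n in sequentially. u (xs (r n)) < u z + e \<and> v z - e < v (ys (r n))" if "e > 0" for e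
    by (rule upper_limit[OF zK K(1) K(2) xl yl that])
  \<comment> \<open>Semicontinuity bounds u from above and v from below along the sequence. Since u
    - v \<ge> M there and u z - v z \<le> M, neither can have a strict gap in the limit.\<close>
  have ul: "(\<lambda>n. u (xs (r n))) \<longlonglongrightarrow> u z"
  proof (rule tendstoI)
    fix e :: real assume e: "e > 0"
    show "\<forall>\<^sub>F n in sequentially. dist (u (xs (r n))) (u z) < e"
      using lims[OF e]
    proof eventually_elim
      fix n assume "u (xs (r n)) < u z + e \<and> v z - e < v (ys (r n))"
      then show "dist (u (xs (r n))) (u z) < e"
        using ge[of "r n"] M(2)[OF zK] by (simp add: dist_real_def abs_less_iff)
    qed
  qed
  have vl: "(\<lambda>n. v (ys (r n))) \<longlonglongrightarrow> v z"
  proof (rule tendstoI)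
    fix e :: real assume e: "e > 0"
    show "\<forall>\<^sub>F n in sequentially. dist (v (ys (r n))) (v z) < e"
      using lims[OF e]
    proof eventually_elim
      fix n assume "u (xs (r n)) < u z + e \<and> v z - e < v (ys (r n))"
      then show "dist (v (ys (r n))) (v z) < e"
        using ge[of "r n"] M(2)[OF zK] by (simp add: dist_real_def abs_less_iff)
    qed
  qed
  have "M \<le> u z - v z"
    by (rule LIMSEQ_le_const[OF tendsto_diff[OF ul vl]]) (use ge in auto)
  then have uvz: "v z < u z" using M(1) by linarith
  \<comment> \<open>The bound for the term with b: \<delta>^\<theta> from Hoelder continuity times
    (2 L \<delta>^(- s))^\<beta> from the gradient, which gives the positive exponent \<epsilon> =
    \<theta> - s * \<beta>.\<close>
  define E where "E = (\<lambda>n. C * (2 * L) powr \<beta> * \<delta> n powr \<epsilon>)"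
  have ineq: "f (ys n) - g (xs n) + \<gamma> (u (xs n)) - \<gamma> (v (ys n)) \<le> E n" if small: "\<delta> n < \<rho>" for n
  proof -
    have in\<Omega>: "xs n \<in> \<Omega>" "ys n \<in> \<Omega>"
      using \<rho>(2)[OF K(1)[of n] K(2)[of n] _ ge[of n]] small by (auto simp: \<delta>_def)
    define j where "j = real (Suc n)"
    have j: "j > 0" by (simp add: j_def)
    define p where "p = j *\<^sub>R (xs n - ys n)"
    have up: "\<phi> n (xs n - ys n + h) \<le> \<phi> n (xs n - ys n) + p \<bullet> h + h \<bullet> (mat j *v h) / 2" for h
    proof -
      have "j / 2 * (norm (xs n - ys n + h))\<^sup>2 = j / 2 * (norm (xs n - ys n))\<^sup>2 + p \<bullet> h + h \<bullet> (mat j *v h) / 2"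
        unfolding mat_vector_mult p_def power2_norm_eq_inner
        by (simp add: inner_add_left inner_add_right inner_commute algebra_simps add_divide_distrib)
      then show ?thesis by (simp add: \<phi>_def j_def)
    qed
    \<comment> \<open>The expansion of the quadratic penalty is exact, so the radius and \<tau> may
      both be 1; from the matrix inequalities only X + Y \<le> 0 is kept.\<close>
    have "\<exists>X Y. symmetric_mat X \<and> symmetric_mat Y \<and> (\<forall>w. w \<bullet> ((X + Y) *v w) \<le> 0) \<and>
      f (ys n) - g (xs n) + \<gamma> (u (xs n)) - \<gamma> (v (ys n)) \<le> Fp F \<alpha> p X - Fp F \<alpha> p (- Y) + (b (ys n) - b (xs n)) * norm p powr \<beta>"
      by (rule doubling_inequality[OF in\<Omega> cont max zero_less_one up symmetric_mat_mat zero_less_one]) (assumption+, intro exI conjI allI)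
    then obtain X Y where XY0: "symmetric_mat X" "symmetric_mat Y" "\<forall>w. w \<bullet> ((X + Y) *v w) \<le> 0"
      "f (ys n) - g (xs n) + \<gamma> (u (xs n)) - \<gamma> (v (ys n)) \<le> Fp F \<alpha> p X - Fp F \<alpha> p (- Y) + (b (ys n) - b (xs n)) * norm p powr \<beta>"
      by (elim exE conjE)
    have diag: "(X + Y) $ i $ i \<le> 0" for i
      using XY0(3)[rule_format, of "axis i 1"]
      by (simp add: inner_axis' matrix_vector_mult_basis column_def)
    have "(\<Sum>i\<in>UNIV. \<bar>p $ i\<bar> powr \<alpha> * (X + Y) $ i $ i) \<le> 0"
      by (intro sum_nonpos mult_nonneg_nonpos diag) auto
    moreover have "a > 0" using F by (simp add: structural_F_def)
    ultimately have "a * (\<Sum>i\<in>UNIV. \<bar>p $ i\<bar> powr \<alpha> * (X + Y) $ i $ i) \<le> 0"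
      by (intro mult_nonneg_nonpos) auto
    then have ell: "Fp F \<alpha> p X - Fp F \<alpha> p (- Y) \<le> 0"
      using Fp_ellipticity[OF F XY0(1,2) XY0(3)[rule_format], of \<alpha> p] by linarith
    have "(b (ys n) - b (xs n)) * norm p powr \<beta> \<le> E n"
    proof (cases "\<delta> n = 0")
      case True
      then have "p = 0" by (simp add: p_def \<delta>_def)
      then show ?thesis using True \<beta>(1) \<epsilon> by (simp add: E_def)
    next
      case False
      then have \<delta>n: "\<delta> n > 0" by (simp add: \<delta>_def)
      have np: "norm p = j * \<delta> n" using j by (simp add: p_def \<delta>_def)
      have "j * \<delta> n * \<delta> n \<le> 2 * L * \<delta> n powr (- s) * \<delta> n"
      proof -
        have "\<delta> n powr \<kappa> = \<delta> n powr (- s) * \<delta> n"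
          using \<delta>n powr_add[of "\<delta> n" "- s" 1] by (simp add: \<kappa>_def)
        then show ?thesis using pen[of n] by (simp add: j_def power2_eq_square mult.assoc)
      qed
      then have "norm p \<le> 2 * L * \<delta> n powr (- s)" using \<delta>n np by simp
      then have "norm p powr \<beta> \<le> (2 * L * \<delta> n powr (- s)) powr \<beta>"
        using \<beta>(1) by (intro powr_mono2) auto
      also have "\<dots> = (2 * L) powr \<beta> * \<delta> n powr (- (s * \<beta>))"
        using L(1) by (simp add: powr_mult powr_powr)
      finally have pb: "norm p powr \<beta> \<le> (2 * L) powr \<beta> * \<delta> n powr (- (s * \<beta>))" .
      have "(b (ys n) - b (xs n)) * norm p powr \<beta> \<le> (C * \<delta> n powr \<theta>) * norm p powr \<beta>"
        using C[OF in\<Omega>] by (intro mult_right_mono) (auto simp: \<delta>_def)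
      also have "\<dots> \<le> (C * \<delta> n powr \<theta>) * ((2 * L) powr \<beta> * \<delta> n powr (- (s * \<beta>)))"
        by (intro mult_left_mono pb) (simp add: C_def)
      also have "\<dots> = C * (2 * L) powr \<beta> * (\<delta> n powr \<theta> * \<delta> n powr (- (s * \<beta>)))"
        by (simp add: mult_ac)
      also have "\<delta> n powr \<theta> * \<delta> n powr (- (s * \<beta>)) = \<delta> n powr \<epsilon>"
        by (simp add: powr_add[symmetric] \<epsilon>_def)
      finally show ?thesis by (simp add: E_def)
    qed
    then show ?thesis using XY0(4) ell by linarith
  qed
  have "(\<lambda>n. \<delta> (r n) powr \<epsilon>) \<longlonglongrightarrow> 0 powr \<epsilon>"
    using \<epsilon> by (intro tendsto_powr' tendsto_const \<delta>r) (auto simp: \<delta>_def)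
  then have El: "(\<lambda>n. E (r n)) \<longlonglongrightarrow> 0"
    unfolding E_def by (intro tendsto_mult_right_zero) simp
  have isC: "isCont f z" "isCont g z"
    using fg(1,2) \<Omega>(1) z by (auto simp: continuous_on_eq_continuous_at)
  have \<gamma>l: "isCont \<gamma> t" for t using \<gamma>(2) by (simp add: continuous_on_eq_continuous_at)
  have lim: "(\<lambda>n. f (ys (r n)) - g (xs (r n)) + \<gamma> (u (xs (r n))) - \<gamma> (v (ys (r n)))) \<longlonglongrightarrow> f z - g z + \<gamma> (u z) - \<gamma> (v z)"
    by (intro tendsto_add tendsto_diff isCont_tendsto_compose[OF isC(1) yl] isCont_tendsto_compose[OF isC(2) xl]
      isCont_tendsto_compose[OF \<gamma>l ul] isCont_tendsto_compose[OF \<gamma>l vl])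
  have "\<forall>\<^sub>F n in sequentially. \<delta> (r n) < \<rho>"
    using \<delta>r \<rho>(1) by (rule order_tendstoD(2))
  then have "\<forall>\<^sub>F n in sequentially. f (ys (r n)) - g (xs (r n)) + \<gamma> (u (xs (r n))) - \<gamma> (v (ys (r n))) \<le> E (r n)"
    by eventually_elim (rule ineq)
  then have "f z - g z + \<gamma> (u z) - \<gamma> (v z) \<le> 0"
    by (rule tendsto_le[OF sequentially_bot El lim])
  then show ?thesis using z uvz by blast
qed

end

theorem theorem2p4:
  fixes \<Omega> :: "(real^'n) set"
    and F :: "real^'n^'n \<Rightarrow> real"
    and a A \<alpha> \<beta> :: real
    and b f g u v :: "real^'n \<Rightarrow> real"
    and \<gamma> :: "real \<Rightarrow> real"
  assumes dom: "C2_domain \<Omega>" "bounded \<Omega>"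
    and alpha: "0 < \<alpha>" "\<alpha> + 1 \<le> \<beta>" "\<beta> \<le> \<alpha> + 2"
    and F: "structural_F F a A"
    and b: "holder_on \<Omega> b"
    and gam: "mono \<gamma>" "continuous_on UNIV \<gamma>" "\<gamma> 0 = 0"
    and fg: "continuous_on \<Omega> f" "continuous_on \<Omega> g" "bounded (f ` \<Omega>)" "bounded (g ` \<Omega>)"
            "\<forall>x\<in>\<Omega>. g x \<le> f x"
    and usc: "usc_on (closure \<Omega>) u"
    and lsc: "lsc_on (closure \<Omega>) v"
    and sub: "visc_sub F \<alpha> \<beta> b \<gamma> g \<Omega> u"
    and super: "visc_super F \<alpha> \<beta> b \<gamma> f \<Omega> v"
    and strict: "(\<forall>x\<in>\<Omega>. g x < f x) \<or> strict_mono \<gamma>"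
    and bdry: "\<forall>x\<in>frontier \<Omega>. u x \<le> v x"
  shows "\<forall>x\<in>\<Omega>. u x \<le> v x"
proof (rule ccontr)
  assume "\<not> (\<forall>x\<in>\<Omega>. u x \<le> v x)"
  then obtain x1 where x1: "x1 \<in> \<Omega>" "v x1 < u x1" by (auto simp: not_le)
  have "closure \<Omega> \<noteq> {}" using x1(1) by auto
  moreover have "compact (closure \<Omega>)" using dom(2) by (simp add: compact_closure)
  ultimately obtain x0 where x0: "x0 \<in> closure \<Omega>" "\<And>y. y \<in> closure \<Omega> \<Longrightarrow> u y - v y \<le> u x0 - v x0"
    using usc_on_attains_max[OF _ _ usc_on_diff[OF usc lsc]] by blast
  have "u x1 - v x1 \<le> u x0 - v x0" using x1(1) closure_subset by (intro x0(2)) blast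
  then have "u x0 - v x0 > 0" using x1(2) by linarith
  moreover have le: "\<forall>x\<in>\<Omega>. g x \<le> f x" by (rule fg(5))
  ultimately interpret viscosity_pair \<Omega> F a A \<alpha> \<beta> b f g u v \<gamma> "u x0 - v x0"
    using dom alpha F b gam fg usc lsc sub super bdry x0 x1(1)
    by unfold_locales (auto simp: C2_domain_def)
  obtain z where z: "z \<in> \<Omega>" "v z < u z" "f z - g z + \<gamma> (u z) - \<gamma> (v z) \<le> 0"
    using comparison_point[OF x0(1) refl] by blast
  \<comment> \<open>Both differences in the inequality at z are nonnegative, and the strictness
    hypothesis makes one of them positive.\<close>
  have "\<gamma> (v z) \<le> \<gamma> (u z)" using gam(1) z(2) by (simp add: mono_def)
  moreover have "g z \<le> f z" using le z(1) by blast
  moreover have "g z < f z \<or> \<gamma> (v z) < \<gamma> (u z)"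
    using strict z(1,2) by (auto simp: strict_mono_def)
  ultimately show False using z(3) by linarith
qed

end
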